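(* Let $\Omega\subset\mathbb{C}^n$ be a bounded convex domain and $0\le M\le N$ integers. For $\varepsilon$ in a neighborhood of $0$ in $\mathbb{C}$, let $S(\varepsilon)=\{a_j(\varepsilon),1\le j\le M;\ a'_j(\varepsilon),a''_j(\varepsilon),M+1\le j\le N\}\subset\Omega$ be a finite set of points which are pairwise distinct for each fixed $\varepsilon$, with $\lim_{\varepsilon\to0}a_j(\varepsilon)=a_j\in\Omega$ ($1\le j\le M$), $\lim_{\varepsilon\to0}a'_j(\varepsilon)=\lim_{\varepsilon\to0}a''_j(\varepsilon)=a_j\in\Omega$ ($M+1\le j\le N$), the points $a_1,\dots,a_N$ being pairwise distinct, and $\lim_{\varepsilon\to0}[a''_j(\varepsilon)-a'_j(\varepsilon)]=[v_j]$ in $\mathbb{P}^{n-1}$ for $M+1\le j\le N$, where $v_j$ is chosen with $\|v_j\|=1$. Let $\Psi_j(z)=\log\|z\|$ for $1\le j\le M$, and for $M+1\le j\le N$ let $\pi_j$ be the orthogonal projection onto $\{v_j\}^\perp$ and $\Psi_j(z)=\max(\log\|\pi_j(z)\|,2\log|z\cdot\bar v_j|)$. Let $S=\{(a_j,\Psi_j):1\le j\le N\}$. Then for all $z\in\Omega$, $$\lim_{\varepsilon\to0}\ell_{S(\varepsilon)}(z)=\lim_{\varepsilon\to0}\mathcal{L}_{S(\varepsilon)}(z)=\mathcal{L}_S(z).$$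
   Context: $\mathbb{D}$ is the unit disk, $z\cdot\bar w=\sum_jz_j\bar w_j$, $\|z\|=(z\cdot\bar z)^{1/2}$, and $[z]$ is the class of $z\neq0$ in $\mathbb{P}^{n-1}$. Coman's Lempert function: for distinct points $b_1,\dots,b_K\in\Omega$, $\ell_{\{b_1,\dots,b_K\}}(z)=\inf\{\sum_{k}\log|\zeta_k|:\exists\varphi\in Hol(\mathbb{D},\Omega),\varphi(0)=z,\varphi(\zeta_k)=b_k,1\le k\le K\}$. Multiplicity: for a function $\Psi$ near $0$ with Monge–Ampère mass $\tau_\Psi$ at $0$ (here $\tau=1$ for $\log\|z\|$ and $\tau=2$ for $\max(\log\|\pi_j z\|,2\log|z\cdot\bar v_j|)$), $\varphi\in Hol(\mathbb{D},\Omega)$, $\alpha\in\mathbb{D}$, $a\in\Omega$: if $\varphi(\alpha)=a$, $m_{\varphi,a,\Psi}(\alpha)=\min\big(\tau_\Psi,\liminf_{\zeta\to0}\Psi(\varphi(\alpha+\zeta)-a)/\log|\zeta|\big)$; else $0$. Generalized Lempert function of a system $T=\{(b_k,\Phi_k)\}$ (distinct points $b_k\in\Omega$, indicators $\Phi_k$ with masses $\tau_k$): $(\varphi,(A_k))$, $\varphi\in Hol(\mathbb{D},\Omega)$, $A_k\subset\mathbb{D}$, is admissible for $T,z$ if $\varphi(0)=z$, $A_k\subset\varphi^{-1}(b_k)$ and $\sum_{\alpha\in A_k}m_{\varphi,b_k,\Phi_k}(\alpha)\le\tau_k$ (empty $A_k$ allowed); $\mathcal{L}_T(z)=\inf\sum_k\sum_{\alpha\in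 A_k}m_{\varphi,b_k,\Phi_k}(\alpha)\log|\alpha|$ over admissible pairs (with $0\cdot\infty=0$). For the point set $S(\varepsilon)$, $\mathcal{L}_{S(\varepsilon)}$ means $\mathcal{L}_T$ with each point of $S(\varepsilon)$ equipped with $\Phi(z)=\log\|z\|$ (mass $1$). *)

theory Defs
  imports "HOL-Analysis.Analysis"
begin

type_synonym 'n cvec = "complex ^ 'n"

definition elog :: "real \<Rightarrow> ereal" where
  "elog x = (if x \<le> 0 then -\<infinity> else ereal (ln x))"

definition cdot :: "'n::finite cvec \<Rightarrow> 'n cvec \<Rightarrow> complex" where
  "cdot z w = (\<Sum>i\<in>UNIV. z $ i * cnj (w $ i))"

definition HolD :: "'n::finite cvec set \<Rightarrow> (complex \<Rightarrow> 'n cvec) set" where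
  "HolD \<Omega> = {\<phi>. (\<forall>i. (\<lambda>\<zeta>. \<phi> \<zeta> $ i) holomorphic_on ball 0 1) \<and> \<phi> ` ball 0 1 \<subseteq> \<Omega>}"

definition coman_lempert :: "'n::finite cvec set \<Rightarrow> 'n cvec set \<Rightarrow> 'n cvec \<Rightarrow> ereal" where
  "coman_lempert \<Omega> P z = Inf {(\<Sum>b\<in>P. elog (cmod (\<zeta> b))) | \<phi> \<zeta>.
      \<phi> \<in> HolD \<Omega> \<and> \<phi> 0 = z \<and> (\<forall>b\<in>P. \<zeta> b \<in> ball 0 1 \<and> \<phi> (\<zeta> b) = b)}"

text \<open>Multiplicity m_{phi,a,Psi}(alpha), Psi with Monge-Ampere mass tau.\<close>
definition mult :: "(complex \<Rightarrow> 'n::finite cvec) \<Rightarrow> 'n cvec \<Rightarrow> ('n cvec \<Rightarrow> ereal) \<Rightarrow> ereal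
    \<Rightarrow> complex \<Rightarrow> ereal" where
  "mult \<phi> a \<Psi> \<tau> \<alpha> = (if \<phi> \<alpha> = a then
      min \<tau> (Liminf (at 0) (\<lambda>\<zeta>. \<Psi> (\<phi> (\<alpha> + \<zeta>) - a) / ereal (ln (cmod \<zeta>))))
    else 0)"

definition gen_lempert :: "'n::finite cvec set \<Rightarrow> 'k set \<Rightarrow> ('k \<Rightarrow> 'n cvec)
    \<Rightarrow> ('k \<Rightarrow> 'n cvec \<Rightarrow> ereal) \<Rightarrow> ('k \<Rightarrow> ereal) \<Rightarrow> 'n cvec \<Rightarrow> ereal" where
  "gen_lempert \<Omega> K b \<Phi> \<tau> z = Inf
     {(\<Sum>k\<in>K. \<Sum>\<alpha>\<in>A k. mult \<phi> (b k) (\<Phi> k) (\<tau> k) \<alpha> * elog (cmod \<alpha>)) | \<phi> A.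
        \<phi> \<in> HolD \<Omega> \<and> \<phi> 0 = z \<and>
        (\<forall>k\<in>K. finite (A k) \<and> A k \<subseteq> ball 0 1 \<and> A k \<subseteq> \<phi> -` {b k} \<and>
               (\<Sum>\<alpha>\<in>A k. mult \<phi> (b k) (\<Phi> k) (\<tau> k) \<alpha>) \<le> \<tau> k)}"

text \<open>Indicators: log||z|| (mass 1) and max(log||pi_v z||, 2 log|z . conj v|) (mass 2).\<close>
definition Psi_pt :: "'n::finite cvec \<Rightarrow> ereal" where
  "Psi_pt z = elog (norm z)"

definition Psi_dir :: "'n::finite cvec \<Rightarrow> 'n cvec \<Rightarrow> ereal" where
  "Psi_dir v z = max (elog (norm (z - cdot z v *s v))) (2 * elog (cmod (cdot z v)))"

definition gen_lempert_pts :: "'n::finite cvec set \<Rightarrow> 'n cvec set \<Rightarrow> 'n cvec \<Rightarrow> ereal" where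
  "gen_lempert_pts \<Omega> P = gen_lempert \<Omega> P id (\<lambda>_. Psi_pt) (\<lambda>_. 1)"

text \<open>Standard (sine-of-angle / Fubini-Study chordal) distance between the classes [u],[w] in P^{n-1}.\<close>
definition proj_dist :: "'n::finite cvec \<Rightarrow> 'n cvec \<Rightarrow> real" where
  "proj_dist u w = sqrt (1 - (cmod (cdot u w))\<^sup>2 / ((norm u)\<^sup>2 * (norm w)\<^sup>2))"

end

theory Submission
  imports Defs "HOL-Complex_Analysis.Complex_Analysis"
begin

text \<open>On a convex domain, prescribing additional points can only decrease Coman's function: with \<open>g\<close>
  mapping the disc into a thin neighbourhood of \<open>[0,1]\<close>, vanishing at the old nodes and equal to 1
  somewhere, the map \<open>(1 - g) \<phi>(r \<cdot>) + g p\<close> stays in \<open>\<Omega>\<close>. Hence, for point systems, the generalized Lempert function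
  agrees with Coman's.

  Upper bound: a competitor for the limit system is dilated and corrected by small Newton interpolation
  polynomials so as to hit the moving poles; a node of multiplicity 2, where the derivative is parallel to \<open>v\<^sub>j\<close>,
  is split into two nodes whose gap is adapted to \<open>a''\<^sub>j - a'\<^sub>j\<close>.

  Lower bound: by Montel, near-optimal discs and their nodes converge along a subsequence. Colliding nodes force
  the limit derivative to be parallel to \<open>v\<^sub>j\<close>, that is, multiplicity 2. If the nodes stay apart but one of them
  happens to have multiplicity 2, the total would exceed the mass; a small perturbation with
  prescribed derivatives makes both multiplicities 1 (in dimension 1, both are 2 and one keeps the node of smaller modulus).\<close>

section \<open>Vector-valued holomorphic maps and multiplicities\<close>

text \<open>A disc in \<open>HolD \<Omega>\<close> may come arbitrarily close to the boundary of
  \<Omega>. Every modification is therefore preceded by a dilation with factor r < 1: the image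
  becomes relatively compact, which leaves room for a perturbation, and each node pays - ln r, a
  cost that vanishes as r tends to 1. The two halves of a split node merge in the limit, where
  Lagrange interpolation would blow up. In Newton's form the second coefficient is a divided
  difference; the gap is chosen so that the difference quotient of the poles tends to the derivative
  of the disc, and then this coefficient tends to 0. At a node over a double pole the multiplicity
  is 1 or 2, never in between: it only depends on whether the part of the derivative orthogonal to v
  vanishes. Colliding nodes of a limit disc thus match the mass 2 exactly. Nodes of a limit disc may
  escape to the unit circle. They contribute ln 1 = 0, and an empty node set over the pole accounts
  for them. If z is itself a limit pole, nodes may sit at 0, where the logarithm is not continuous;
  this case is settled separately, with limit -\<infinity>.\<close>

lemma elog_pos: "x > 0 \<Longrightarrow> elog x = ereal (ln x)"
  by (simp add: elog_def)

lemma elog_0: "elog 0 = -\<infinity>"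
  by (simp add: elog_def)

lemma elog_nonpos: "x \<le> 1 \<Longrightarrow> elog x \<le> 0"
  by (auto simp: elog_def)

lemma elog_mono: "x \<le> y \<Longrightarrow> elog x \<le> elog y"
  by (auto simp: elog_def)

lemma elog_le: "0 \<le> x \<Longrightarrow> x \<le> exp y \<Longrightarrow> elog x \<le> ereal y"
  using ln_mono[of x "exp y"] by (auto simp: elog_def)

lemma two_times_ereal: "2 * ereal x = ereal (2 * x)"
  by (metis numeral_eq_ereal times_ereal.simps(1))

lemma norm_vector_smult: "norm (c *s (y :: complex ^ 'n::finite)) = cmod c * norm y"
  by (simp add: norm_vec_def norm_mult L2_set_right_distrib)

lemma cdot_add: "cdot (x + y) v = cdot x v + cdot y v"
  by (simp add: cdot_def algebra_simps sum.distrib)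

lemma cdot_diff: "cdot (x - y) v = cdot x v - cdot y v"
  by (simp add: cdot_def algebra_simps sum_subtractf)

lemma cdot_smult: "cdot (c *s x) v = c * cdot x v"
  by (simp add: cdot_def sum_distrib_left mult.assoc)

lemma cdot_self: "cdot v v = complex_of_real ((norm v)\<^sup>2)"
proof -
  have "(norm v)\<^sup>2 = (\<Sum>i\<in>UNIV. (cmod (v $ i))\<^sup>2)"
    by (simp add: norm_vec_def L2_set_def sum_nonneg)
  then show ?thesis
    by (simp add: cdot_def flip: complex_norm_square)
qed

lemma tendsto_cdot [tendsto_intros]:
  "(f \<longlongrightarrow> l) F \<Longrightarrow> ((\<lambda>x. cdot (f x) v) \<longlongrightarrow> cdot l v) F"
  unfolding cdot_def by (intro tendsto_intros)

lemma tendsto_smult [tendsto_intros]: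
  fixes f :: "'b \<Rightarrow> complex" and g :: "'b \<Rightarrow> complex ^ 'n::finite"
  assumes "(f \<longlongrightarrow> c) F" "(g \<longlongrightarrow> y) F"
  shows "((\<lambda>x. f x *s g x) \<longlongrightarrow> c *s y) F"
  by (rule vec_tendstoI) (simp add: tendsto_mult[OF assms(1) tendsto_vec_nth[OF assms(2)]])

text \<open>This is the orthogonal projection onto the complement of v for unit vectors v; the
  formula does not divide by the squared norm of v.\<close>

definition cproj :: "complex ^ 'n::finite \<Rightarrow> complex ^ 'n \<Rightarrow> complex ^ 'n" where
  "cproj v u = u - cdot u v *s v"

lemma cproj_diff: "cproj v (x - y) = cproj v x - cproj v y"
  by (simp add: cproj_def cdot_diff vec_eq_iff algebra_simps)

lemma cproj_add: "cproj v (x + y) = cproj v x + cproj v y"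
  by (simp add: cproj_def cdot_add vec_eq_iff algebra_simps)

lemma cproj_smult: "cproj v (c *s x) = c *s cproj v x"
  by (simp add: cproj_def cdot_smult vec_eq_iff algebra_simps)

lemma tendsto_cproj [tendsto_intros]:
  "(f \<longlongrightarrow> l) F \<Longrightarrow> ((\<lambda>x. cproj v (f x)) \<longlongrightarrow> cproj v l) F"
  unfolding cproj_def by (intro tendsto_intros)

lemma inner_eq_Re_cdot: "x \<bullet> y = Re (cdot x y)"
  by (simp add: cdot_def inner_vec_def inner_complex_def)

text \<open>Pythagoras: the real inner product is the real part of \<open>cdot\<close>, so Hermitian
  orthogonality implies real orthogonality.\<close>

lemma norm_cproj_sq:
  fixes u v :: "complex ^ 'n::finite"
  assumes "norm v = 1"
  shows "(norm u)\<^sup>2 = (norm (cproj v u))\<^sup>2 + (cmod (cdot u v))\<^sup>2"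
proof -
  have "cdot (cproj v u) v = 0"
    by (simp add: cproj_def cdot_diff cdot_smult cdot_self assms)
  moreover have "cdot x (c *s y) = cnj c * cdot x y" for x y :: "complex ^ 'n" and c
    by (simp add: cdot_def sum_distrib_left mult_ac)
  ultimately have "cproj v u \<bullet> (cdot u v *s v) = 0"
    by (simp add: inner_eq_Re_cdot)
  moreover have "u = cproj v u + cdot u v *s v"
    by (simp add: cproj_def)
  ultimately have "(norm u)\<^sup>2 = (norm (cproj v u))\<^sup>2 + (norm (cdot u v *s v))\<^sup>2"
    by (metis norm_add_Pythagorean orthogonal_def)
  then show ?thesis
    by (simp add: norm_vector_smult assms)
qed

text \<open>By Pythagoras \<open>proj_dist\<close> is the sine of the angle between u and the line
  of v. This turns convergence in projective space into smallness of the transversal part.\<close>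

lemma norm_cproj_eq_proj_dist:
  assumes "norm v = 1"
  shows "norm (cproj v u) = norm u * proj_dist u v"
proof (cases "u = 0")
  case False
  have "1 - (cmod (cdot u v))\<^sup>2 / (norm u)\<^sup>2 = (norm (cproj v u))\<^sup>2 / (norm u)\<^sup>2"
    using False arg_cong[OF norm_cproj_sq[OF assms, of u], of "\<lambda>t. t / (norm u)\<^sup>2"]
    by (simp add: add_divide_distrib)
  then have "proj_dist u v = norm (cproj v u) / norm u"
    by (simp add: proj_dist_def assms real_sqrt_divide)
  then show ?thesis using False by simp
qed (simp add: cproj_def cdot_def)

lemma norm_cproj_le: "norm v = 1 \<Longrightarrow> norm (cproj v u) \<le> norm u"
  by (rule power2_le_imp_le) (metis norm_cproj_sq le_add_same_cancel1 zero_le_power2, simp)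

lemma cmod_cdot_le: "norm v = 1 \<Longrightarrow> cmod (cdot u v) \<le> norm u"
  by (rule power2_le_imp_le) (metis norm_cproj_sq le_add_same_cancel2 zero_le_power2, simp)

section \<open>Vector-valued holomorphic maps and their derivatives\<close>

definition vholo :: "(complex \<Rightarrow> complex ^ 'n::finite) \<Rightarrow> complex set \<Rightarrow> bool" where
  "vholo \<phi> U \<longleftrightarrow> (\<forall>i. (\<lambda>\<zeta>. \<phi> \<zeta> $ i) holomorphic_on U)"

definition vderiv :: "(complex \<Rightarrow> complex ^ 'n::finite) \<Rightarrow> complex \<Rightarrow> complex ^ 'n" where
  "vderiv \<phi> \<alpha> = (\<chi> i. deriv (\<lambda>\<zeta>. \<phi> \<zeta> $ i) \<alpha>)"

lemma HolD_iff: "\<phi> \<in> HolD \<Omega> \<longleftrightarrow> vholo \<phi> (ball 0 1) \<and> \<phi> ` ball 0 1 \<subseteq> \<Omega>"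
  by (auto simp: HolD_def vholo_def)

lemma vholo_add: "vholo f U \<Longrightarrow> vholo g U \<Longrightarrow> vholo (\<lambda>\<zeta>. f \<zeta> + g \<zeta>) U"
  by (auto simp: vholo_def intro!: holomorphic_intros)

lemma vholo_diff: "vholo f U \<Longrightarrow> vholo g U \<Longrightarrow> vholo (\<lambda>\<zeta>. f \<zeta> - g \<zeta>) U"
  by (auto simp: vholo_def intro!: holomorphic_intros)

lemma vholo_const: "vholo (\<lambda>\<zeta>. c) U"
  by (auto simp: vholo_def intro!: holomorphic_intros)

lemma vholo_smult: "f holomorphic_on U \<Longrightarrow> vholo g U \<Longrightarrow> vholo (\<lambda>\<zeta>. f \<zeta> *s g \<zeta>) U"
  by (auto simp: vholo_def intro!: holomorphic_intros)

lemma vholo_cdot: "vholo f U \<Longrightarrow> (\<lambda>\<zeta>. cdot (f \<zeta>) v) holomorphic_on U"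
  by (auto simp: vholo_def cdot_def intro!: holomorphic_intros)

lemma vholo_cproj: "vholo f U \<Longrightarrow> vholo (\<lambda>\<zeta>. cproj v (f \<zeta>)) U"
  unfolding cproj_def by (intro vholo_diff vholo_smult vholo_cdot vholo_const)

lemma vholo_subset: "vholo f U \<Longrightarrow> V \<subseteq> U \<Longrightarrow> vholo f V"
  by (auto simp: vholo_def intro: holomorphic_on_subset)

lemma vholo_compose: "vholo f V \<Longrightarrow> g holomorphic_on U \<Longrightarrow> g ` U \<subseteq> V \<Longrightarrow> vholo (\<lambda>\<zeta>. f (g \<zeta>)) U"
  unfolding vholo_def using holomorphic_on_compose_gen[unfolded o_def] by blast

lemma vholo_continuous: "vholo f U \<Longrightarrow> continuous_on U f"
proof -
  assume "vholo f U"
  then have "continuous_on U (\<lambda>x. \<chi> i. f x $ i)"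
    by (intro continuous_on_vec_lambda) (auto simp: vholo_def intro: holomorphic_on_imp_continuous_on)
  then show ?thesis by simp
qed

lemma vholo_diffquot:
  assumes "vholo \<phi> U" "open U" "\<alpha> \<in> U"
  shows "((\<lambda>h. (1 / h) *s (\<phi> (\<alpha> + h) - \<phi> \<alpha>)) \<longlongrightarrow> vderiv \<phi> \<alpha>) (at 0)"
proof (rule vec_tendstoI)
  fix i
  have "((\<lambda>\<zeta>. \<phi> \<zeta> $ i) has_field_derivative deriv (\<lambda>\<zeta>. \<phi> \<zeta> $ i) \<alpha>) (at \<alpha>)"
    using assms holomorphic_derivI unfolding vholo_def by blast
  then show "((\<lambda>h. ((1 / h) *s (\<phi> (\<alpha> + h) - \<phi> \<alpha>)) $ i) \<longlongrightarrow> vderiv \<phi> \<alpha> $ i) (at 0)"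
    by (simp add: DERIV_def vderiv_def diff_divide_distrib)
qed

lemma vderiv_unique:
  assumes "vholo \<phi> U" "open U" "\<alpha> \<in> U"
    and "((\<lambda>h. (1 / h) *s (\<phi> (\<alpha> + h) - \<phi> \<alpha>)) \<longlongrightarrow> d) (at 0)"
  shows "vderiv \<phi> \<alpha> = d"
  using tendsto_unique[OF _ vholo_diffquot[OF assms(1-3)] assms(4)] by simp

lemma vderiv_cproj:
  assumes "vholo \<phi> U" "open U" "\<alpha> \<in> U"
  shows "vderiv (\<lambda>\<zeta>. cproj v (\<phi> \<zeta> - a)) \<alpha> = cproj v (vderiv \<phi> \<alpha>)"
proof (rule vderiv_unique[OF _ assms(2,3)])
  show "vholo (\<lambda>\<zeta>. cproj v (\<phi> \<zeta> - a)) U"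
    by (intro vholo_cproj vholo_diff assms vholo_const)
  have "((\<lambda>h. cproj v ((1 / h) *s (\<phi> (\<alpha> + h) - \<phi> \<alpha>))) \<longlongrightarrow> cproj v (vderiv \<phi> \<alpha>)) (at 0)"
    by (intro tendsto_intros vholo_diffquot[OF assms])
  then show "((\<lambda>h. (1 / h) *s (cproj v (\<phi> (\<alpha> + h) - a) - cproj v (\<phi> \<alpha> - a))) \<longlongrightarrow> cproj v (vderiv \<phi> \<alpha>)) (at 0)"
    by (simp add: cproj_diff cproj_smult)
qed

lemma norm_le_sum_cmod: "norm (x :: complex ^ 'n::finite) \<le> (\<Sum>i\<in>UNIV. cmod (x $ i))"
  unfolding norm_vec_def by (rule L2_set_le_sum) auto

text \<open>Taylor's formula of first order at \<alpha>: value and derivative vanish, and the second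
  derivative is bounded on a closed disc around \<alpha>.\<close>

lemma holomorphic_quadratic_bound:
  assumes "f holomorphic_on U" "open U" "\<alpha> \<in> U" "f \<alpha> = 0" "deriv f \<alpha> = 0"
  shows "\<exists>C. \<forall>\<^sub>F h in at 0. cmod (f (\<alpha> + h)) \<le> C * (cmod h)\<^sup>2"
proof -
  obtain r where r: "r > 0" "cball \<alpha> r \<subseteq> U"
    using assms(2,3) open_contains_cball by blast
  have hol: "(deriv ^^ n) f holomorphic_on U" for n
    by (rule holomorphic_higher_deriv[OF assms(1,2)])
  have "compact ((deriv ^^ 2) f ` cball \<alpha> r)"
    by (intro compact_continuous_image holomorphic_on_imp_continuous_on
        holomorphic_on_subset[OF hol r(2)]) auto
  then obtain B where B: "\<And>x. x \<in> cball \<alpha> r \<Longrightarrow> cmod ((deriv ^^ 2) f x) \<le> B"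
    using compact_imp_bounded bounded_iff by (metis imageI)
  have "cmod (f (\<alpha> + h)) \<le> B * (cmod h)\<^sup>2" if "cmod h < r" for h
  proof -
    have "cmod ((deriv ^^ 0) f (\<alpha> + h) - (\<Sum>i\<le>1. (deriv ^^ i) f \<alpha> * (\<alpha> + h - \<alpha>) ^ i / fact i))
        \<le> B * cmod (\<alpha> + h - \<alpha>) ^ Suc 1 / fact 1"
    proof (rule complex_Taylor[of "cball \<alpha> r" 1 "\<lambda>i. (deriv ^^ i) f"])
      fix i x assume "x \<in> cball \<alpha> r"
      then show "((deriv ^^ i) f has_field_derivative (deriv ^^ Suc i) f x) (at x within cball \<alpha> r)"
        using holomorphic_derivI[OF hol assms(2)] r(2) has_field_derivative_at_within
        by (metis comp_apply funpow.simps(2) subsetD)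
    qed (use B that r in \<open>auto simp: dist_norm numeral_2_eq_2\<close>)
    then show ?thesis
      using assms(4,5) by (simp add: power2_eq_square)
  qed
  then show ?thesis
    using r(1) by (intro exI[of _ B]) (auto simp: eventually_at dist_norm intro!: exI[of _ r])
qed

lemma vholo_quadratic_bound:
  assumes "vholo \<phi> U" "open U" "\<alpha> \<in> U" "\<phi> \<alpha> = 0" "vderiv \<phi> \<alpha> = 0"
  shows "\<exists>C. \<forall>\<^sub>F h in at 0. norm (\<phi> (\<alpha> + h)) \<le> C * (cmod h)\<^sup>2"
proof -
  have "\<exists>C. \<forall>\<^sub>F h in at 0. cmod (\<phi> (\<alpha> + h) $ i) \<le> C * (cmod h)\<^sup>2" for i
    using assms by (intro holomorphic_quadratic_bound[of _ U]) (auto simp: vholo_def vderiv_def vec_eq_iff)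
  then obtain C where C: "\<And>i. \<forall>\<^sub>F h in at 0. cmod (\<phi> (\<alpha> + h) $ i) \<le> C i * (cmod h)\<^sup>2"
    by metis
  have "\<forall>\<^sub>F h in at 0. \<forall>i. cmod (\<phi> (\<alpha> + h) $ i) \<le> C i * (cmod h)\<^sup>2"
    using eventually_all_finite[OF C] .
  then have "\<forall>\<^sub>F h in at 0. norm (\<phi> (\<alpha> + h)) \<le> (\<Sum>i\<in>UNIV. C i) * (cmod h)\<^sup>2"
  proof eventually_elim
    case (elim h)
    have "norm (\<phi> (\<alpha> + h)) \<le> (\<Sum>i\<in>UNIV. cmod (\<phi> (\<alpha> + h) $ i))"
      by (rule norm_le_sum_cmod)
    also have "\<dots> \<le> (\<Sum>i\<in>UNIV. C i * (cmod h)\<^sup>2)"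
      using elim by (intro sum_mono) auto
    finally show ?case by (simp add: sum_distrib_right)
  qed
  then show ?thesis by blast
qed

lemma vholo_linear_bound:
  assumes "vholo \<phi> U" "open U" "\<alpha> \<in> U"
  shows "\<exists>C>0. \<forall>\<^sub>F h in at 0. norm (\<phi> (\<alpha> + h) - \<phi> \<alpha>) \<le> C * cmod h"
proof -
  let ?C = "norm (vderiv \<phi> \<alpha>) + 1"
  have "((\<lambda>h. norm ((1 / h) *s (\<phi> (\<alpha> + h) - \<phi> \<alpha>))) \<longlongrightarrow> norm (vderiv \<phi> \<alpha>)) (at 0)"
    by (intro tendsto_intros vholo_diffquot[OF assms])
  then have "\<forall>\<^sub>F h in at 0. norm ((1 / h) *s (\<phi> (\<alpha> + h) - \<phi> \<alpha>)) < ?C"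
    by (rule order_tendstoD) simp
  moreover have "\<forall>\<^sub>F h :: complex in at 0. h \<noteq> 0"
    by (simp add: eventually_at_filter)
  ultimately have "\<forall>\<^sub>F h in at 0. norm (\<phi> (\<alpha> + h) - \<phi> \<alpha>) \<le> ?C * cmod h"
  proof eventually_elim
    case (elim h)
    then have "norm (\<phi> (\<alpha> + h) - \<phi> \<alpha>) / cmod h < ?C"
      by (simp only: norm_vector_smult norm_divide norm_one mult_1 times_divide_eq_left)
    then show ?case
      using elim(2) by (simp add: pos_divide_less_eq)
  qed
  then show ?thesis
    by (intro exI[of _ ?C]) (auto intro: add_nonneg_pos)
qed

section \<open>Multiplicities read off from first-order behaviour\<close>

lemma tendsto_const_div_ln: "((\<lambda>h::complex. k + C / ln (cmod h)) \<longlongrightarrow> k) (at 0)"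
proof -
  have "filterlim (\<lambda>h::complex. cmod h) (at_right 0) (at 0)"
    by (auto simp: filterlim_at eventually_at_filter intro!: tendsto_eq_intros)
  then have "filterlim (\<lambda>h::complex. ln (cmod h)) at_bot (at 0)"
    using filterlim_compose[OF ln_at_0] by blast
  then have "((\<lambda>h::complex. C / ln (cmod h)) \<longlongrightarrow> 0) (at 0)"
    by (intro tendsto_divide_0[OF tendsto_const]) (auto intro: filterlim_mono[OF _ at_bot_le_at_infinity])
  from tendsto_add[OF tendsto_const this] show ?thesis by simp
qed

lemma ereal_divide_neg_antimono:
  assumes "x \<le> ereal y" "c < 0"
  shows "ereal (y / c) \<le> x / ereal c"
  using assms by (cases x) (auto simp: divide_right_mono_neg divide_ereal_def divide_simps)

lemma ereal_divide_neg_antimono':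
  assumes "ereal y \<le> x" "c < 0"
  shows "x / ereal c \<le> ereal (y / c)"
  using assms by (cases x) (auto simp: divide_right_mono_neg divide_ereal_def divide_simps)

lemma eventually_small_nonzero: "r > 0 \<Longrightarrow> \<forall>\<^sub>F h :: complex in at 0. 0 < cmod h \<and> cmod h < r"
  by (auto simp: eventually_at dist_norm)

text \<open>Dividing by ln |h| < 0 reverses inequalities, so an upper bound on \<Psi> bounds the
  multiplicity from below. The constant C is harmless because C / ln |h| tends to 0.\<close>

lemma mult_ge:
  assumes "\<phi> \<alpha> = a" "ereal k \<le> \<tau>"
    and ev: "\<forall>\<^sub>F h in at 0. \<Psi> (\<phi> (\<alpha> + h) - a) \<le> ereal (k * ln (cmod h) + C)"
  shows "ereal k \<le> mult \<phi> a \<Psi> \<tau> \<alpha>"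
proof -
  have "\<forall>\<^sub>F h in at 0. ereal (k + C / ln (cmod h)) \<le> \<Psi> (\<phi> (\<alpha> + h) - a) / ereal (ln (cmod h))"
    using ev eventually_small_nonzero[OF zero_less_one]
  proof eventually_elim
    case (elim h)
    then have "ln (cmod h) < 0" by simp
    with ereal_divide_neg_antimono[OF elim(1) this] show ?case
      by (simp add: add_divide_distrib)
  qed
  then have "Liminf (at 0) (\<lambda>h::complex. ereal (k + C / ln (cmod h)))
      \<le> Liminf (at 0) (\<lambda>h. \<Psi> (\<phi> (\<alpha> + h) - a) / ereal (ln (cmod h)))"
    by (rule Liminf_mono)
  moreover have "Liminf (at 0) (\<lambda>h::complex. ereal (k + C / ln (cmod h))) = ereal k"
    by (intro lim_imp_Liminf tendsto_intros tendsto_const_div_ln) simp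
  ultimately show ?thesis
    using assms(1,2) by (simp add: mult_def)
qed

lemma mult_le:
  assumes "\<phi> \<alpha> = a"
    and ev: "\<forall>\<^sub>F h in at 0. ereal (k * ln (cmod h) + C) \<le> \<Psi> (\<phi> (\<alpha> + h) - a)"
  shows "mult \<phi> a \<Psi> \<tau> \<alpha> \<le> ereal k"
proof -
  have "\<forall>\<^sub>F h in at 0. \<Psi> (\<phi> (\<alpha> + h) - a) / ereal (ln (cmod h)) \<le> ereal (k + C / ln (cmod h))"
    using ev eventually_small_nonzero[OF zero_less_one]
  proof eventually_elim
    case (elim h)
    then have "ln (cmod h) < 0" by simp
    with ereal_divide_neg_antimono'[OF elim(1) this] show ?case
      by (simp add: add_divide_distrib)
  qed
  then have "Liminf (at 0) (\<lambda>h. \<Psi> (\<phi> (\<alpha> + h) - a) / ereal (ln (cmod h)))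
      \<le> Liminf (at 0) (\<lambda>h::complex. ereal (k + C / ln (cmod h)))"
    by (rule Liminf_mono)
  moreover have "Liminf (at 0) (\<lambda>h::complex. ereal (k + C / ln (cmod h))) = ereal k"
    by (intro lim_imp_Liminf tendsto_intros tendsto_const_div_ln) simp
  ultimately show ?thesis
    using assms(1) by (auto simp: mult_def intro: min.coboundedI2)
qed

lemma mult_le_mass: "0 \<le> \<tau> \<Longrightarrow> mult \<phi> a \<Psi> \<tau> \<alpha> \<le> \<tau>"
  by (simp add: mult_def)

lemma Psi_dir_cproj: "Psi_dir v z = max (elog (norm (cproj v z))) (2 * elog (cmod (cdot z v)))"
  by (simp add: Psi_dir_def cproj_def)

lemma mult_pt:
  assumes "vholo \<phi> U" "open U" "\<alpha> \<in> U" "\<phi> \<alpha> = a"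
  shows "mult \<phi> a Psi_pt 1 \<alpha> = 1"
proof (rule antisym)
  show "mult \<phi> a Psi_pt 1 \<alpha> \<le> 1"
    by (rule mult_le_mass) simp
  obtain C where C: "C > 0" "\<forall>\<^sub>F h in at 0. norm (\<phi> (\<alpha> + h) - \<phi> \<alpha>) \<le> C * cmod h"
    using vholo_linear_bound[OF assms(1-3)] by blast
  have "ereal 1 \<le> mult \<phi> a Psi_pt 1 \<alpha>"
  proof (rule mult_ge[of \<phi> \<alpha> a, OF assms(4)])
    show "\<forall>\<^sub>F h in at 0. Psi_pt (\<phi> (\<alpha> + h) - a) \<le> ereal (1 * ln (cmod h) + ln C)"
      using C(2) eventually_small_nonzero[OF zero_less_one]
      by eventually_elim (use C(1) assms(4) in \<open>auto simp: Psi_pt_def exp_add mult_ac intro!: elog_le\<close>)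
  qed simp
  then show "1 \<le> mult \<phi> a Psi_pt 1 \<alpha>" by (simp add: one_ereal_def)
qed

lemma mult_dir_ge1:
  assumes "vholo \<phi> U" "open U" "\<alpha> \<in> U" "\<phi> \<alpha> = a" "norm v = 1"
  shows "1 \<le> mult \<phi> a (Psi_dir v) 2 \<alpha>"
proof -
  obtain C where C: "C > 0" "\<forall>\<^sub>F h in at 0. norm (\<phi> (\<alpha> + h) - \<phi> \<alpha>) \<le> C * cmod h"
    using vholo_linear_bound[OF assms(1-3)] by blast
  have "ereal 1 \<le> mult \<phi> a (Psi_dir v) 2 \<alpha>"
  proof (rule mult_ge[of \<phi> \<alpha> a, OF assms(4)])
    show "\<forall>\<^sub>F h in at 0. Psi_dir v (\<phi> (\<alpha> + h) - a) \<le> ereal (1 * ln (cmod h) + ln C)"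
      using C(2) eventually_small_nonzero[OF zero_less_one] eventually_small_nonzero[OF divide_pos_pos[OF zero_less_one C(1)]]
    proof eventually_elim
      case (elim h)
      let ?u = "\<phi> (\<alpha> + h) - a"
      have u: "norm ?u \<le> C * cmod h" "C * cmod h > 0" "C * cmod h < 1"
        using elim C(1) assms(4) by (auto simp: field_simps)
      have "elog (norm (cproj v ?u)) \<le> ereal (ln (C * cmod h))"
        using u norm_cproj_le[OF assms(5), of ?u] by (intro elog_le) auto
      moreover have "elog (cmod (cdot ?u v)) \<le> ereal (ln (C * cmod h))"
        using u cmod_cdot_le[OF assms(5), of ?u] by (intro elog_le) auto
      then have "2 * elog (cmod (cdot ?u v)) \<le> 2 * ereal (ln (C * cmod h))"
        by (intro ereal_mult_left_mono) auto
      \<comment> \<open>The smallness of h was imposed for this: once C |h| < 1 the logarithm is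
        negative, and doubling it lowers it.\<close>
      moreover have "2 * ereal (ln (C * cmod h)) \<le> ereal (ln (C * cmod h))"
        using u by (simp add: two_times_ereal)
      ultimately have "Psi_dir v ?u \<le> ereal (ln (C * cmod h))"
        unfolding Psi_dir_cproj by (auto intro: order_trans)
      moreover have "ln (C * cmod h) = 1 * ln (cmod h) + ln C"
        using C(1) elim by (simp add: ln_mult)
      ultimately show ?case by simp
    qed
  qed simp
  then show ?thesis by (simp add: one_ereal_def)
qed

text \<open>Both members of the maximum are at most 2 ln |h| up to a constant: the transversal part
  has zero derivative and is quadratic in h, while the tangential part is linear but its logarithm
  is doubled in \<open>Psi_dir\<close>.\<close>

lemma mult_dir_eq2:
  assumes "vholo \<phi> U" "open U" "\<alpha> \<in> U" "\<phi> \<alpha> = a" "norm v = 1" "cproj v (vderiv \<phi> \<alpha>) = 0"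
  shows "mult \<phi> a (Psi_dir v) 2 \<alpha> = 2"
proof (rule antisym)
  show "mult \<phi> a (Psi_dir v) 2 \<alpha> \<le> 2"
    by (rule mult_le_mass) simp
  obtain C where C: "C > 0" "\<forall>\<^sub>F h in at 0. norm (\<phi> (\<alpha> + h) - \<phi> \<alpha>) \<le> C * cmod h"
    using vholo_linear_bound[OF assms(1-3)] by blast
  have "\<exists>D. \<forall>\<^sub>F h in at 0. norm (cproj v (\<phi> (\<alpha> + h) - a)) \<le> D * (cmod h)\<^sup>2"
    by (rule vholo_quadratic_bound[of _ U])
      (use assms in \<open>auto simp: vderiv_cproj[OF assms(1-3)] cproj_def[of _ 0] cdot_def intro!: vholo_cproj vholo_diff vholo_const\<close>)
  then obtain D where D: "\<forall>\<^sub>F h in at 0. norm (cproj v (\<phi> (\<alpha> + h) - a)) \<le> D * (cmod h)\<^sup>2"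
    by blast
  \<comment> \<open>One constant for both quadratic bounds, D for the transversal part and the
    square of C for the tangential one; the 1 keeps it positive.\<close>
  define E where "E = max (max D 1) (C\<^sup>2)"
  have E: "E > 0" "D \<le> E" "C\<^sup>2 \<le> E" by (auto simp: E_def)
  have "ereal 2 \<le> mult \<phi> a (Psi_dir v) 2 \<alpha>"
  proof (rule mult_ge[of \<phi> \<alpha> a, OF assms(4)])
    show "\<forall>\<^sub>F h in at 0. Psi_dir v (\<phi> (\<alpha> + h) - a) \<le> ereal (2 * ln (cmod h) + ln E)"
      using C(2) D eventually_small_nonzero[OF zero_less_one]
    proof eventually_elim
      case (elim h)
      let ?u = "\<phi> (\<alpha> + h) - a"
      have "exp (2 * ln (cmod h) + ln E) = E * (cmod h)\<^sup>2"
        using elim E(1) exp_of_nat_mult[of 2 "ln (cmod h)"] by (simp add: exp_add)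
      then have "elog (norm (cproj v ?u)) \<le> ereal (2 * ln (cmod h) + ln E)"
        using elim(2) E mult_right_mono[OF E(2), of "(cmod h)\<^sup>2"] by (intro elog_le) auto
      moreover have "elog (cmod (cdot ?u v)) \<le> ereal (ln (C * cmod h))"
        using cmod_cdot_le[OF assms(5), of ?u] C(1) elim assms(4) by (intro elog_le) auto
      then have "2 * elog (cmod (cdot ?u v)) \<le> 2 * ereal (ln (C * cmod h))"
        by (intro ereal_mult_left_mono) auto
      moreover have "2 * ereal (ln (C * cmod h)) = ereal (2 * ln (cmod h) + ln (C\<^sup>2))"
        using elim C(1) by (simp add: ln_mult ln_realpow two_times_ereal)
      moreover have "ln (C\<^sup>2) \<le> ln E"
        using C(1) E by (simp add: ln_mono)
      ultimately show ?case
        by (auto simp: Psi_dir_cproj intro: order_trans)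
    qed
  qed simp
  then show "2 \<le> mult \<phi> a (Psi_dir v) 2 \<alpha>" by simp
qed

text \<open>A nonzero transversal derivative keeps the transversal part above a fixed multiple of
  |h|, so the first member of the maximum alone forces the order down to ln |h|.\<close>

lemma mult_dir_eq1:
  assumes "vholo \<phi> U" "open U" "\<alpha> \<in> U" "\<phi> \<alpha> = a" "norm v = 1" "cproj v (vderiv \<phi> \<alpha>) \<noteq> 0"
  shows "mult \<phi> a (Psi_dir v) 2 \<alpha> = 1"
proof (rule antisym)
  show "1 \<le> mult \<phi> a (Psi_dir v) 2 \<alpha>"
    by (rule mult_dir_ge1[OF assms(1-5)])
  let ?d = "norm (cproj v (vderiv \<phi> \<alpha>))"
  have "((\<lambda>h. norm (cproj v ((1 / h) *s (\<phi> (\<alpha> + h) - \<phi> \<alpha>)))) \<longlongrightarrow> ?d) (at 0)"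
    by (intro tendsto_intros vholo_diffquot[OF assms(1-3)])
  then have ev: "\<forall>\<^sub>F h in at 0. norm (cproj v ((1 / h) *s (\<phi> (\<alpha> + h) - \<phi> \<alpha>))) > ?d / 2"
    by (rule order_tendstoD) (use assms(6) in simp)
  have "mult \<phi> a (Psi_dir v) 2 \<alpha> \<le> ereal 1"
  proof (rule mult_le[of \<phi> \<alpha> a, OF assms(4)])
    show "\<forall>\<^sub>F h in at 0. ereal (1 * ln (cmod h) + ln (?d / 2)) \<le> Psi_dir v (\<phi> (\<alpha> + h) - a)"
      using ev eventually_small_nonzero[OF zero_less_one]
    proof eventually_elim
      case (elim h)
      have "norm (cproj v (\<phi> (\<alpha> + h) - a)) > cmod h * (?d / 2)"
      proof -
        have "?d / 2 < norm (cproj v (\<phi> (\<alpha> + h) - a)) / cmod h"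
          using elim(1) assms(4)
          by (simp only: cproj_smult norm_vector_smult norm_divide norm_one mult_1 times_divide_eq_left)
        then show ?thesis
          using elim(2) by (simp add: pos_less_divide_eq mult.commute)
      qed
      moreover have pos: "cmod h * (?d / 2) > 0" using elim assms(6) by simp
      ultimately have "elog (cmod h * (?d / 2)) \<le> elog (norm (cproj v (\<phi> (\<alpha> + h) - a)))"
        by (intro elog_mono) simp
      then have "ereal (ln (cmod h * (?d / 2))) \<le> elog (norm (cproj v (\<phi> (\<alpha> + h) - a)))"
        using elog_pos[OF pos] by simp
      moreover have "ln (cmod h * (?d / 2)) = ln (cmod h) + ln (?d / 2)"
        using elim assms(6) by (intro ln_mult_pos) auto
      ultimately show ?case
        unfolding Psi_dir_cproj by (simp add: le_max_iff_disj)
    qed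
  qed
  then show "mult \<phi> a (Psi_dir v) 2 \<alpha> \<le> 1" by (simp add: one_ereal_def)
qed

section \<open>Adding points to the Lempert function\<close>

text \<open>The Riemann map of the \<delta>-neighbourhood of [0,1], a bounded convex open set,
  preceded by the disc automorphism that sends 0 to the preimage of 0.\<close>

lemma thin_map:
  assumes "\<delta> > 0"
  obtains \<psi> \<beta> where "\<psi> holomorphic_on ball 0 1" "\<psi> 0 = (0::complex)" "\<psi> \<beta> = 1" "\<beta> \<in> ball 0 1"
    "\<And>\<zeta>. \<zeta> \<in> ball 0 1 \<Longrightarrow> \<exists>t\<in>{0..1}. cmod (\<psi> \<zeta> - of_real t) < \<delta>"
proof -
  define U where "U = (\<Union>x\<in>closed_segment 0 1. \<Union>y\<in>ball 0 \<delta>. {x + y :: complex})"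
  have "open U"
    unfolding U_def by (intro open_sums) auto
  moreover have "convex U"
    unfolding U_def by (intro convex_sums) auto
  moreover have "bounded U"
    unfolding U_def by (intro bounded_sums bounded_closed_segment) auto
  then have "U \<noteq> UNIV"
    using not_bounded_UNIV by blast
  moreover have "closed_segment 0 1 \<subseteq> U"
    using assms by (force simp: U_def)
  then have 01: "0 \<in> U" "1 \<in> U"
    by auto
  ultimately obtain f g where fg: "f holomorphic_on U" "g holomorphic_on ball 0 1"
      "\<And>z. z \<in> U \<Longrightarrow> f z \<in> ball 0 1 \<and> g (f z) = z" "\<And>z. z \<in> ball 0 1 \<Longrightarrow> g z \<in> U \<and> f (g z) = z"
    using Riemann_mapping_theorem[of U] convex_imp_simply_connected by (metis empty_iff)
  have f01: "cmod (f 0) < 1" "cmod (f 1) < 1"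
    using fg(3) 01 by auto
  let ?m = "Moebius_function 0 (- f 0)"
  have m: "?m ` ball 0 1 \<subseteq> ball 0 1" "?m holomorphic_on ball 0 1"
    using Moebius_function_norm_lt_1[of "- f 0"] Moebius_function_holomorphic[of "- f 0"] f01 by auto
  show thesis
  proof (rule that[of "\<lambda>\<zeta>. g (?m \<zeta>)" "Moebius_function 0 (f 0) (f 1)"])
    show "(\<lambda>\<zeta>. g (?m \<zeta>)) holomorphic_on ball 0 1"
      using holomorphic_on_compose_gen[OF m(2) fg(2) m(1)] by (simp add: o_def)
    show "g (?m 0) = 0"
      using fg(3) 01 by (simp add: Moebius_function_of_zero)
    show "g (?m (Moebius_function 0 (f 0) (f 1))) = 1"
      using Moebius_function_compose[of "- f 0" "f 0" "f 1"] f01 fg(3) 01 by simp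
    show "Moebius_function 0 (f 0) (f 1) \<in> ball 0 1"
      using Moebius_function_norm_lt_1 f01 by simp
    fix \<zeta> :: complex assume "\<zeta> \<in> ball 0 1"
    then have "g (?m \<zeta>) \<in> U"
      using fg(4) m(1) by blast
    then obtain x y where xy: "x \<in> closed_segment 0 1" "cmod y < \<delta>" "g (?m \<zeta>) = x + y"
      by (auto simp: U_def)
    then obtain t where "x = complex_of_real t" "0 \<le> t" "t \<le> 1"
      by (auto simp: closed_segment_def scaleR_conv_of_real)
    then show "\<exists>t\<in>{0..1}. cmod (g (?m \<zeta>) - of_real t) < \<delta>"
      using xy by (intro bexI[of _ t]) auto
  qed
qed

text \<open>A rotated finite Blaschke product. Its modulus is 0 at the origin and 1 at the boundary
  point 1, so by the intermediate value theorem it equals |\<beta>0| somewhere on [0,1); a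
  unimodular factor then adjusts the argument. The origin in F gives the starting value 0, and its
  factor \<zeta> keeps the product strictly inside the disc.\<close>

lemma vanishing_disc_map:
  assumes F: "finite F" "F \<subseteq> ball 0 1" "0 \<in> F" and \<beta>0: "cmod \<beta>0 < 1"
  obtains B \<beta> where "B holomorphic_on ball 0 1" "B ` ball 0 1 \<subseteq> ball 0 1" "\<And>p. p \<in> F \<Longrightarrow> B p = 0"
    "\<beta> \<in> ball 0 1" "B \<beta> = \<beta>0"
proof -
  define b where "b \<zeta> = (\<Prod>p\<in>F. Moebius_function 0 p \<zeta>)" for \<zeta>
  have hol: "b holomorphic_on ball 0 1"
    unfolding b_def using F Moebius_function_holomorphic by (intro holomorphic_on_prod) auto
  have zero: "b p = 0" if "p \<in> F" for p
    unfolding b_def using F(1) that by (intro prod_zero bexI[of _ p]) (auto simp: Moebius_function_eq_zero)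
  have lt: "cmod (b \<zeta>) < 1" if "cmod \<zeta> < 1" for \<zeta>
  proof -
    have "b \<zeta> = Moebius_function 0 0 \<zeta> * (\<Prod>p\<in>F - {0}. Moebius_function 0 p \<zeta>)"
      unfolding b_def by (rule prod.remove) (use F in auto)
    also have "cmod \<dots> = cmod \<zeta> * (\<Prod>p\<in>F - {0}. cmod (Moebius_function 0 p \<zeta>))"
      by (simp add: norm_mult prod_norm Moebius_function_simple)
    also have "\<dots> \<le> cmod \<zeta> * 1"
      using F that by (intro mult_left_mono prod_le_1) (auto intro!: less_imp_le Moebius_function_norm_lt_1)
    finally show ?thesis using that by simp
  qed
  have nz: "1 - cnj p * of_real t \<noteq> 0" if "p \<in> F" "t \<in> {0..1}" for p t
  proof
    assume "1 - cnj p * of_real t = 0"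
    then have "cmod (cnj p * of_real t) = 1" by (metis eq_iff_diff_eq_0 norm_one)
    moreover have "cmod p * \<bar>t\<bar> \<le> cmod p * 1"
      using that by (intro mult_left_mono) auto
    ultimately show False using F that by (auto simp: norm_mult)
  qed
  have "cmod (1 - cnj p) = cmod (1 - p)" for p
    by (metis complex_cnj_diff complex_cnj_one complex_mod_cnj)
  then have "cmod (Moebius_function 0 p 1) = 1" if "p \<in> F" for p
    using nz[OF that, of 1] by (simp add: Moebius_function_simple norm_divide)
  then have b1: "cmod (b 1) = 1"
    by (simp add: b_def flip: prod_norm)
  have "continuous_on {0..1} (\<lambda>t. cmod (b (of_real t)))"
    unfolding b_def Moebius_function_simple using nz by (auto intro!: continuous_intros)
  moreover have "cmod (b (of_real 0)) \<le> cmod \<beta>0" "cmod \<beta>0 \<le> cmod (b (of_real 1))"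
    using zero[OF F(3)] b1 \<beta>0 by auto
  ultimately obtain t where t: "0 \<le> t" "t \<le> 1" "cmod (b (of_real t)) = cmod \<beta>0"
    using IVT'[of "\<lambda>t. cmod (b (of_real t))" 0 "cmod \<beta>0" 1] by auto
  have "t \<noteq> 1"
    using t(3) b1 \<beta>0 by auto
  \<comment> \<open>For \<beta>0 = 0 the product vanishes at t too, and the quotient 0 / 0 = 0 would
    not be unimodular.\<close>
  define c where "c = (if \<beta>0 = 0 then 1 else \<beta>0 / b (of_real t))"
  have c: "cmod c = 1" "c * b (of_real t) = \<beta>0"
    using t(3) by (auto simp: c_def norm_divide)
  show thesis
    by (rule that[of "\<lambda>\<zeta>. c * b \<zeta>" "of_real t"])
      (use hol lt zero t \<open>t \<noteq> 1\<close> c in \<open>auto simp: norm_mult intro!: holomorphic_intros\<close>)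
qed

text \<open>The Blaschke product sends F to 0, a zero of the thin map, and sends \<beta> to the
  point where the thin map equals 1.\<close>

lemma segment_map:
  assumes "finite F" "F \<subseteq> ball 0 1" "0 \<in> F" "\<delta> > 0"
  obtains g \<beta> where "g holomorphic_on ball 0 1" "\<And>p. p \<in> F \<Longrightarrow> g p = (0::complex)" "g \<beta> = 1" "\<beta> \<in> ball 0 1"
    "\<And>\<zeta>. \<zeta> \<in> ball 0 1 \<Longrightarrow> \<exists>t\<in>{0..1}. cmod (g \<zeta> - of_real t) < \<delta>"
proof -
  obtain \<psi> \<beta>0 where \<psi>: "\<psi> holomorphic_on ball 0 1" "\<psi> 0 = (0::complex)" "\<psi> \<beta>0 = 1" "\<beta>0 \<in> ball 0 1"
    "\<And>\<zeta>. \<zeta> \<in> ball 0 1 \<Longrightarrow> \<exists>t\<in>{0..1}. cmod (\<psi> \<zeta> - of_real t) < \<delta>"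
    using thin_map[OF assms(4)] by blast
  obtain B \<beta> where B: "B holomorphic_on ball 0 1" "B ` ball 0 1 \<subseteq> ball 0 1" "\<And>p. p \<in> F \<Longrightarrow> B p = 0"
    "\<beta> \<in> ball 0 1" "B \<beta> = \<beta>0"
    using vanishing_disc_map[OF assms(1-3)] \<psi>(4) by (metis mem_ball_0)
  show thesis
  proof (rule that[of "\<lambda>\<zeta>. \<psi> (B \<zeta>)" \<beta>])
    show "(\<lambda>\<zeta>. \<psi> (B \<zeta>)) holomorphic_on ball 0 1"
      using holomorphic_on_compose_gen[OF B(1) \<psi>(1) B(2)] by (simp add: o_def)
    show "\<exists>t\<in>{0..1}. cmod (\<psi> (B \<zeta>) - of_real t) < \<delta>" if "\<zeta> \<in> ball 0 1" for \<zeta>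
      using that B(2) by (intro \<psi>(5)) blast
  qed (use B \<psi> in auto)
qed

lemma HolD_dilation_compact:
  assumes "\<phi> \<in> HolD \<Omega>" "0 \<le> r" "r < 1"
  obtains K where "compact K" "K \<subseteq> \<Omega>" "\<And>\<zeta>. \<zeta> \<in> ball 0 1 \<Longrightarrow> \<phi> (of_real r * \<zeta>) \<in> K"
proof (rule that[of "\<phi> ` cball 0 r"])
  have sub: "cball 0 r \<subseteq> (ball 0 1 :: complex set)"
    using assms by auto
  have "continuous_on (cball 0 r) \<phi>"
    using vholo_continuous continuous_on_subset[OF _ sub] assms(1) by (auto simp: HolD_iff)
  then show "compact (\<phi> ` cball 0 r)"
    by (intro compact_continuous_image) auto
  show "\<phi> ` cball 0 r \<subseteq> \<Omega>"
    using sub assms(1) unfolding HolD_iff by blast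
  show "\<phi> (of_real r * \<zeta>) \<in> \<phi> ` cball 0 r" if "\<zeta> \<in> ball 0 1" for \<zeta>
    using that assms mult_left_mono[of "cmod \<zeta>" 1 r] by (auto simp: norm_mult)
qed

lemma vholo_dilation:
  assumes "\<phi> \<in> HolD \<Omega>" "0 \<le> r" "r \<le> 1"
  shows "vholo (\<lambda>\<zeta>. \<phi> (of_real r * \<zeta>)) (ball 0 1)"
proof (rule vholo_compose)
  show "vholo \<phi> (ball 0 1)" using assms by (simp add: HolD_iff)
  show "(\<lambda>\<zeta>. of_real r * \<zeta>) ` ball 0 1 \<subseteq> (ball 0 1 :: complex set)"
  proof clarsimp
    fix \<zeta> :: complex assume "cmod \<zeta> < 1"
    then show "cmod (of_real r * \<zeta>) < 1"
      using assms mult_right_mono[of r 1 "cmod \<zeta>"] by (simp add: norm_mult)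
  qed
qed (intro holomorphic_intros)

lemma HolD_add_hit:
  assumes \<Omega>: "open \<Omega>" "convex \<Omega>" and \<phi>: "\<phi> \<in> HolD \<Omega>" and r: "0 \<le> r" "r < 1"
    and F: "finite F" "F \<subseteq> ball 0 1" "0 \<in> F" and p: "p \<in> \<Omega>"
  obtains \<phi>' \<beta> where "\<phi>' \<in> HolD \<Omega>" "\<beta> \<in> ball 0 1" "\<phi>' \<beta> = p"
    "\<And>\<zeta>. \<zeta> \<in> F \<Longrightarrow> \<phi>' \<zeta> = \<phi> (of_real r * \<zeta>)"
proof -
  obtain K where K: "compact K" "K \<subseteq> \<Omega>" "\<And>\<zeta>. \<zeta> \<in> ball 0 1 \<Longrightarrow> \<phi> (of_real r * \<zeta>) \<in> K"
    using HolD_dilation_compact[OF \<phi> r] by blast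
  \<comment> \<open>If g took values in [0,1], the new disc would stay in this hull. The margin
    \<delta> around the hull absorbs the fact that g is only close to [0,1].\<close>
  have "compact (convex hull (insert p K))"
    using K(1) by (intro compact_convex_hull) auto
  moreover have "convex hull (insert p K) \<subseteq> \<Omega>"
    using K(2) p \<Omega>(2) by (intro hull_minimal) auto
  ultimately obtain \<delta> where \<delta>: "\<delta> > 0" "(\<Union>x\<in>convex hull (insert p K). ball x \<delta>) \<subseteq> \<Omega>"
    using compact_subset_open_imp_ball_epsilon_subset \<Omega>(1) by metis
  \<comment> \<open>The error of g gets multiplied by p - x with norm at most R, hence the tolerance
    \<delta> / R below.\<close>
  have "bounded ((\<lambda>x. p - x) ` K)"
    using K(1) by (intro compact_imp_bounded compact_continuous_image continuous_intros)
  then obtain R where R: "R > 0" "\<And>x. x \<in> K \<Longrightarrow> norm (p - x) \<le> R"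
    by (auto simp: bounded_pos)
  obtain g \<beta> where g: "g holomorphic_on ball 0 1" "\<And>p. p \<in> F \<Longrightarrow> g p = (0::complex)" "g \<beta> = 1" "\<beta> \<in> ball 0 1"
    "\<And>\<zeta>. \<zeta> \<in> ball 0 1 \<Longrightarrow> \<exists>t\<in>{0..1}. cmod (g \<zeta> - of_real t) < \<delta> / R"
    using segment_map[OF F, of "\<delta> / R"] \<delta>(1) R(1) by (metis divide_pos_pos)
  define \<phi>' where "\<phi>' \<zeta> = \<phi> (of_real r * \<zeta>) + g \<zeta> *s (p - \<phi> (of_real r * \<zeta>))" for \<zeta>
  have "\<phi>' \<zeta> \<in> \<Omega>" if \<zeta>: "\<zeta> \<in> ball 0 1" for \<zeta>
  proof -
    let ?x = "\<phi> (of_real r * \<zeta>)"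
    obtain t where t: "t \<in> {0..1}" "cmod (g \<zeta> - of_real t) < \<delta> / R"
      using g(5)[OF \<zeta>] by blast
    let ?y = "(1 - t) *\<^sub>R ?x + t *\<^sub>R p"
    have "?y \<in> convex hull (insert p K)"
      using t(1) K(3)[OF \<zeta>] by (intro convexD convex_convex_hull) (auto intro: hull_inc)
    moreover have "\<phi>' \<zeta> - ?y = (g \<zeta> - of_real t) *s (p - ?x)"
      by (simp add: \<phi>'_def vec_eq_iff algebra_simps scaleR_conv_of_real[where 'a = complex])
    then have "norm (\<phi>' \<zeta> - ?y) \<le> cmod (g \<zeta> - of_real t) * R"
      using R(2)[OF K(3)[OF \<zeta>]] by (simp only: norm_vector_smult mult_left_mono norm_ge_zero)
    then have "norm (\<phi>' \<zeta> - ?y) < \<delta>"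
      using t(2) R(1) by (simp add: field_simps)
    then have "\<phi>' \<zeta> \<in> ball ?y \<delta>"
      by (simp add: dist_norm norm_minus_commute)
    ultimately show ?thesis using \<delta>(2) by blast
  qed
  moreover have "vholo \<phi>' (ball 0 1)"
    unfolding \<phi>'_def using r
    by (intro vholo_add vholo_smult vholo_diff vholo_const g(1) vholo_dilation[OF \<phi>]) auto
  ultimately have "\<phi>' \<in> HolD \<Omega>"
    by (auto simp: HolD_iff)
  then show thesis
    by (rule that[of \<phi>' \<beta>]) (use g in \<open>auto simp: \<phi>'_def\<close>)
qed

lemma elog_divide: "0 < r \<Longrightarrow> elog (x / r) = elog x + ereal (- ln r)"
  by (auto simp: elog_def ln_div divide_le_0_iff)

text \<open>Prepares the replacement of nodes \<zeta> by \<zeta> / r: the bound x b < r keeps them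
  in the disc, and \<open>real k * - ln r\<close> is the total cost for k nodes.\<close>

lemma exists_dilation_factor:
  assumes "finite B" "\<And>b. b \<in> B \<Longrightarrow> x b < 1" "e > (0::real)"
  obtains r where "0 < r" "r < 1" "\<And>b. b \<in> B \<Longrightarrow> x b < r" "real k * - ln r < e"
proof -
  have "\<forall>\<^sub>F r in at_left (1::real). 0 < r \<and> r < 1"
    by (auto simp: eventually_at_left[of 0] intro!: exI[of _ 0])
  moreover have "((\<lambda>r::real. real k * - ln r) \<longlongrightarrow> real k * - ln 1) (at_left 1)"
    by (intro tendsto_intros) auto
  then have "\<forall>\<^sub>F r in at_left (1::real). real k * - ln r < e"
    by (rule order_tendstoD) (use assms in simp)
  moreover have "\<forall>\<^sub>F r in at_left (1::real). \<forall>b\<in>B. x b < r"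
    using assms by (intro eventually_ball_finite ballI order_tendstoD(1)[OF tendsto_ident_at]) auto
  ultimately have "\<forall>\<^sub>F r in at_left (1::real). 0 < r \<and> r < 1 \<and> real k * - ln r < e \<and> (\<forall>b\<in>B. x b < r)"
    by eventually_elim auto
  then show thesis
    using that eventually_happens'[OF trivial_limit_at_left_real] by blast
qed

lemma coman_lempert_insert:
  assumes \<Omega>: "open \<Omega>" "convex \<Omega>" and P: "finite P" "p \<in> \<Omega>" "p \<notin> P"
  shows "coman_lempert \<Omega> (insert p P) z \<le> coman_lempert \<Omega> P z"
proof -
  have "coman_lempert \<Omega> (insert p P) z \<le> (\<Sum>b\<in>P. elog (cmod (\<zeta> b)))"
    if \<phi>: "\<phi> \<in> HolD \<Omega>" "\<phi> 0 = z" "\<forall>b\<in>P. \<zeta> b \<in> ball 0 1 \<and> \<phi> (\<zeta> b) = b" for \<phi> \<zeta>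
  proof (rule ereal_le_epsilon2)
    fix e :: real assume "e > 0"
    obtain r where r: "0 < r" "r < 1" "\<And>b. b \<in> P \<Longrightarrow> cmod (\<zeta> b) < r" "real (card P) * - ln r < e"
      using exists_dilation_factor[OF P(1), of "\<lambda>b. cmod (\<zeta> b)" e "card P"] \<phi>(3) \<open>e > 0\<close> by auto
    \<comment> \<open>The origin is treated as a node so that the new disc still starts at
      z.\<close>
    define F where "F = insert 0 ((\<lambda>b. \<zeta> b / of_real r) ` P)"
    have "finite F" "F \<subseteq> ball 0 1" "0 \<in> F"
      using P(1) r by (auto simp: F_def norm_divide)
    then obtain \<phi>' \<beta> where \<phi>': "\<phi>' \<in> HolD \<Omega>" "\<beta> \<in> ball 0 1" "\<phi>' \<beta> = p"
      "\<And>\<zeta>. \<zeta> \<in> F \<Longrightarrow> \<phi>' \<zeta> = \<phi> (of_real r * \<zeta>)"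
      using HolD_add_hit[OF \<Omega> \<phi>(1) less_imp_le[OF r(1)] r(2) _ _ _ P(2), of F] by blast
    define \<zeta>' where "\<zeta>' b = (if b = p then \<beta> else \<zeta> b / of_real r)" for b
    have "\<forall>b\<in>insert p P. \<zeta>' b \<in> ball 0 1 \<and> \<phi>' (\<zeta>' b) = b"
      using \<phi>' \<phi>(3) r P(3) by (auto simp: \<zeta>'_def F_def norm_divide)
    moreover have "\<phi>' 0 = z"
      using \<phi>'(4)[of 0] \<phi>(2) by (simp add: F_def)
    ultimately have "coman_lempert \<Omega> (insert p P) z \<le> (\<Sum>b\<in>insert p P. elog (cmod (\<zeta>' b)))"
      unfolding coman_lempert_def using \<phi>'(1) by (intro Inf_lower) blast
    also have "\<dots> = elog (cmod \<beta>) + (\<Sum>b\<in>P. elog (cmod (\<zeta>' b)))"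
      using P by (simp add: \<zeta>'_def)
    also have "\<dots> \<le> 0 + (\<Sum>b\<in>P. elog (cmod (\<zeta>' b)))"
      using \<phi>'(2) by (intro add_right_mono elog_nonpos) auto
    also have "\<dots> = (\<Sum>b\<in>P. elog (cmod (\<zeta> b)) + ereal (- ln r))"
      using P(3) r(1) by (auto simp: \<zeta>'_def norm_divide elog_divide intro!: sum.cong)
    also have "\<dots> = (\<Sum>b\<in>P. elog (cmod (\<zeta> b))) + ereal (real (card P) * - ln r)"
      by (simp add: sum.distrib)
    also have "\<dots> \<le> (\<Sum>b\<in>P. elog (cmod (\<zeta> b))) + ereal e"
      using r(4) by (intro add_left_mono) simp
    finally show "coman_lempert \<Omega> (insert p P) z \<le> (\<Sum>b\<in>P. elog (cmod (\<zeta> b))) + ereal e" .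
  qed
  then show ?thesis
    unfolding coman_lempert_def[of \<Omega> P z] by (auto intro!: Inf_greatest)
qed

lemma coman_lempert_antimono:
  assumes \<Omega>: "open \<Omega>" "convex \<Omega>" and P: "finite P" "P \<subseteq> \<Omega>" "Q \<subseteq> P"
  shows "coman_lempert \<Omega> P z \<le> coman_lempert \<Omega> Q z"
proof -
  have "finite R \<Longrightarrow> R \<subseteq> \<Omega> \<Longrightarrow> coman_lempert \<Omega> (R \<union> Q) z \<le> coman_lempert \<Omega> Q z" for R
  proof (induction R rule: finite_induct)
    case (insert p R)
    then have IH: "coman_lempert \<Omega> (R \<union> Q) z \<le> coman_lempert \<Omega> Q z" by simp
    show ?case
    proof (cases "p \<in> Q")
      case True
      then show ?thesis using IH by (simp add: insert_absorb)
    next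
      case False
      then have "coman_lempert \<Omega> (insert p (R \<union> Q)) z \<le> coman_lempert \<Omega> (R \<union> Q) z"
        using insert P finite_subset by (intro coman_lempert_insert \<Omega>) auto
      then show ?thesis using IH by simp
    qed
  qed simp
  from this[of P] show ?thesis
    using P by (simp add: Un_absorb2)
qed

text \<open>Because the function decreases when points are added, a disc that hits only part of P
  already gives an upper bound. All later competitors enter in this form.\<close>

lemma coman_lempert_le:
  assumes \<Omega>: "open \<Omega>" "convex \<Omega>" and P: "finite P" "P \<subseteq> \<Omega>" "q ` L \<subseteq> P" "inj_on q L"
    and \<phi>: "\<phi> \<in> HolD \<Omega>" "\<phi> 0 = z" "\<And>l. l \<in> L \<Longrightarrow> x l \<in> ball 0 1 \<and> \<phi> (x l) = q l"
  shows "coman_lempert \<Omega> P z \<le> (\<Sum>l\<in>L. elog (cmod (x l)))"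
proof -
  have "coman_lempert \<Omega> P z \<le> coman_lempert \<Omega> (q ` L) z"
    by (rule coman_lempert_antimono[OF \<Omega> P(1-3)])
  also have "\<dots> \<le> (\<Sum>b\<in>q ` L. elog (cmod (x (inv_into L q b))))"
    unfolding coman_lempert_def using \<phi> P(4) by (intro Inf_lower) (auto intro!: exI[of _ \<phi>])
  also have "\<dots> = (\<Sum>l\<in>L. elog (cmod (x l)))"
    using P(4) by (simp add: sum.reindex)
  finally show ?thesis .
qed

text \<open>All multiplicities equal 1, so the mass 1 leaves at most one node over each point.
  Points left without a node are restored by antitonicity in the point set.\<close>

lemma gen_lempert_pts_eq_coman_lempert:
  assumes \<Omega>: "open \<Omega>" "convex \<Omega>" and P: "finite P" "P \<subseteq> \<Omega>"
  shows "gen_lempert_pts \<Omega> P z = coman_lempert \<Omega> P z"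
proof (rule antisym)
  have m: "Defs.mult \<phi> b Psi_pt 1 \<alpha> = 1" if "\<phi> \<in> HolD \<Omega>" "\<alpha> \<in> ball 0 1" "\<phi> \<alpha> = b" for \<phi> \<alpha> b
    using that by (intro mult_pt[of _ "ball 0 1"]) (auto simp: HolD_iff)
  show "gen_lempert_pts \<Omega> P z \<le> coman_lempert \<Omega> P z"
    unfolding coman_lempert_def
  proof (intro Inf_greatest, clarify)
    fix \<phi> \<zeta> assume \<phi>: "\<phi> \<in> HolD \<Omega>" "z = \<phi> 0" "\<forall>b\<in>P. \<zeta> b \<in> ball 0 1 \<and> \<phi> (\<zeta> b) = b"
    have m1: "Defs.mult \<phi> b Psi_pt 1 (\<zeta> b) = 1" if "b \<in> P" for b
      using m \<phi> that by blast
    have "gen_lempert_pts \<Omega> P z \<le>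
        (\<Sum>b\<in>P. \<Sum>\<alpha>\<in>{\<zeta> b}. Defs.mult \<phi> (id b) Psi_pt 1 \<alpha> * elog (cmod \<alpha>))"
      unfolding gen_lempert_pts_def gen_lempert_def using \<phi> m1
      by (intro Inf_lower CollectI exI[of _ \<phi>] exI[of _ "\<lambda>b. {\<zeta> b}"]) auto
    also have "\<dots> = (\<Sum>b\<in>P. elog (cmod (\<zeta> b)))"
      by (intro sum.cong) (auto simp: m1)
    finally show "gen_lempert_pts \<Omega> P (\<phi> 0) \<le> (\<Sum>b\<in>P. elog (cmod (\<zeta> b)))"
      by (simp add: \<phi>(2))
  qed
  show "coman_lempert \<Omega> P z \<le> gen_lempert_pts \<Omega> P z"
    unfolding gen_lempert_pts_def gen_lempert_def
  proof (intro Inf_greatest, clarify)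
    fix \<phi> A
    assume \<phi>: "\<phi> \<in> HolD \<Omega>" "z = \<phi> 0" and "\<forall>k\<in>P. finite (A k) \<and> A k \<subseteq> ball 0 1 \<and>
        A k \<subseteq> \<phi> -` {id k} \<and> (\<Sum>\<alpha>\<in>A k. Defs.mult \<phi> (id k) Psi_pt 1 \<alpha>) \<le> 1"
    then have A: "\<And>k. k \<in> P \<Longrightarrow> finite (A k)" "\<And>k. k \<in> P \<Longrightarrow> A k \<subseteq> ball 0 1"
        "\<And>k \<alpha>. k \<in> P \<Longrightarrow> \<alpha> \<in> A k \<Longrightarrow> \<phi> \<alpha> = k"
        "\<And>k. k \<in> P \<Longrightarrow> (\<Sum>\<alpha>\<in>A k. Defs.mult \<phi> k Psi_pt 1 \<alpha>) \<le> 1"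
      by auto
    have m1: "Defs.mult \<phi> k Psi_pt 1 \<alpha> = 1" if "k \<in> P" "\<alpha> \<in> A k" for k \<alpha>
      using m[OF \<phi>(1)] A that by blast
    have "card (A k) \<le> 1" if "k \<in> P" for k
    proof -
      have "(\<Sum>\<alpha>\<in>A k. Defs.mult \<phi> k Psi_pt 1 \<alpha>) = (\<Sum>\<alpha>\<in>A k. ereal 1)"
        using m1 that by (intro sum.cong) (auto simp: one_ereal_def)
      then show ?thesis
        using A(4)[OF that] by (simp add: one_ereal_def)
    qed
    then have "\<alpha> = \<alpha>'" if "k \<in> P" "\<alpha> \<in> A k" "\<alpha>' \<in> A k" for k \<alpha> \<alpha>'
      using A(1)[OF that(1)] that card_le_Suc0_iff_eq by (metis One_nat_def)
    then have single: "A k = {\<alpha>}" if "k \<in> P" "\<alpha> \<in> A k" for k \<alpha>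
      using that by blast
    define Q where "Q = {k \<in> P. A k \<noteq> {}}"
    define x where "x k = (SOME \<alpha>. \<alpha> \<in> A k)" for k
    have x: "x k \<in> A k" if "k \<in> Q" for k
      using that some_in_eq by (auto simp: Q_def x_def)
    have "coman_lempert \<Omega> P z \<le> (\<Sum>k\<in>Q. elog (cmod (x k)))"
    proof (rule coman_lempert_le[OF \<Omega> P, where q=id and \<phi>=\<phi>])
      show "x l \<in> ball 0 1 \<and> \<phi> (x l) = id l" if "l \<in> Q" for l
        using x[OF that] A(2)[of l] A(3)[of l "x l"] that by (auto simp: Q_def)
    qed (use \<phi> in \<open>auto simp: Q_def\<close>)
    also have "\<dots> = (\<Sum>k\<in>Q. \<Sum>\<alpha>\<in>A k. Defs.mult \<phi> (id k) Psi_pt 1 \<alpha> * elog (cmod \<alpha>))"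
    proof (intro sum.cong refl)
      fix k assume "k \<in> Q"
      then have "k \<in> P" "A k = {x k}" using x single by (auto simp: Q_def)
      then show "elog (cmod (x k)) = (\<Sum>\<alpha>\<in>A k. Defs.mult \<phi> (id k) Psi_pt 1 \<alpha> * elog (cmod \<alpha>))"
        using m1[of k "x k"] by simp
    qed
    also have "\<dots> = (\<Sum>k\<in>P. \<Sum>\<alpha>\<in>A k. Defs.mult \<phi> (id k) Psi_pt 1 \<alpha> * elog (cmod \<alpha>))"
      using P(1) by (intro sum.mono_neutral_left) (auto simp: Q_def)
    finally show "coman_lempert \<Omega> P (\<phi> 0)
        \<le> (\<Sum>k\<in>P. \<Sum>\<alpha>\<in>A k. Defs.mult \<phi> (id k) Psi_pt 1 \<alpha> * elog (cmod \<alpha>))"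
      by (simp add: \<phi>(2))
  qed
qed

section \<open>Perturbing a disc to hit moving points\<close>

text \<open>Smallness is measured by a Lipschitz constant tending to 0, not by the supremum, because
  the difference quotient of the correction across two merging nodes must also tend to 0. Vanishing
  at 0 preserves the base point and turns the Lipschitz bound into a supremum bound.\<close>

definition small_lip :: "'b filter \<Rightarrow> ('b \<Rightarrow> complex \<Rightarrow> complex ^ 'n::finite) \<Rightarrow> bool" where
  "small_lip F h \<longleftrightarrow> (\<forall>\<epsilon>. vholo (h \<epsilon>) (ball 0 1) \<and> h \<epsilon> 0 = 0) \<and>
    (\<exists>L. (L \<longlongrightarrow> (0::real)) F \<and> (\<forall>\<^sub>F \<epsilon> in F. \<forall>\<zeta>\<in>ball 0 1. \<forall>\<zeta>'\<in>ball 0 1.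
        norm (h \<epsilon> \<zeta> - h \<epsilon> \<zeta>') \<le> L \<epsilon> * cmod (\<zeta> - \<zeta>')))"

lemma small_lip_zero: "small_lip F (\<lambda>\<epsilon> \<zeta>. 0)"
  unfolding small_lip_def by (auto intro!: vholo_const exI[of _ "\<lambda>_. 0"])

lemma small_lip_tendsto:
  assumes "small_lip F h" "\<forall>\<^sub>F \<epsilon> in F. y \<epsilon> \<in> ball 0 1"
  shows "((\<lambda>\<epsilon>. h \<epsilon> (y \<epsilon>)) \<longlongrightarrow> 0) F"
proof -
  obtain L where L: "(L \<longlongrightarrow> (0::real)) F" "\<forall>\<^sub>F \<epsilon> in F. \<forall>\<zeta>\<in>ball 0 1. \<forall>\<zeta>'\<in>ball 0 1.
      norm (h \<epsilon> \<zeta> - h \<epsilon> \<zeta>') \<le> L \<epsilon> * cmod (\<zeta> - \<zeta>')"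
    and h0: "\<And>\<epsilon>. h \<epsilon> 0 = 0"
    using assms(1) by (auto simp: small_lip_def)
  have "\<forall>\<^sub>F \<epsilon> in F. norm (h \<epsilon> (y \<epsilon>)) \<le> \<bar>L \<epsilon>\<bar>"
    using L(2) assms(2)
  proof eventually_elim
    case (elim \<epsilon>)
    then have "norm (h \<epsilon> (y \<epsilon>) - h \<epsilon> 0) \<le> L \<epsilon> * cmod (y \<epsilon> - 0)"
      by (metis centre_in_ball zero_less_one)
    also have "\<dots> \<le> \<bar>L \<epsilon>\<bar> * 1"
      using elim by (intro mult_mono) auto
    finally show ?case by (simp add: h0)
  qed
  moreover have "((\<lambda>\<epsilon>. \<bar>L \<epsilon>\<bar>) \<longlongrightarrow> 0) F"
    using L(1) by (simp add: tendsto_rabs_zero_iff)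
  ultimately show ?thesis
    by (rule Lim_null_comparison)
qed

lemma small_lip_diffquot_tendsto:
  assumes "small_lip F h" "\<xi> \<in> ball 0 1" "\<forall>\<^sub>F \<epsilon> in F. \<xi> + c \<epsilon> \<in> ball 0 1"
  shows "((\<lambda>\<epsilon>. (1 / c \<epsilon>) *s (h \<epsilon> (\<xi> + c \<epsilon>) - h \<epsilon> \<xi>)) \<longlongrightarrow> 0) F"
proof -
  obtain L where L: "(L \<longlongrightarrow> (0::real)) F" "\<forall>\<^sub>F \<epsilon> in F. \<forall>\<zeta>\<in>ball 0 1. \<forall>\<zeta>'\<in>ball 0 1.
      norm (h \<epsilon> \<zeta> - h \<epsilon> \<zeta>') \<le> L \<epsilon> * cmod (\<zeta> - \<zeta>')"
    using assms(1) by (auto simp: small_lip_def)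
  have "\<forall>\<^sub>F \<epsilon> in F. norm ((1 / c \<epsilon>) *s (h \<epsilon> (\<xi> + c \<epsilon>) - h \<epsilon> \<xi>)) \<le> \<bar>L \<epsilon>\<bar>"
    using L(2) assms(3)
  proof eventually_elim
    case (elim \<epsilon>)
    have "norm (h \<epsilon> (\<xi> + c \<epsilon>) - h \<epsilon> \<xi>) \<le> L \<epsilon> * cmod (\<xi> + c \<epsilon> - \<xi>)"
      using elim assms(2) by blast
    also have "\<dots> \<le> \<bar>L \<epsilon>\<bar> * cmod (c \<epsilon>)"
      by (simp add: mult_right_mono)
    finally have "norm (h \<epsilon> (\<xi> + c \<epsilon>) - h \<epsilon> \<xi>) / cmod (c \<epsilon>) \<le> \<bar>L \<epsilon>\<bar>"
      by (cases "c \<epsilon> = 0") (auto simp: divide_le_eq)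
    then show ?case
      by (simp only: norm_vector_smult norm_divide norm_one mult_1 times_divide_eq_left)
  qed
  moreover have "((\<lambda>\<epsilon>. \<bar>L \<epsilon>\<bar>) \<longlongrightarrow> 0) F"
    using L(1) by (simp add: tendsto_rabs_zero_iff)
  ultimately show ?thesis
    by (rule Lim_null_comparison)
qed

text \<open>The nodes will move with \<epsilon>, so the constant must be the same for all positions
  in the disc. Each additional linear factor has modulus at most 2 and Lipschitz constant 1, hence
  the passage from C to 3 C by the product rule.\<close>

lemma node_poly_bounds:
  assumes "finite X"
  shows "\<exists>C\<ge>0. \<forall>n :: 'l \<Rightarrow> complex. (\<forall>l\<in>X. cmod (n l) < 1) \<longrightarrow> (\<forall>\<zeta>\<in>ball 0 1. \<forall>\<zeta>'\<in>ball 0 1.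
      cmod (\<zeta> * (\<Prod>l\<in>X. \<zeta> - n l)) \<le> C \<and>
      cmod (\<zeta> * (\<Prod>l\<in>X. \<zeta> - n l) - \<zeta>' * (\<Prod>l\<in>X. \<zeta>' - n l)) \<le> C * cmod (\<zeta> - \<zeta>'))"
  using assms
proof (induction X rule: finite_induct)
  case empty
  show ?case by (intro exI[of _ 1]) auto
next
  case (insert m X)
  let ?w = "\<lambda>n \<zeta>. \<zeta> * (\<Prod>l\<in>X. \<zeta> - n l)"
  obtain C where C: "C \<ge> 0" "\<And>n \<zeta> \<zeta>'. \<forall>l\<in>X. cmod (n l) < 1 \<Longrightarrow> \<zeta> \<in> ball 0 1 \<Longrightarrow> \<zeta>' \<in> ball 0 1 \<Longrightarrow>
      cmod (?w n \<zeta>) \<le> C \<and> cmod (?w n \<zeta> - ?w n \<zeta>') \<le> C * cmod (\<zeta> - \<zeta>')"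
    using insert.IH by blast
  have "cmod (\<zeta> * (\<Prod>l\<in>insert m X. \<zeta> - n l)) \<le> 3 * C \<and>
      cmod (\<zeta> * (\<Prod>l\<in>insert m X. \<zeta> - n l) - \<zeta>' * (\<Prod>l\<in>insert m X. \<zeta>' - n l)) \<le> 3 * C * cmod (\<zeta> - \<zeta>')"
    if n: "\<forall>l\<in>insert m X. cmod (n l) < 1" and \<zeta>: "\<zeta> \<in> ball 0 1" "\<zeta>' \<in> ball 0 1" for n \<zeta> \<zeta>'
  proof -
    have eq: "\<zeta> * (\<Prod>l\<in>insert m X. \<zeta> - n l) = (\<zeta> - n m) * ?w n \<zeta>" for \<zeta>
      using insert.hyps by simp
    have le2: "cmod (\<zeta> - n m) \<le> 2" if "\<zeta> \<in> ball 0 1" for \<zeta>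
      using norm_triangle_ineq4[of \<zeta> "n m"] n that by auto
    have w: "cmod (?w n \<zeta>) \<le> C" "cmod (?w n \<zeta> - ?w n \<zeta>') \<le> C * cmod (\<zeta> - \<zeta>')"
      using C(2)[of n \<zeta> \<zeta>'] n \<zeta> by auto
    have 1: "cmod ((\<zeta> - n m) * ?w n \<zeta>) \<le> 2 * C"
      unfolding norm_mult[of "\<zeta> - n m"] using le2 \<zeta> w C(1) by (intro mult_mono) auto
    have "(\<zeta> - n m) * ?w n \<zeta> - (\<zeta>' - n m) * ?w n \<zeta>' =
        (\<zeta> - \<zeta>') * ?w n \<zeta> + (\<zeta>' - n m) * (?w n \<zeta> - ?w n \<zeta>')"
      by (simp add: algebra_simps)
    also have "cmod \<dots> \<le> cmod (\<zeta> - \<zeta>') * cmod (?w n \<zeta>) + cmod (\<zeta>' - n m) * cmod (?w n \<zeta> - ?w n \<zeta>')"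
      unfolding norm_mult[symmetric] by (rule norm_triangle_ineq)
    also have "\<dots> \<le> cmod (\<zeta> - \<zeta>') * C + 2 * (C * cmod (\<zeta> - \<zeta>'))"
      using w le2 \<zeta> by (intro add_mono mult_mono) auto
    finally have 2: "cmod ((\<zeta> - n m) * ?w n \<zeta> - (\<zeta>' - n m) * ?w n \<zeta>') \<le> 3 * C * cmod (\<zeta> - \<zeta>')"
      by (simp add: algebra_simps)
    show ?thesis
      unfolding eq using 1 2 C(1) by auto
  qed
  then show ?case
    using C(1) by (intro exI[of _ "3 * C"]) auto
qed

text \<open>One step of Newton interpolation: the added term is a polynomial vanishing at 0 and at
  the old nodes, so base point and earlier hits survive, times the remaining error divided by W.
  Smallness is required of this quotient and not of the error, because W may itself tend to
  0.\<close>

lemma newton_step: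
  fixes h :: "'b \<Rightarrow> complex \<Rightarrow> complex ^ 'n::finite"
  assumes h: "small_lip F h" and X: "finite X" "m \<notin> X"
    and x: "\<And>l. l \<in> X \<Longrightarrow> \<forall>\<^sub>F \<epsilon> in F. cmod (x l \<epsilon>) < 1"
    and hit: "\<And>l. l \<in> X \<Longrightarrow> \<forall>\<^sub>F \<epsilon> in F. \<phi> (x l \<epsilon>) + h \<epsilon> (x l \<epsilon>) = q l \<epsilon>"
    and W: "\<And>\<epsilon>. W \<epsilon> = x m \<epsilon> * (\<Prod>l\<in>X. x m \<epsilon> - x l \<epsilon>)" "\<forall>\<^sub>F \<epsilon> in F. W \<epsilon> \<noteq> 0"
    and lim: "((\<lambda>\<epsilon>. (1 / W \<epsilon>) *s (q m \<epsilon> - \<phi> (x m \<epsilon>) - h \<epsilon> (x m \<epsilon>))) \<longlongrightarrow> 0) F"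
  shows "\<exists>h'. small_lip F h' \<and> (\<forall>l\<in>insert m X. \<forall>\<^sub>F \<epsilon> in F. \<phi> (x l \<epsilon>) + h' \<epsilon> (x l \<epsilon>) = q l \<epsilon>)"
proof -
  define y where "y \<epsilon> = (1 / W \<epsilon>) *s (q m \<epsilon> - \<phi> (x m \<epsilon>) - h \<epsilon> (x m \<epsilon>))" for \<epsilon>
  define w where "w \<epsilon> \<zeta> = \<zeta> * (\<Prod>l\<in>X. \<zeta> - x l \<epsilon>)" for \<epsilon> \<zeta>
  define h' where "h' \<epsilon> \<zeta> = h \<epsilon> \<zeta> + w \<epsilon> \<zeta> *s y \<epsilon>" for \<epsilon> \<zeta>
  have hol: "vholo (h' \<epsilon>) (ball 0 1) \<and> h' \<epsilon> 0 = 0" for \<epsilon>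
    using h unfolding h'_def w_def small_lip_def
    by (auto intro!: vholo_add vholo_smult vholo_const holomorphic_intros)
  obtain L where L: "(L \<longlongrightarrow> (0::real)) F" "\<forall>\<^sub>F \<epsilon> in F. \<forall>\<zeta>\<in>ball 0 1. \<forall>\<zeta>'\<in>ball 0 1.
      norm (h \<epsilon> \<zeta> - h \<epsilon> \<zeta>') \<le> L \<epsilon> * cmod (\<zeta> - \<zeta>')"
    using h by (auto simp: small_lip_def)
  obtain C where C: "\<And>n :: 'a \<Rightarrow> complex. \<forall>l\<in>X. cmod (n l) < 1 \<Longrightarrow> (\<forall>\<zeta>\<in>ball 0 1. \<forall>\<zeta>'\<in>ball 0 1.
      cmod (\<zeta> * (\<Prod>l\<in>X. \<zeta> - n l) - \<zeta>' * (\<Prod>l\<in>X. \<zeta>' - n l)) \<le> C * cmod (\<zeta> - \<zeta>'))"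
    using node_poly_bounds[OF X(1)] by blast
  have "\<forall>\<^sub>F \<epsilon> in F. \<forall>l\<in>X. cmod (x l \<epsilon>) < 1"
    using x X(1) by (intro eventually_ball_finite) auto
  with L(2) have "\<forall>\<^sub>F \<epsilon> in F. \<forall>\<zeta>\<in>ball 0 1. \<forall>\<zeta>'\<in>ball 0 1.
      norm (h' \<epsilon> \<zeta> - h' \<epsilon> \<zeta>') \<le> (L \<epsilon> + C * norm (y \<epsilon>)) * cmod (\<zeta> - \<zeta>')"
  proof eventually_elim
    case (elim \<epsilon>)
    show ?case
    proof (intro ballI)
      fix \<zeta> \<zeta>' :: complex assume \<zeta>: "\<zeta> \<in> ball 0 1" "\<zeta>' \<in> ball 0 1"
      have "h' \<epsilon> \<zeta> - h' \<epsilon> \<zeta>' = (h \<epsilon> \<zeta> - h \<epsilon> \<zeta>') + (w \<epsilon> \<zeta> - w \<epsilon> \<zeta>') *s y \<epsilon>"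
        by (simp add: h'_def vec_eq_iff algebra_simps)
      also have "norm \<dots> \<le> norm (h \<epsilon> \<zeta> - h \<epsilon> \<zeta>') + cmod (w \<epsilon> \<zeta> - w \<epsilon> \<zeta>') * norm (y \<epsilon>)"
        by (metis norm_triangle_ineq norm_vector_smult)
      also have "\<dots> \<le> L \<epsilon> * cmod (\<zeta> - \<zeta>') + (C * cmod (\<zeta> - \<zeta>')) * norm (y \<epsilon>)"
        using elim C[of "\<lambda>l. x l \<epsilon>"] \<zeta> by (intro add_mono mult_right_mono) (auto simp: w_def)
      finally show "norm (h' \<epsilon> \<zeta> - h' \<epsilon> \<zeta>') \<le> (L \<epsilon> + C * norm (y \<epsilon>)) * cmod (\<zeta> - \<zeta>')"
        by (simp add: algebra_simps)
    qed
  qed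
  moreover have "((\<lambda>\<epsilon>. L \<epsilon> + C * norm (y \<epsilon>)) \<longlongrightarrow> 0 + C * norm (0 :: complex ^ 'n)) F"
    using lim L(1) unfolding y_def by (intro tendsto_intros)
  ultimately have "small_lip F h'"
    using hol unfolding small_lip_def by (auto intro!: exI[of _ "\<lambda>\<epsilon>. L \<epsilon> + C * norm (y \<epsilon>)"])
  moreover have "\<forall>\<^sub>F \<epsilon> in F. \<phi> (x l \<epsilon>) + h' \<epsilon> (x l \<epsilon>) = q l \<epsilon>" if "l \<in> insert m X" for l
  proof (cases "l = m")
    case True
    from W(2) show ?thesis
    proof eventually_elim
      case (elim \<epsilon>)
      have "w \<epsilon> (x m \<epsilon>) = W \<epsilon>" by (simp add: w_def W(1))
      then have "w \<epsilon> (x m \<epsilon>) *s y \<epsilon> = q m \<epsilon> - \<phi> (x m \<epsilon>) - h \<epsilon> (x m \<epsilon>)"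
        using elim by (simp only: y_def vector_smult_assoc) simp
      then show ?case
        using True by (simp add: h'_def)
    qed
  next
    case False
    then have l: "l \<in> X" using that by simp
    have "w \<epsilon> (x l \<epsilon>) = 0" for \<epsilon>
      unfolding w_def using X(1) l by auto
    then show ?thesis using hit[OF l] by (simp add: h'_def)
  qed
  ultimately show ?thesis by blast
qed

text \<open>Induction over K, where each fixed node in D is followed at once by its companion at
  distance c. The first Newton coefficient tends to 0 because p k tends to \<phi> (\<xi> k). For the
  companion the divisor contains c, and the difference quotients over c of the poles and of the disc
  have the same limit, while that of the correction tends to 0.\<close>

lemma perturb_hits:
  fixes \<phi> :: "complex \<Rightarrow> complex ^ 'n::finite"
  assumes \<phi>: "vholo \<phi> (ball 0 1)"
    and K: "finite K" "inj_on \<xi> K" "\<And>k. k \<in> K \<Longrightarrow> \<xi> k \<in> ball 0 1 \<and> \<xi> k \<noteq> 0" "D \<subseteq> K"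
    and p: "\<And>k. k \<in> K \<Longrightarrow> (p k \<longlongrightarrow> \<phi> (\<xi> k)) F"
    and c: "\<And>k. k \<in> D \<Longrightarrow> (c k \<longlongrightarrow> 0) F" "\<And>k. k \<in> D \<Longrightarrow> \<forall>\<^sub>F \<epsilon> in F. c k \<epsilon> \<noteq> 0"
    and p': "\<And>k. k \<in> D \<Longrightarrow> ((\<lambda>\<epsilon>. (1 / c k \<epsilon>) *s (p' k \<epsilon> - p k \<epsilon>)) \<longlongrightarrow> vderiv \<phi> (\<xi> k)) F"
  shows "\<exists>h. small_lip F h \<and> (\<forall>k\<in>K. \<forall>\<^sub>F \<epsilon> in F. \<phi> (\<xi> k) + h \<epsilon> (\<xi> k) = p k \<epsilon>) \<and>
    (\<forall>k\<in>D. \<forall>\<^sub>F \<epsilon> in F. \<phi> (\<xi> k + c k \<epsilon>) + h \<epsilon> (\<xi> k + c k \<epsilon>) = p' k \<epsilon>)"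
proof -
  \<comment> \<open>The label \<open>(k, False)\<close> stands for the fixed node,
    \<open>(k, True)\<close> for its moving companion.\<close>
  define x where "x l \<epsilon> = (if snd l then \<xi> (fst l) + c (fst l) \<epsilon> else \<xi> (fst l))" for l :: "'a \<times> bool" and \<epsilon>
  define q where "q l \<epsilon> = (if snd l then p' (fst l) \<epsilon> else p (fst l) \<epsilon>)" for l :: "'a \<times> bool" and \<epsilon>
  define lab where "lab B = B \<times> {False} \<union> (B \<inter> D) \<times> {True}" for B
  have fin: "finite (lab B)" if "B \<subseteq> K" for B
    unfolding lab_def using K(1) that finite_subset by blast
  have x_lim: "(x l \<longlongrightarrow> \<xi> (fst l)) F" if "l \<in> lab K" for l
  proof (cases "snd l")
    case True
    then have "((\<lambda>\<epsilon>. \<xi> (fst l) + c (fst l) \<epsilon>) \<longlongrightarrow> \<xi> (fst l) + 0) F"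
      using that by (intro tendsto_intros c) (auto simp: lab_def)
    then show ?thesis using True unfolding x_def by simp
  qed (simp add: x_def[abs_def])
  have x_in: "\<forall>\<^sub>F \<epsilon> in F. cmod (x l \<epsilon>) < 1" if "l \<in> lab K" for l
    by (rule order_tendstoD(2)[OF tendsto_norm[OF x_lim[OF that]]]) (use K that in \<open>auto simp: lab_def\<close>)
  have "B \<subseteq> K \<Longrightarrow> \<exists>h. small_lip F h \<and> (\<forall>l\<in>lab B. \<forall>\<^sub>F \<epsilon> in F. \<phi> (x l \<epsilon>) + h \<epsilon> (x l \<epsilon>) = q l \<epsilon>)"
    if "finite B" for B
    using that
  proof (induction B rule: finite_induct)
    case empty
    then show ?case using small_lip_zero by (auto simp: lab_def)
  next
    case (insert k B)
    then have k: "k \<in> K" "k \<notin> B" "B \<subseteq> K" by auto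
    obtain h where h: "small_lip F h" "\<And>l. l \<in> lab B \<Longrightarrow> \<forall>\<^sub>F \<epsilon> in F. \<phi> (x l \<epsilon>) + h \<epsilon> (x l \<epsilon>) = q l \<epsilon>"
      using insert.IH k by blast
    have sub: "lab B \<subseteq> lab K" using k by (auto simp: lab_def)
    have xlt: "\<forall>\<^sub>F \<epsilon> in F. cmod (x l \<epsilon>) < 1" if "l \<in> lab B" for l
      using x_in sub that by blast
    have \<xi>k: "\<xi> k \<in> ball 0 1" "\<xi> k \<noteq> 0" using K(3)[OF k(1)] by auto
    have ne: "\<xi> k \<noteq> \<xi> (fst l)" if "l \<in> lab B" for l
      using inj_onD[OF K(2), of k "fst l"] that k by (auto simp: lab_def)
    define R where "R = \<xi> k * (\<Prod>l\<in>lab B. \<xi> k - \<xi> (fst l))"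
    have R: "R \<noteq> 0"
      unfolding R_def using \<xi>k ne fin[OF k(3)] by (auto simp: prod_zero_iff)
    have Rlim: "((\<lambda>\<epsilon>. y \<epsilon> * (\<Prod>l\<in>lab B. y \<epsilon> - x l \<epsilon>)) \<longlongrightarrow> R) F" if "(y \<longlongrightarrow> \<xi> k) F" for y
      unfolding R_def using that sub x_lim by (intro tendsto_intros) auto
    let ?m = "(k, False)" and ?m' = "(k, True)"
    have m: "?m \<notin> lab B" "?m' \<notin> insert ?m (lab B)" using k by (auto simp: lab_def)
    have Wlim: "((\<lambda>\<epsilon>. x ?m \<epsilon> * (\<Prod>l\<in>lab B. x ?m \<epsilon> - x l \<epsilon>)) \<longlongrightarrow> R) F"
      by (rule Rlim) (simp add: x_def)
    have "\<exists>h. small_lip F h \<and> (\<forall>l\<in>insert ?m (lab B). \<forall>\<^sub>F \<epsilon> in F. \<phi> (x l \<epsilon>) + h \<epsilon> (x l \<epsilon>) = q l \<epsilon>)"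
    proof (rule newton_step[OF h(1) fin[OF k(3)] m(1) xlt h(2) refl])
      show "\<forall>\<^sub>F \<epsilon> in F. x ?m \<epsilon> * (\<Prod>l\<in>lab B. x ?m \<epsilon> - x l \<epsilon>) \<noteq> 0"
        using tendsto_imp_eventually_ne[OF Wlim R] .
      have "((\<lambda>\<epsilon>. (1 / (x ?m \<epsilon> * (\<Prod>l\<in>lab B. x ?m \<epsilon> - x l \<epsilon>))) *s
          (p k \<epsilon> - \<phi> (\<xi> k) - h \<epsilon> (\<xi> k))) \<longlongrightarrow> (1 / R) *s (\<phi> (\<xi> k) - \<phi> (\<xi> k) - 0)) F"
        using \<xi>k by (intro tendsto_intros Wlim R p k(1) small_lip_tendsto[OF h(1)]) auto
      then show "((\<lambda>\<epsilon>. (1 / (x ?m \<epsilon> * (\<Prod>l\<in>lab B. x ?m \<epsilon> - x l \<epsilon>))) *s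
          (q ?m \<epsilon> - \<phi> (x ?m \<epsilon>) - h \<epsilon> (x ?m \<epsilon>))) \<longlongrightarrow> 0) F"
        by (simp add: q_def x_def)
    qed
    then obtain h1 where h1: "small_lip F h1"
        "\<And>l. l \<in> insert ?m (lab B) \<Longrightarrow> \<forall>\<^sub>F \<epsilon> in F. \<phi> (x l \<epsilon>) + h1 \<epsilon> (x l \<epsilon>) = q l \<epsilon>"
      by blast
    show ?case
    proof (cases "k \<in> D")
      case False
      then have "lab (insert k B) = insert ?m (lab B)" by (auto simp: lab_def)
      then show ?thesis using h1 by auto
    next
      case True
      then have lab_eq: "lab (insert k B) = insert ?m' (insert ?m (lab B))" by (auto simp: lab_def)
      have mK: "?m' \<in> lab K" "?m \<in> lab K" using True k by (auto simp: lab_def)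
      have x': "\<And>\<epsilon>. x ?m' \<epsilon> = \<xi> k + c k \<epsilon>" "\<And>\<epsilon>. x ?m \<epsilon> = \<xi> k" by (auto simp: x_def)
      have in1: "\<forall>\<^sub>F \<epsilon> in F. \<xi> k + c k \<epsilon> \<in> ball 0 1"
        using x_in[OF mK(1)] by (simp add: x')
      have xlt1: "\<forall>\<^sub>F \<epsilon> in F. cmod (x l \<epsilon>) < 1" if "l \<in> insert ?m (lab B)" for l
        using x_in sub that mK by blast
      \<comment> \<open>The Newton divisor of the companion with its vanishing factor
        \<open>c k \<epsilon>\<close> removed; what remains has the nonzero limit R.\<close>
      define W where "W \<epsilon> = (\<xi> k + c k \<epsilon>) * (\<Prod>l\<in>lab B. \<xi> k + c k \<epsilon> - x l \<epsilon>)" for \<epsilon>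
      have W: "(W \<longlongrightarrow> R) F"
        unfolding W_def using x_lim[OF mK(1)] by (intro Rlim) (simp add: x_def[abs_def])
      have Weq: "x ?m' \<epsilon> * (\<Prod>l\<in>insert ?m (lab B). x ?m' \<epsilon> - x l \<epsilon>) = c k \<epsilon> * W \<epsilon>" for \<epsilon>
        using m fin[OF k(3)] by (simp add: x' W_def)
      have atc: "filterlim (c k) (at 0) F"
        using c[OF True] by (simp add: filterlim_at)
      have "\<exists>h. small_lip F h \<and> (\<forall>l\<in>insert ?m' (insert ?m (lab B)).
          \<forall>\<^sub>F \<epsilon> in F. \<phi> (x l \<epsilon>) + h \<epsilon> (x l \<epsilon>) = q l \<epsilon>)"
      proof (rule newton_step[OF h1(1) _ m(2) xlt1 h1(2) refl])
        show "finite (insert ?m (lab B))" using fin k by auto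
        show "\<forall>\<^sub>F \<epsilon> in F. x ?m' \<epsilon> * (\<Prod>l\<in>insert ?m (lab B). x ?m' \<epsilon> - x l \<epsilon>) \<noteq> 0"
          unfolding Weq using c(2)[OF True] tendsto_imp_eventually_ne[OF W R]
          by eventually_elim simp
        have "((\<lambda>\<epsilon>. (1 / W \<epsilon>) *s ((1 / c k \<epsilon>) *s (p' k \<epsilon> - p k \<epsilon>)
              - (1 / c k \<epsilon>) *s (\<phi> (\<xi> k + c k \<epsilon>) - \<phi> (\<xi> k))
              - (1 / c k \<epsilon>) *s (h1 \<epsilon> (\<xi> k + c k \<epsilon>) - h1 \<epsilon> (\<xi> k))))
            \<longlongrightarrow> (1 / R) *s (vderiv \<phi> (\<xi> k) - vderiv \<phi> (\<xi> k) - 0)) F"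
          by (intro tendsto_intros W R p'[OF True] filterlim_compose[OF vholo_diffquot[OF \<phi>] atc]
              small_lip_diffquot_tendsto[OF h1(1)] in1 \<xi>k) auto
        \<comment> \<open>The first node is hit exactly, so its equation can be subtracted; this
          rewrites the remaining error as a combination of three differences.\<close>
        moreover have "\<forall>\<^sub>F \<epsilon> in F. (1 / W \<epsilon>) *s ((1 / c k \<epsilon>) *s (p' k \<epsilon> - p k \<epsilon>)
              - (1 / c k \<epsilon>) *s (\<phi> (\<xi> k + c k \<epsilon>) - \<phi> (\<xi> k))
              - (1 / c k \<epsilon>) *s (h1 \<epsilon> (\<xi> k + c k \<epsilon>) - h1 \<epsilon> (\<xi> k)))
            = (1 / (x ?m' \<epsilon> * (\<Prod>l\<in>insert ?m (lab B). x ?m' \<epsilon> - x l \<epsilon>))) *s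
              (q ?m' \<epsilon> - \<phi> (x ?m' \<epsilon>) - h1 \<epsilon> (x ?m' \<epsilon>))"
          using h1(2)[of ?m, OF insertI1]
        proof eventually_elim
          case (elim \<epsilon>)
          then have "p k \<epsilon> = \<phi> (\<xi> k) + h1 \<epsilon> (\<xi> k)" by (simp add: x_def q_def)
          then show ?case
            unfolding Weq by (simp add: q_def x' vec_eq_iff diff_divide_distrib add_divide_distrib mult.commute[of _ "c k \<epsilon>"])
        qed
        ultimately show "((\<lambda>\<epsilon>. (1 / (x ?m' \<epsilon> * (\<Prod>l\<in>insert ?m (lab B). x ?m' \<epsilon> - x l \<epsilon>))) *s
              (q ?m' \<epsilon> - \<phi> (x ?m' \<epsilon>) - h1 \<epsilon> (x ?m' \<epsilon>))) \<longlongrightarrow> 0) F"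
          using tendsto_cong by force
      qed
      then show ?thesis by (simp only: lab_eq)
    qed
  qed
  from this[OF K(1) order_refl] obtain h where h: "small_lip F h"
      "\<And>l. l \<in> lab K \<Longrightarrow> \<forall>\<^sub>F \<epsilon> in F. \<phi> (x l \<epsilon>) + h \<epsilon> (x l \<epsilon>) = q l \<epsilon>"
    by blast
  show ?thesis
  proof (intro exI conjI ballI)
    show "small_lip F h" by (rule h(1))
    show "\<forall>\<^sub>F \<epsilon> in F. \<phi> (\<xi> k) + h \<epsilon> (\<xi> k) = p k \<epsilon>" if "k \<in> K" for k
      using h(2)[of "(k, False)"] that by (simp add: lab_def x_def q_def)
    show "\<forall>\<^sub>F \<epsilon> in F. \<phi> (\<xi> k + c k \<epsilon>) + h \<epsilon> (\<xi> k + c k \<epsilon>) = p' k \<epsilon>" if "k \<in> D" for k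
      using h(2)[of "(k, True)"] that K(4) by (auto simp: lab_def x_def q_def)
  qed
qed

lemma small_lip_HolD:
  assumes \<Omega>: "open \<Omega>" and K: "compact K" "K \<subseteq> \<Omega>" and \<phi>: "vholo \<phi> (ball 0 1)"
    "\<And>\<zeta>. \<zeta> \<in> ball 0 1 \<Longrightarrow> \<phi> \<zeta> \<in> K" and h: "small_lip F h"
  shows "\<forall>\<^sub>F \<epsilon> in F. (\<lambda>\<zeta>. \<phi> \<zeta> + h \<epsilon> \<zeta>) \<in> HolD \<Omega>"
proof -
  obtain \<delta> where \<delta>: "\<delta> > 0" "(\<Union>x\<in>K. ball x \<delta>) \<subseteq> \<Omega>"
    using compact_subset_open_imp_ball_epsilon_subset K \<Omega> by metis
  obtain L where L: "(L \<longlongrightarrow> (0::real)) F" "\<forall>\<^sub>F \<epsilon> in F. \<forall>\<zeta>\<in>ball 0 1. \<forall>\<zeta>'\<in>ball 0 1.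
      norm (h \<epsilon> \<zeta> - h \<epsilon> \<zeta>') \<le> L \<epsilon> * cmod (\<zeta> - \<zeta>')"
    and hh: "\<And>\<epsilon>. h \<epsilon> 0 = 0" "\<And>\<epsilon>. vholo (h \<epsilon>) (ball 0 1)"
    using h by (auto simp: small_lip_def)
  have "\<forall>\<^sub>F \<epsilon> in F. L \<epsilon> < \<delta>"
    using order_tendstoD(2)[OF L(1) \<delta>(1)] .
  with L(2) show ?thesis
  proof eventually_elim
    case (elim \<epsilon>)
    have "\<phi> \<zeta> + h \<epsilon> \<zeta> \<in> \<Omega>" if \<zeta>: "\<zeta> \<in> ball 0 1" for \<zeta>
    proof -
      have "norm (h \<epsilon> \<zeta> - h \<epsilon> 0) \<le> L \<epsilon> * cmod (\<zeta> - 0)"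
        using elim(1) \<zeta> by (metis centre_in_ball zero_less_one)
      also have "\<dots> \<le> max 0 (L \<epsilon>) * 1"
        using \<zeta> by (intro mult_mono) auto
      also have "\<dots> < \<delta>" using elim(2) \<delta>(1) by simp
      finally have "\<phi> \<zeta> + h \<epsilon> \<zeta> \<in> ball (\<phi> \<zeta>) \<delta>"
        by (simp add: hh dist_norm)
      then show ?thesis using \<delta>(2) \<phi>(2)[OF \<zeta>] by blast
    qed
    then show ?case
      using vholo_add[OF \<phi>(1) hh(2)] by (auto simp: HolD_iff)
  qed
qed

lemma vderiv_dilation:
  assumes "\<phi> \<in> HolD \<Omega>" "0 < r" "r < 1" "\<xi> \<in> ball 0 1"
  shows "vderiv (\<lambda>\<zeta>. \<phi> (of_real r * \<zeta>)) \<xi> = of_real r *s vderiv \<phi> (of_real r * \<xi>)"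
proof -
  have "cmod (of_real r * \<xi>) < 1"
    using assms mult_strict_mono'[of r 1 "cmod \<xi>" 1] by (auto simp: norm_mult)
  then have "((\<lambda>\<zeta>. \<phi> \<zeta> $ i) has_field_derivative deriv (\<lambda>\<zeta>. \<phi> \<zeta> $ i) (of_real r * \<xi>)) (at (of_real r * \<xi>))" for i
    using assms(1) holomorphic_derivI[of _ "ball 0 1"] by (auto simp: HolD_iff vholo_def)
  then have "((\<lambda>\<zeta>. \<phi> (of_real r * \<zeta>) $ i) has_field_derivative
      deriv (\<lambda>\<zeta>. \<phi> \<zeta> $ i) (of_real r * \<xi>) * of_real r) (at \<xi>)" for i
    by (rule DERIV_chain2) (auto intro!: derivative_eq_intros)
  then show ?thesis
    by (auto simp: vderiv_def vec_eq_iff mult.commute intro: DERIV_imp_deriv)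
qed

text \<open>The vector d is a multiple \<mu> of v, and u is asymptotically parallel to v. For \<mu>
  different from 0 the gap is the v-component of u divided by \<mu>, so that u / c has the
  v-component of d exactly. For \<mu> = 0 any gap tending to 0 more slowly than u works.\<close>

lemma exists_node_gap:
  fixes u :: "'b \<Rightarrow> complex ^ 'n::finite"
  assumes v: "norm v = 1" and d: "cproj v d = 0" and u: "(u \<longlongrightarrow> 0) F"
    and pd: "((\<lambda>\<epsilon>. proj_dist (u \<epsilon>) v) \<longlongrightarrow> 0) F"
  shows "\<exists>c. (c \<longlongrightarrow> 0) F \<and> (\<forall>\<^sub>F \<epsilon> in F. c \<epsilon> \<noteq> 0) \<and> ((\<lambda>\<epsilon>. (1 / c \<epsilon>) *s u \<epsilon>) \<longlongrightarrow> d) F"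
proof -
  \<comment> \<open>This also excludes u = 0, where \<open>proj_dist\<close> equals 1 by the
    convention 0 / 0 = 0. A sine below 1/2 makes the component along v dominate, and the factor 2
    below is generous.\<close>
  have "\<forall>\<^sub>F \<epsilon> in F. \<bar>proj_dist (u \<epsilon>) v\<bar> < 1/2"
    using tendsto_rabs[OF pd] by (intro order_tendstoD(2)[where y = "0::real"]) auto
  then have ev: "\<forall>\<^sub>F \<epsilon> in F. u \<epsilon> \<noteq> 0 \<and> norm (u \<epsilon>) \<le> 2 * cmod (cdot (u \<epsilon>) v)"
  proof eventually_elim
    case (elim \<epsilon>)
    have "u \<epsilon> \<noteq> 0"
    proof
      assume "u \<epsilon> = 0"
      then have "proj_dist (u \<epsilon>) v = 1" by (simp add: proj_dist_def)
      then show False using elim by simp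
    qed
    moreover have "norm (cproj v (u \<epsilon>)) \<le> norm (u \<epsilon>) * (1/2)"
      unfolding norm_cproj_eq_proj_dist[OF v] using elim by (intro mult_left_mono) auto
    then have "(norm (cproj v (u \<epsilon>)))\<^sup>2 \<le> (norm (u \<epsilon>) * (1/2))\<^sup>2"
      by (intro power_mono) auto
    then have "(norm (cproj v (u \<epsilon>)))\<^sup>2 \<le> (norm (u \<epsilon>))\<^sup>2 / 4"
      by (simp add: power_divide)
    then have "(norm (u \<epsilon>))\<^sup>2 \<le> 4 * (cmod (cdot (u \<epsilon>) v))\<^sup>2"
      using norm_cproj_sq[OF v, of "u \<epsilon>"] zero_le_power2[of "cmod (cdot (u \<epsilon>) v)"] by linarith
    then have "(norm (u \<epsilon>))\<^sup>2 \<le> (2 * cmod (cdot (u \<epsilon>) v))\<^sup>2"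
      by (simp add: power_mult_distrib)
    then have "norm (u \<epsilon>) \<le> 2 * cmod (cdot (u \<epsilon>) v)"
      by (rule power2_le_imp_le) simp
    ultimately show ?case by simp
  qed
  define \<mu> where "\<mu> = cdot d v"
  have d_eq: "d = \<mu> *s v"
    using d by (simp add: cproj_def \<mu>_def)
  show ?thesis
  proof (cases "\<mu> = 0")
    case True
    \<comment> \<open>With the square root, both c and u / c have norm
      \<open>sqrt (norm (u \<epsilon>))\<close>.\<close>
    define c where "c \<epsilon> = complex_of_real (sqrt (norm (u \<epsilon>)))" for \<epsilon>
    have "(c \<longlongrightarrow> of_real (sqrt (norm (0 :: complex ^ 'n)))) F"
      unfolding c_def by (intro tendsto_intros u)
    then have c0: "(c \<longlongrightarrow> 0) F" by simp
    have "norm ((1 / c \<epsilon>) *s u \<epsilon>) = norm (c \<epsilon>)" for \<epsilon>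
      unfolding norm_vector_smult by (simp add: c_def norm_divide real_div_sqrt)
    then have "((\<lambda>\<epsilon>. norm ((1 / c \<epsilon>) *s u \<epsilon>)) \<longlongrightarrow> 0) F"
      using tendsto_norm_zero[OF c0] by (simp only:)
    then have "((\<lambda>\<epsilon>. (1 / c \<epsilon>) *s u \<epsilon>) \<longlongrightarrow> 0) F"
      by (rule tendsto_norm_zero_cancel)
    moreover have "\<forall>\<^sub>F \<epsilon> in F. c \<epsilon> \<noteq> 0"
      using ev by eventually_elim (simp add: c_def)
    ultimately show ?thesis
      using c0 True d_eq by (intro exI[of _ c]) simp
  next
    case False
    define c where "c \<epsilon> = cdot (u \<epsilon>) v / \<mu>" for \<epsilon>
    have "(c \<longlongrightarrow> cdot 0 v / \<mu>) F"
      unfolding c_def by (intro tendsto_intros u False)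
    then have c0: "(c \<longlongrightarrow> 0) F" by (simp add: cdot_def)
    have c_ne: "\<forall>\<^sub>F \<epsilon> in F. c \<epsilon> \<noteq> 0"
      using ev by eventually_elim (use False in \<open>auto simp: c_def\<close>)
    have "\<forall>\<^sub>F \<epsilon> in F. norm ((1 / c \<epsilon>) *s u \<epsilon> - d) \<le> cmod \<mu> * 2 * \<bar>proj_dist (u \<epsilon>) v\<bar>"
      using ev c_ne
    proof eventually_elim
      case (elim \<epsilon>)
      let ?s = "cdot (u \<epsilon>) v"
      have s: "?s \<noteq> 0" using elim(2) by (auto simp: c_def)
      have "(1 / c \<epsilon>) *s u \<epsilon> - d = (\<mu> / ?s) *s cproj v (u \<epsilon>)"
        using s by (simp add: c_def d_eq cproj_def vec_eq_iff field_simps)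
      then have "norm ((1 / c \<epsilon>) *s u \<epsilon> - d) = cmod \<mu> / cmod ?s * (norm (u \<epsilon>) * proj_dist (u \<epsilon>) v)"
        by (simp only: norm_vector_smult norm_divide norm_cproj_eq_proj_dist[OF v])
      also have "\<dots> \<le> cmod \<mu> / cmod ?s * ((2 * cmod ?s) * \<bar>proj_dist (u \<epsilon>) v\<bar>)"
        using elim(1) by (intro mult_left_mono order_trans[OF mult_left_mono[OF abs_ge_self] mult_right_mono]) auto
      also have "\<dots> = cmod \<mu> * 2 * \<bar>proj_dist (u \<epsilon>) v\<bar>"
        using s by simp
      finally show ?case .
    qed
    moreover have "((\<lambda>\<epsilon>. cmod \<mu> * 2 * \<bar>proj_dist (u \<epsilon>) v\<bar>) \<longlongrightarrow> cmod \<mu> * 2 * \<bar>0\<bar>) F"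
      by (intro tendsto_intros pd)
    then have "((\<lambda>\<epsilon>. cmod \<mu> * 2 * \<bar>proj_dist (u \<epsilon>) v\<bar>) \<longlongrightarrow> 0) F" by simp
    ultimately have "((\<lambda>\<epsilon>. (1 / c \<epsilon>) *s u \<epsilon> - d) \<longlongrightarrow> 0) F"
      by (rule Lim_null_comparison)
    then have "((\<lambda>\<epsilon>. (1 / c \<epsilon>) *s u \<epsilon>) \<longlongrightarrow> d) F"
      by (simp add: LIM_zero_iff)
    then show ?thesis using c0 c_ne by blast
  qed
qed

text \<open>D contains the nodes to be split, so their logarithms count twice. The strict inequality
  pays for a dilation, which keeps derivatives parallel to v; then the nodes of the perturbed discs
  converge, and so does the sum of their logarithms.\<close>

lemma coman_lempert_eventually_less:
  fixes \<phi> :: "complex \<Rightarrow> complex ^ 'n::finite"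
  assumes \<Omega>: "open \<Omega>" "convex \<Omega>" and \<phi>: "\<phi> \<in> HolD \<Omega>" "\<phi> 0 = z"
    and K: "finite K" "inj_on \<xi> K" "\<And>k. k \<in> K \<Longrightarrow> \<xi> k \<in> ball 0 1 \<and> \<xi> k \<noteq> 0" "D \<subseteq> K"
    and P: "\<forall>\<^sub>F \<epsilon> in F. finite (P \<epsilon>) \<and> P \<epsilon> \<subseteq> \<Omega>"
    and p: "\<And>k. k \<in> K \<Longrightarrow> (p k \<longlongrightarrow> \<phi> (\<xi> k)) F"
    and p': "\<And>k. k \<in> D \<Longrightarrow> (p' k \<longlongrightarrow> \<phi> (\<xi> k)) F"
    and v: "\<And>k. k \<in> D \<Longrightarrow> norm (v k) = 1" "\<And>k. k \<in> D \<Longrightarrow> cproj (v k) (vderiv \<phi> (\<xi> k)) = 0"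
    and dir: "\<And>k. k \<in> D \<Longrightarrow> ((\<lambda>\<epsilon>. proj_dist (p' k \<epsilon> - p k \<epsilon>) (v k)) \<longlongrightarrow> 0) F"
    and q: "\<And>\<epsilon> k. q \<epsilon> (k, False) = p k \<epsilon>" "\<And>\<epsilon> k. q \<epsilon> (k, True) = p' k \<epsilon>"
    and Lab: "Lab = K \<times> {False} \<union> D \<times> {True}"
    and inj: "\<forall>\<^sub>F \<epsilon> in F. inj_on (q \<epsilon>) Lab \<and> q \<epsilon> ` Lab \<subseteq> P \<epsilon>"
    and less: "(\<Sum>k\<in>K. ln (cmod (\<xi> k))) + (\<Sum>k\<in>D. ln (cmod (\<xi> k))) < C"
  shows "\<forall>\<^sub>F \<epsilon> in F. coman_lempert \<Omega> (P \<epsilon>) z < ereal C"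
proof -
  have finD: "finite D" using K finite_subset by blast
  define V where "V = (\<Sum>k\<in>K. ln (cmod (\<xi> k))) + (\<Sum>k\<in>D. ln (cmod (\<xi> k)))"
  obtain r where r: "0 < r" "r < 1" "\<And>k. k \<in> K \<Longrightarrow> cmod (\<xi> k) < r"
      "real (card K + card D) * - ln r < C - V"
    using exists_dilation_factor[OF K(1), of "\<lambda>k. cmod (\<xi> k)" "C - V" "card K + card D"] K(3) less
    by (auto simp: V_def)
  define \<psi> where "\<psi> \<zeta> = \<phi> (of_real r * \<zeta>)" for \<zeta>
  define \<eta> where "\<eta> k = \<xi> k / of_real r" for k
  have r\<eta>: "of_real r * \<eta> k = \<xi> k" for k
    using r by (simp add: \<eta>_def)
  have \<eta>: "\<eta> k \<in> ball 0 1 \<and> \<eta> k \<noteq> 0" if "k \<in> K" for k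
    using that K(3) r by (auto simp: \<eta>_def norm_divide)
  have inj\<eta>: "inj_on \<eta> K"
    using K(2) r by (auto simp: inj_on_def \<eta>_def)
  have \<psi>: "vholo \<psi> (ball 0 1)"
    unfolding \<psi>_def using r by (intro vholo_dilation[OF \<phi>(1)]) auto
  have ex: "\<exists>c. (c \<longlongrightarrow> 0) F \<and> (\<forall>\<^sub>F \<epsilon> in F. c \<epsilon> \<noteq> 0) \<and>
      ((\<lambda>\<epsilon>. (1 / c \<epsilon>) *s (p' k \<epsilon> - p k \<epsilon>)) \<longlongrightarrow> vderiv \<psi> (\<eta> k)) F" if k: "k \<in> D" for k
  proof (rule exists_node_gap[OF v(1)[OF k] _ _ dir[OF k]])
    show "cproj (v k) (vderiv \<psi> (\<eta> k)) = 0"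
    proof -
      have "vderiv \<psi> (\<eta> k) = of_real r *s vderiv \<phi> (\<xi> k)"
        unfolding \<psi>_def using vderiv_dilation[OF \<phi>(1) r(1,2), of "\<eta> k"] \<eta>[of k] K(4) k by (auto simp: r\<eta>)
      then show ?thesis
        by (simp only: cproj_smult v(2)[OF k] vector_smult_rzero)
    qed
    have "((\<lambda>\<epsilon>. p' k \<epsilon> - p k \<epsilon>) \<longlongrightarrow> \<phi> (\<xi> k) - \<phi> (\<xi> k)) F"
      using k K(4) by (intro tendsto_intros p p') auto
    then show "((\<lambda>\<epsilon>. p' k \<epsilon> - p k \<epsilon>) \<longlongrightarrow> 0) F" by simp
  qed
  have "\<exists>c. \<forall>k\<in>D. (c k \<longlongrightarrow> 0) F \<and> (\<forall>\<^sub>F \<epsilon> in F. c k \<epsilon> \<noteq> 0) \<and>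
      ((\<lambda>\<epsilon>. (1 / c k \<epsilon>) *s (p' k \<epsilon> - p k \<epsilon>)) \<longlongrightarrow> vderiv \<psi> (\<eta> k)) F"
    by (rule bchoice, rule ballI, rule ex)
  then obtain c where c: "\<And>k. k \<in> D \<Longrightarrow> (c k \<longlongrightarrow> 0) F" "\<And>k. k \<in> D \<Longrightarrow> \<forall>\<^sub>F \<epsilon> in F. c k \<epsilon> \<noteq> 0"
      "\<And>k. k \<in> D \<Longrightarrow> ((\<lambda>\<epsilon>. (1 / c k \<epsilon>) *s (p' k \<epsilon> - p k \<epsilon>)) \<longlongrightarrow> vderiv \<psi> (\<eta> k)) F"
    by blast
  have p\<psi>: "(p k \<longlongrightarrow> \<psi> (\<eta> k)) F" if "k \<in> K" for k
    using p[OF that] by (simp add: \<psi>_def r\<eta>)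
  have "\<exists>h. small_lip F h \<and> (\<forall>k\<in>K. \<forall>\<^sub>F \<epsilon> in F. \<psi> (\<eta> k) + h \<epsilon> (\<eta> k) = p k \<epsilon>) \<and>
      (\<forall>k\<in>D. \<forall>\<^sub>F \<epsilon> in F. \<psi> (\<eta> k + c k \<epsilon>) + h \<epsilon> (\<eta> k + c k \<epsilon>) = p' k \<epsilon>)"
  proof (rule perturb_hits[where \<phi> = \<psi> and K = K and D = D and \<xi> = \<eta> and F = F and p = p and p' = p' and c = c])
    show "D \<subseteq> K" by (rule K(4))
  qed (fact \<psi> K(1) inj\<eta> \<eta> p\<psi> c)+
  then obtain h where h: "small_lip F h" "\<And>k. k \<in> K \<Longrightarrow> \<forall>\<^sub>F \<epsilon> in F. \<psi> (\<eta> k) + h \<epsilon> (\<eta> k) = p k \<epsilon>"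
      "\<And>k. k \<in> D \<Longrightarrow> \<forall>\<^sub>F \<epsilon> in F. \<psi> (\<eta> k + c k \<epsilon>) + h \<epsilon> (\<eta> k + c k \<epsilon>) = p' k \<epsilon>"
    by blast
  obtain Q where Q: "compact Q" "Q \<subseteq> \<Omega>" "\<And>\<zeta>. \<zeta> \<in> ball 0 1 \<Longrightarrow> \<psi> \<zeta> \<in> Q"
    unfolding \<psi>_def using HolD_dilation_compact[OF \<phi>(1), of r] r by auto
  have hol: "\<forall>\<^sub>F \<epsilon> in F. (\<lambda>\<zeta>. \<psi> \<zeta> + h \<epsilon> \<zeta>) \<in> HolD \<Omega>"
    by (rule small_lip_HolD[OF \<Omega>(1) Q(1,2) \<psi> Q(3) h(1)])
  define x where "x \<epsilon> l = (if snd l then \<eta> (fst l) + c (fst l) \<epsilon> else \<eta> (fst l))" for l :: "'a \<times> bool" and \<epsilon>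
  have finLab: "finite Lab" unfolding Lab using K(1) finD by auto
  have x_lim: "((\<lambda>\<epsilon>. x \<epsilon> l) \<longlongrightarrow> \<eta> (fst l)) F" if "l \<in> Lab" for l
  proof (cases "snd l")
    case True
    then have "((\<lambda>\<epsilon>. \<eta> (fst l) + c (fst l) \<epsilon>) \<longlongrightarrow> \<eta> (fst l) + 0) F"
      using that by (intro tendsto_intros c) (auto simp: Lab)
    then show ?thesis using True unfolding x_def by simp
  qed (simp add: x_def)
  have fstK: "fst l \<in> K" if "l \<in> Lab" for l
    using that K(4) by (auto simp: Lab)
  have hits: "\<forall>\<^sub>F \<epsilon> in F. \<forall>l\<in>Lab. \<psi> (x \<epsilon> l) + h \<epsilon> (x \<epsilon> l) = q \<epsilon> l"
  proof (intro eventually_ball_finite ballI finLab)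
    fix l assume "l \<in> Lab"
    then show "\<forall>\<^sub>F \<epsilon> in F. \<psi> (x \<epsilon> l) + h \<epsilon> (x \<epsilon> l) = q \<epsilon> l"
      using h(2)[of "fst l"] h(3)[of "fst l"] by (auto simp: Lab x_def q)
  qed
  have inside: "\<forall>\<^sub>F \<epsilon> in F. \<forall>l\<in>Lab. 0 < cmod (x \<epsilon> l) \<and> cmod (x \<epsilon> l) < 1"
  proof (intro eventually_ball_finite ballI finLab eventually_conj)
    fix l assume l: "l \<in> Lab"
    show "\<forall>\<^sub>F \<epsilon> in F. 0 < cmod (x \<epsilon> l)"
      by (rule order_tendstoD(1)[OF tendsto_norm[OF x_lim[OF l]]]) (use \<eta>[OF fstK[OF l]] in simp)
    show "\<forall>\<^sub>F \<epsilon> in F. cmod (x \<epsilon> l) < 1"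
      by (rule order_tendstoD(2)[OF tendsto_norm[OF x_lim[OF l]]]) (use \<eta>[OF fstK[OF l]] in simp)
  qed
  have "((\<lambda>\<epsilon>. \<Sum>l\<in>Lab. ln (cmod (x \<epsilon> l))) \<longlongrightarrow> (\<Sum>l\<in>Lab. ln (cmod (\<eta> (fst l))))) F"
    using \<eta>[OF fstK] by (intro tendsto_intros x_lim) auto
  moreover have "(\<Sum>l\<in>Lab. ln (cmod (\<eta> (fst l)))) < C"
  proof -
    have "(\<Sum>l\<in>Lab. ln (cmod (\<eta> (fst l)))) =
        (\<Sum>l\<in>K \<times> {False}. ln (cmod (\<eta> (fst l)))) + (\<Sum>l\<in>D \<times> {True}. ln (cmod (\<eta> (fst l))))"
      unfolding Lab using K(1) finD by (intro sum.union_disjoint) auto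
    also have "\<dots> = (\<Sum>k\<in>K. ln (cmod (\<eta> k))) + (\<Sum>k\<in>D. ln (cmod (\<eta> k)))"
      by (simp add: sum.cartesian_product' flip: sum.cartesian_product)
    also have "\<dots> = (\<Sum>k\<in>K. ln (cmod (\<xi> k)) + - ln r) + (\<Sum>k\<in>D. ln (cmod (\<xi> k)) + - ln r)"
    proof -
      have "ln (cmod (\<eta> k)) = ln (cmod (\<xi> k)) + - ln r" if "k \<in> K" for k
        using K(3)[OF that] r ln_div[of "cmod (\<xi> k)" r] by (simp add: \<eta>_def norm_divide)
      then show ?thesis
        using K(4) by (intro arg_cong2[of _ _ _ _ "(+)"] sum.cong) auto
    qed
    also have "\<dots> = V + real (card K + card D) * - ln r"
      by (simp add: sum.distrib sum_subtractf V_def algebra_simps)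
    also have "\<dots> < C" using r(4) by simp
    finally show ?thesis .
  qed
  ultimately have "\<forall>\<^sub>F \<epsilon> in F. (\<Sum>l\<in>Lab. ln (cmod (x \<epsilon> l))) < C"
    by (rule order_tendstoD)
  with hol hits inside inj P show ?thesis
  proof eventually_elim
    case (elim \<epsilon>)
    have "coman_lempert \<Omega> (P \<epsilon>) z \<le> (\<Sum>l\<in>Lab. elog (cmod (x \<epsilon> l)))"
    proof (rule coman_lempert_le[OF \<Omega>, of "P \<epsilon>" "q \<epsilon>" Lab "\<lambda>\<zeta>. \<psi> \<zeta> + h \<epsilon> \<zeta>"])
      show "\<psi> 0 + h \<epsilon> 0 = z"
        using \<phi>(2) h(1) by (simp add: \<psi>_def small_lip_def)
    qed (use elim in auto)
    also have "\<dots> = (\<Sum>l\<in>Lab. ereal (ln (cmod (x \<epsilon> l))))"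
      using elim(3) by (intro sum.cong elog_pos refl) auto
    also have "\<dots> < ereal C" using elim by simp
    finally show ?case .
  qed
qed

section \<open>Limits and derivative perturbations of discs\<close>

text \<open>Successive extraction, possible because Q survives passage to subsequences. It serves
  for the coordinates in Montel's theorem and again for the nodes of the discs.\<close>

lemma finite_common_subseq:
  fixes Q :: "'l \<Rightarrow> (nat \<Rightarrow> nat) \<Rightarrow> bool"
  assumes "finite X"
    and ex: "\<And>l (s :: nat \<Rightarrow> nat). l \<in> X \<Longrightarrow> strict_mono s \<Longrightarrow> \<exists>r. strict_mono (r :: nat \<Rightarrow> nat) \<and> Q l (s \<circ> r)"
    and sub: "\<And>l s (r :: nat \<Rightarrow> nat). l \<in> X \<Longrightarrow> Q l s \<Longrightarrow> strict_mono r \<Longrightarrow> Q l (s \<circ> r)"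
  shows "\<exists>r. strict_mono r \<and> (\<forall>l\<in>X. Q l r)"
proof -
  have "Y \<subseteq> X \<Longrightarrow> \<exists>r. strict_mono r \<and> (\<forall>l\<in>Y. Q l r)" if "finite Y" for Y
    using that
  proof (induction Y rule: finite_induct)
    case empty
    then show ?case using strict_mono_id by auto
  next
    case (insert m Y)
    then obtain s where s: "strict_mono s" "\<forall>l\<in>Y. Q l s" and m: "m \<in> X" by auto
    obtain r where r: "strict_mono r" "Q m (s \<circ> r)"
      using ex[OF m s(1)] by blast
    have "Q l (s \<circ> r)" if "l \<in> Y" for l
      using sub[of l s r] s(2) r(1) that insert.prems by blast
    then show ?case
      using strict_mono_o[OF s(1) r(1)] r(2) by blast
  qed
  then show ?thesis using assms(1) by blast
qed

text \<open>Locally uniform convergence stated by coordinates, the form in which the scalar Montel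
  theorem and Cauchy estimates apply.\<close>

definition locally_tends :: "(nat \<Rightarrow> complex \<Rightarrow> complex ^ 'n::finite) \<Rightarrow> (complex \<Rightarrow> complex ^ 'n) \<Rightarrow> bool" where
  "locally_tends f \<phi> \<longleftrightarrow> (\<forall>i K. compact K \<longrightarrow> K \<subseteq> ball 0 1 \<longrightarrow>
    uniform_limit K (\<lambda>n \<zeta>. f n \<zeta> $ i) (\<lambda>\<zeta>. \<phi> \<zeta> $ i) sequentially)"

lemma uniform_limit_subseq:
  assumes "uniform_limit K f g sequentially" "strict_mono r"
  shows "uniform_limit K (\<lambda>n. f (r n)) g sequentially"
  using assms unfolding uniform_limit_iff
  by (auto intro: eventually_subseq)

lemma vector_Montel:
  fixes f :: "nat \<Rightarrow> complex \<Rightarrow> complex ^ 'n::finite"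
  assumes f: "\<And>n. vholo (f n) (ball 0 1)" and B: "\<And>n \<zeta>. \<zeta> \<in> ball 0 1 \<Longrightarrow> norm (f n \<zeta>) \<le> B"
  obtains r \<phi> where "strict_mono r" "vholo \<phi> (ball 0 1)" "locally_tends (\<lambda>n. f (r n)) \<phi>"
proof -
  define Q where "Q i s \<longleftrightarrow> (\<exists>g. g holomorphic_on ball 0 1 \<and> (\<forall>K. compact K \<longrightarrow> K \<subseteq> ball 0 1 \<longrightarrow>
      uniform_limit K (\<lambda>n \<zeta>. f (s n) \<zeta> $ i) g sequentially))" for i and s :: "nat \<Rightarrow> nat"
  have "\<exists>r. strict_mono r \<and> (\<forall>i\<in>UNIV. Q i r)"
  proof (rule finite_common_subseq)
    fix i and s :: "nat \<Rightarrow> nat"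
    define H where "H = {h. h holomorphic_on ball 0 1 \<and> (\<forall>\<zeta>\<in>ball 0 1. cmod (h \<zeta>) \<le> B)}"
    obtain g r where gr: "g holomorphic_on ball 0 1" "strict_mono (r :: nat \<Rightarrow> nat)"
      "\<And>K. compact K \<Longrightarrow> K \<subseteq> ball 0 1 \<Longrightarrow> uniform_limit K ((\<lambda>n \<zeta>. f (s n) \<zeta> $ i) \<circ> r) g sequentially"
    proof (rule Montel[of "ball 0 1" H "\<lambda>n \<zeta>. f (s n) \<zeta> $ i"])
      show "range (\<lambda>n \<zeta>. f (s n) \<zeta> $ i) \<subseteq> H"
        using f order_trans[OF Finite_Cartesian_Product.norm_nth_le B] by (auto simp: H_def vholo_def)
      show "\<exists>B. \<forall>h\<in>H. \<forall>\<zeta>\<in>K. cmod (h \<zeta>) \<le> B" if "K \<subseteq> ball 0 1" for K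
        using that unfolding H_def by blast
    qed (auto simp: H_def)
    then have "Q i (s \<circ> r)"
      unfolding Q_def o_def by (intro exI[of _ g]) auto
    then show "\<exists>r. strict_mono r \<and> Q i (s \<circ> r)"
      using gr(2) by blast
  next
    fix i and s r :: "nat \<Rightarrow> nat"
    assume "Q i s" "strict_mono r"
    then show "Q i (s \<circ> r)"
      unfolding Q_def o_def using uniform_limit_subseq[where f = "\<lambda>n \<zeta>. f (s n) \<zeta> $ i" and r = r] by blast
  qed simp
  then obtain r where r: "strict_mono r" "\<forall>i. Q i r" by auto
  then obtain g where g: "\<And>i. g i holomorphic_on ball 0 1"
      "\<And>i K. compact K \<Longrightarrow> K \<subseteq> ball 0 1 \<Longrightarrow> uniform_limit K (\<lambda>n \<zeta>. f (r n) \<zeta> $ i) (g i) sequentially"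
    unfolding Q_def by metis
  show thesis
    by (rule that[of r "\<lambda>\<zeta>. \<chi> i. g i \<zeta>"]) (use r g in \<open>auto simp: vholo_def locally_tends_def\<close>)
qed

lemma locally_tends_subseq: "locally_tends f \<phi> \<Longrightarrow> strict_mono r \<Longrightarrow> locally_tends (\<lambda>n. f (r n)) \<phi>"
  unfolding locally_tends_def using uniform_limit_subseq by fast

lemma exists_cball_in_disc:
  fixes \<alpha> :: complex
  assumes "\<alpha> \<in> ball 0 1"
  obtains \<rho> where "\<rho> > 0" "cball \<alpha> \<rho> \<subseteq> ball 0 1"
  using assms open_ball open_contains_cball by blast

lemma locally_tends_moving:
  assumes "locally_tends f \<phi>" "vholo \<phi> (ball 0 1)" "x \<longlonglongrightarrow> \<alpha>" "\<alpha> \<in> ball 0 1"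
  shows "(\<lambda>n. f n (x n)) \<longlonglongrightarrow> \<phi> \<alpha>"
proof (rule vec_tendstoI)
  fix i
  obtain \<rho> where \<rho>: "\<rho> > 0" "cball \<alpha> \<rho> \<subseteq> ball 0 1"
    using exists_cball_in_disc assms(4) by blast
  have xin: "\<forall>\<^sub>F n in sequentially. x n \<in> cball \<alpha> \<rho>"
    using tendstoD[OF assms(3) \<rho>(1)] by eventually_elim (simp add: dist_commute)
  have "(\<lambda>n. f n (x n) $ i - \<phi> (x n) $ i) \<longlonglongrightarrow> 0"
  proof (rule tendstoI)
    fix e :: real assume "e > 0"
    then have "\<forall>\<^sub>F n in sequentially. \<forall>\<zeta>\<in>cball \<alpha> \<rho>. dist (f n \<zeta> $ i) (\<phi> \<zeta> $ i) < e"
      using assms(1) \<rho>(2) unfolding locally_tends_def uniform_limit_iff by (meson compact_cball)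
    with xin show "\<forall>\<^sub>F n in sequentially. dist (f n (x n) $ i - \<phi> (x n) $ i) 0 < e"
      by eventually_elim (simp add: dist_norm)
  qed
  moreover have "(\<lambda>n. \<phi> (x n) $ i) \<longlonglongrightarrow> \<phi> \<alpha> $ i"
  proof -
    have "isCont \<phi> \<alpha>"
      using vholo_continuous[OF assms(2)] assms(4) by (simp add: continuous_on_eq_continuous_at)
    then show ?thesis
      using assms(3) by (intro tendsto_vec_nth isCont_tendsto_compose[of _ \<phi>])
  qed
  ultimately show "(\<lambda>n. f n (x n) $ i) \<longlonglongrightarrow> \<phi> \<alpha> $ i"
    using tendsto_add by fastforce
qed

text \<open>The linear function with slope g'(\<alpha>) is subtracted from f n. Near \<alpha> the
  remaining derivative is small: Cauchy's inequality controls the derivative of f n - g, and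
  continuity controls g' - g'(\<alpha>). The mean value inequality then treats both moving points at
  once.\<close>

lemma diffquot_tendsto_deriv:
  fixes f :: "nat \<Rightarrow> complex \<Rightarrow> complex"
  assumes f: "\<And>n. f n holomorphic_on ball 0 1" and g: "g holomorphic_on ball 0 1"
    and ul: "\<And>K. compact K \<Longrightarrow> K \<subseteq> ball 0 1 \<Longrightarrow> uniform_limit K f g sequentially"
    and x: "x \<longlonglongrightarrow> \<alpha>" "y \<longlonglongrightarrow> \<alpha>" "\<And>n. x n \<noteq> y n" and \<alpha>: "\<alpha> \<in> ball 0 1"
  shows "(\<lambda>n. (f n (y n) - f n (x n)) / (y n - x n)) \<longlonglongrightarrow> deriv g \<alpha>"
proof (rule tendstoI)
  fix e :: real assume e: "e > 0"
  obtain \<rho>0 where \<rho>0: "\<rho>0 > 0" "cball \<alpha> \<rho>0 \<subseteq> ball 0 1"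
    using exists_cball_in_disc \<alpha> by blast
  have "deriv g holomorphic_on ball 0 1"
    using g by (simp add: holomorphic_deriv)
  then have "isCont (deriv g) \<alpha>"
    using \<alpha> holomorphic_on_imp_continuous_on[of "deriv g" "ball 0 1"]
    by (simp add: continuous_on_eq_continuous_at)
  then obtain \<rho>1 where \<rho>1: "\<rho>1 > 0" "\<And>w. dist w \<alpha> < \<rho>1 \<Longrightarrow> dist (deriv g w) (deriv g \<alpha>) < e / 4"
    unfolding continuous_at_eps_delta using e by (metis zero_less_divide_iff zero_less_numeral)
  \<comment> \<open>Half of \<rho>0, so that a disc of radius \<rho> around any point of
    \<open>ball \<alpha> \<rho>\<close> stays where the convergence is uniform.\<close>
  define \<rho> where "\<rho> = min (\<rho>0 / 2) \<rho>1"
  have \<rho>: "\<rho> > 0" "\<rho> \<le> \<rho>1" "2 * \<rho> \<le> \<rho>0" using \<rho>0 \<rho>1 by (auto simp: \<rho>_def)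
  \<comment> \<open>Cauchy's inequality divides by \<rho>, which leaves e / 4; continuity of g' adds
    another e / 4.\<close>
  have "e * \<rho> / 4 > 0" using e \<rho> by simp
  then have "\<forall>\<^sub>F n in sequentially. \<forall>\<zeta>\<in>cball \<alpha> \<rho>0. dist (f n \<zeta>) (g \<zeta>) < e * \<rho> / 4"
    using ul[OF compact_cball \<rho>0(2)] unfolding uniform_limit_iff by blast
  moreover have "\<forall>\<^sub>F n in sequentially. dist (x n) \<alpha> < \<rho>" "\<forall>\<^sub>F n in sequentially. dist (y n) \<alpha> < \<rho>"
    using x \<rho>(1) tendstoD by blast+
  ultimately show "\<forall>\<^sub>F n in sequentially. dist ((f n (y n) - f n (x n)) / (y n - x n)) (deriv g \<alpha>) < e"
  proof eventually_elim
    case (elim n)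
    have sub: "cball w \<rho> \<subseteq> cball \<alpha> \<rho>0" if "w \<in> ball \<alpha> \<rho>" for w
    proof
      fix t assume "t \<in> cball w \<rho>"
      then show "t \<in> cball \<alpha> \<rho>0"
        using that \<rho>(3) dist_triangle[of \<alpha> t w] by auto
    qed
    let ?d = "\<lambda>\<zeta>. f n \<zeta> - g \<zeta>"
    have hd: "?d holomorphic_on ball 0 1" using f g by (intro holomorphic_intros)
    have w_in: "w \<in> ball 0 1" if "w \<in> ball \<alpha> \<rho>" for w
      using sub[OF that] \<rho>0(2) \<rho>(1) by force
    have d1: "cmod (deriv ?d w) \<le> e / 4" if w: "w \<in> ball \<alpha> \<rho>" for w
    proof -
      have c01: "cball w \<rho> \<subseteq> ball 0 1" using sub[OF w] \<rho>0(2) by auto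
      have "cmod ((deriv ^^ 1) ?d w) \<le> fact 1 * (e * \<rho> / 4) / \<rho> ^ 1"
      proof (rule Cauchy_inequality)
        show "?d holomorphic_on ball w \<rho>"
          using hd c01 ball_subset_cball by (meson holomorphic_on_subset order_trans)
        show "continuous_on (cball w \<rho>) ?d"
          using holomorphic_on_imp_continuous_on[OF holomorphic_on_subset[OF hd c01]] .
        fix t assume "cmod (w - t) = \<rho>"
        then have "t \<in> cball \<alpha> \<rho>0" using sub[OF w] by (auto simp: dist_norm)
        then show "cmod (?d t) \<le> e * \<rho> / 4"
          using elim(1) by (auto simp: dist_norm intro: less_imp_le)
      qed (use \<rho> in auto)
      then show ?thesis using \<rho>(1) by simp
    qed
    have "cmod ((f n (y n) - deriv g \<alpha> * y n) - (f n (x n) - deriv g \<alpha> * x n)) \<le> (e / 2) * cmod (y n - x n)"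
    proof (rule field_differentiable_bound[of "ball \<alpha> \<rho>" _ "\<lambda>w. deriv ?d w + (deriv g w - deriv g \<alpha>)"])
      fix w assume w: "w \<in> ball \<alpha> \<rho>"
      have "(?d has_field_derivative deriv ?d w) (at w)" "(g has_field_derivative deriv g w) (at w)"
        using holomorphic_derivI[OF hd open_ball w_in[OF w]] holomorphic_derivI[OF g open_ball w_in[OF w]] by auto
      then have "((\<lambda>w. ?d w + (g w - deriv g \<alpha> * w)) has_field_derivative
          deriv ?d w + (deriv g w - deriv g \<alpha> * 1)) (at w within ball \<alpha> \<rho>)"
        by (intro DERIV_add DERIV_diff DERIV_cmult DERIV_ident) (auto intro: has_field_derivative_at_within)
      then show "((\<lambda>w. f n w - deriv g \<alpha> * w) has_field_derivative
          deriv ?d w + (deriv g w - deriv g \<alpha>)) (at w within ball \<alpha> \<rho>)"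
        by (simp add: algebra_simps)
      have "cmod (deriv g w - deriv g \<alpha>) < e / 4"
        using \<rho>1(2)[of w] w \<rho>(2) by (simp add: dist_norm norm_minus_commute)
      then show "cmod (deriv ?d w + (deriv g w - deriv g \<alpha>)) \<le> e / 2"
        using d1[OF w] norm_triangle_ineq[of "deriv ?d w" "deriv g w - deriv g \<alpha>"] by linarith
    qed (use elim in \<open>auto simp: dist_commute\<close>)
    moreover have "(f n (y n) - deriv g \<alpha> * y n) - (f n (x n) - deriv g \<alpha> * x n)
        = ((f n (y n) - f n (x n)) / (y n - x n) - deriv g \<alpha>) * (y n - x n)"
      using x(3)[of n] by (simp add: field_simps)
    ultimately have "cmod ((f n (y n) - f n (x n)) / (y n - x n) - deriv g \<alpha>) \<le> e / 2"
      using x(3)[of n] by (simp add: norm_mult)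
    then show ?case using e by (simp add: dist_norm)
  qed
qed

lemma locally_tends_diffquot:
  assumes "locally_tends f \<phi>" "vholo \<phi> (ball 0 1)" "\<And>n. vholo (f n) (ball 0 1)"
    "x \<longlonglongrightarrow> \<alpha>" "y \<longlonglongrightarrow> \<alpha>" "\<And>n. x n \<noteq> y n" "\<alpha> \<in> ball 0 1"
  shows "(\<lambda>n. (1 / (y n - x n)) *s (f n (y n) - f n (x n))) \<longlonglongrightarrow> vderiv \<phi> \<alpha>"
proof (rule vec_tendstoI)
  fix i
  have "(\<lambda>n. (f n (y n) $ i - f n (x n) $ i) / (y n - x n)) \<longlonglongrightarrow> deriv (\<lambda>\<zeta>. \<phi> \<zeta> $ i) \<alpha>"
    by (rule diffquot_tendsto_deriv) (use assms in \<open>auto simp: vholo_def locally_tends_def\<close>)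
  then show "(\<lambda>n. ((1 / (y n - x n)) *s (f n (y n) - f n (x n))) $ i) \<longlonglongrightarrow> vderiv \<phi> \<alpha> $ i"
    by (simp add: vderiv_def diff_divide_distrib)
qed

text \<open>A supporting hyperplane at a boundary value of \<open>\<phi>\<close> would give a holomorphic function whose
  real part attains its maximum inside the disc.\<close>

lemma HolD_closure:
  fixes \<Omega> :: "(complex ^ 'n::finite) set"
  assumes \<Omega>: "open \<Omega>" "convex \<Omega>" and \<phi>: "vholo \<phi> (ball 0 1)" "\<phi> 0 \<in> \<Omega>"
    and cl: "\<And>\<zeta>. \<zeta> \<in> ball 0 1 \<Longrightarrow> \<phi> \<zeta> \<in> closure \<Omega>"
  shows "\<phi> \<in> HolD \<Omega>"
proof -
  have "\<phi> \<zeta>0 \<in> \<Omega>" if \<zeta>0: "\<zeta>0 \<in> ball 0 1" for \<zeta>0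
  proof (rule ccontr)
    assume "\<phi> \<zeta>0 \<notin> \<Omega>"
    then have "\<phi> \<zeta>0 \<notin> rel_interior \<Omega>" using rel_interior_subset by blast
    then obtain b where b: "\<And>y. y \<in> closure \<Omega> \<Longrightarrow> b \<bullet> \<phi> \<zeta>0 \<le> b \<bullet> y"
        "\<And>y. y \<in> rel_interior \<Omega> \<Longrightarrow> b \<bullet> \<phi> \<zeta>0 < b \<bullet> y"
      using supporting_hyperplane_relative_frontier[OF \<Omega>(2) cl[OF \<zeta>0]] by metis
    define G where "G \<zeta> = exp (- cdot (\<phi> \<zeta>) b)" for \<zeta>
    have norm_G: "cmod (G \<zeta>) = exp (- (b \<bullet> \<phi> \<zeta>))" for \<zeta>
      unfolding inner_commute[of b] by (simp add: G_def inner_eq_Re_cdot)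
    have "G constant_on ball 0 1"
    proof (rule maximum_modulus_principle[of _ _ "ball 0 1" \<zeta>0])
      show "G holomorphic_on ball 0 1"
        unfolding G_def by (intro holomorphic_intros vholo_cdot \<phi>)
      show "cmod (G \<zeta>) \<le> cmod (G \<zeta>0)" if "\<zeta> \<in> ball 0 1" for \<zeta>
        using b(1) cl that by (simp add: norm_G)
    qed (use \<zeta>0 in auto)
    then have "G 0 = G \<zeta>0"
      using \<zeta>0 unfolding constant_on_def by (metis centre_in_ball zero_less_one)
    then have "b \<bullet> \<phi> 0 = b \<bullet> \<phi> \<zeta>0"
      using norm_G[of 0] norm_G[of \<zeta>0] by simp
    moreover have "\<phi> 0 \<in> rel_interior \<Omega>"
      using \<phi>(2) \<Omega>(1) by (simp add: rel_interior_open)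
    ultimately show False using b(2) by fastforce
  qed
  then show ?thesis using \<phi> by (auto simp: HolD_iff)
qed

text \<open>Each building block \<open>k p\<close> is \<zeta> - p times the square of the Lagrange
  basis polynomial at p: it has derivative 1 at p and a double zero at every other node.\<close>

lemma hermite_interpolation:
  fixes u :: "complex \<Rightarrow> complex ^ 'n::finite"
  assumes X: "finite X"
  obtains h where "vholo h UNIV" "\<And>\<xi>. \<xi> \<in> X \<Longrightarrow> h \<xi> = 0 \<and> vderiv h \<xi> = u \<xi>"
proof -
  define k where "k p \<zeta> = (\<zeta> - p) * (\<Prod>q\<in>X - {p}. (\<zeta> - q) / (p - q))\<^sup>2" for p \<zeta>
  define h where "h \<zeta> = (\<Sum>p\<in>X. k p \<zeta> *s u p)" for \<zeta>
  have k0: "k p q = 0" if "q \<in> X" for p q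
    using X that by (cases "p = q") (auto simp: k_def intro!: prod_zero bexI[of _ q])
  have hol: "k p holomorphic_on UNIV" for p
    unfolding k_def[abs_def] using X by (cases "p \<in> X") (auto intro!: holomorphic_intros)
  have "(k p has_field_derivative (if p = \<xi> then 1 else 0)) (at \<xi>)" if "p \<in> X" "\<xi> \<in> X" for p \<xi>
  proof (cases "p = \<xi>")
    case True
    define m where "m \<zeta> = (\<Prod>q\<in>X - {p}. (\<zeta> - q) / (p - q))\<^sup>2" for \<zeta>
    have "m holomorphic_on UNIV"
      unfolding m_def[abs_def] by (auto intro!: holomorphic_intros)
    then have "(m has_field_derivative deriv m \<xi>) (at \<xi>)"
      using holomorphic_derivI by blast
    then have "((\<lambda>\<zeta>. (\<zeta> - p) * m \<zeta>) has_field_derivative m \<xi>) (at \<xi>)"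
      using True by (auto intro!: derivative_eq_intros)
    moreover have "m \<xi> = 1"
      unfolding m_def True by (subst prod.neutral) auto
    ultimately show ?thesis using True by (simp add: k_def[abs_def] m_def)
  next
    case False
    define m where "m \<zeta> = (\<zeta> - p) * ((\<Prod>q\<in>X - {p} - {\<xi>}. (\<zeta> - q) / (p - q)) / (p - \<xi>))\<^sup>2" for \<zeta>
    have "m holomorphic_on UNIV"
      unfolding m_def[abs_def] using False by (auto intro!: holomorphic_intros)
    then have "(m has_field_derivative deriv m \<xi>) (at \<xi>)"
      using holomorphic_derivI by blast
    then have "((\<lambda>\<zeta>. (\<zeta> - \<xi>)\<^sup>2 * m \<zeta>) has_field_derivative 0) (at \<xi>)"
      by (auto intro!: derivative_eq_intros)
    moreover have "k p \<zeta> = (\<zeta> - \<xi>)\<^sup>2 * m \<zeta>" for \<zeta>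
    proof -
      have "(\<Prod>q\<in>X - {p}. (\<zeta> - q) / (p - q)) = (\<zeta> - \<xi>) / (p - \<xi>) * (\<Prod>q\<in>X - {p} - {\<xi>}. (\<zeta> - q) / (p - q))"
        using X that False by (intro prod.remove) auto
      then show ?thesis by (simp add: k_def m_def power_mult_distrib power_divide)
    qed
    then have "k p = (\<lambda>\<zeta>. (\<zeta> - \<xi>)\<^sup>2 * m \<zeta>)" by blast
    ultimately show ?thesis using False by simp
  qed
  then have "((\<lambda>\<zeta>. h \<zeta> $ i) has_field_derivative (\<Sum>p\<in>X. (if p = \<xi> then 1 else 0) * u p $ i)) (at \<xi>)"
    if "\<xi> \<in> X" for \<xi> i
    unfolding h_def using that by (auto intro!: DERIV_sum DERIV_cmult_right simp del: mult_if_delta)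
  then have "vderiv h \<xi> = u \<xi>" if "\<xi> \<in> X" for \<xi>
    using that X by (auto simp: vderiv_def vec_eq_iff sum.delta if_distrib[of "\<lambda>t. t * _"] cong: if_cong
        dest!: DERIV_imp_deriv)
  moreover have "vholo h UNIV"
    unfolding vholo_def h_def using hol by (auto intro!: holomorphic_intros)
  moreover have "h \<xi> = 0" if "\<xi> \<in> X" for \<xi>
    using k0[OF that] by (simp add: h_def)
  ultimately show thesis using that by blast
qed

lemma vderiv_add:
  assumes "vholo f U" "vholo g U" "open U" "\<alpha> \<in> U"
  shows "vderiv (\<lambda>\<zeta>. f \<zeta> + c *s g \<zeta>) \<alpha> = vderiv f \<alpha> + c *s vderiv g \<alpha>"
proof (rule vderiv_unique[OF _ assms(3,4)])
  show "vholo (\<lambda>\<zeta>. f \<zeta> + c *s g \<zeta>) U"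
    using assms by (intro vholo_add vholo_smult) auto
  have "((\<lambda>h. (1 / h) *s (f (\<alpha> + h) - f \<alpha>) + c *s ((1 / h) *s (g (\<alpha> + h) - g \<alpha>))) \<longlongrightarrow>
      vderiv f \<alpha> + c *s vderiv g \<alpha>) (at 0)"
    by (intro tendsto_intros vholo_diffquot[of _ U] assms)
  then show "((\<lambda>h. (1 / h) *s (f (\<alpha> + h) + c *s g (\<alpha> + h) - (f \<alpha> + c *s g \<alpha>))) \<longlongrightarrow>
      vderiv f \<alpha> + c *s vderiv g \<alpha>) (at 0)"
    by (simp add: vec_eq_iff algebra_simps)
qed

text \<open>The dilated disc has a margin \<delta> inside \<Omega>, and a Hermite polynomial scaled
  to norm at most \<delta> / 2 fits into it. The size of \<eta> is irrelevant later; only \<eta>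
  being nonzero and the direction u matter for transversality.\<close>

lemma HolD_perturb_derivative:
  fixes \<phi> :: "complex \<Rightarrow> complex ^ 'n::finite"
  assumes \<Omega>: "open \<Omega>" and \<phi>: "\<phi> \<in> HolD \<Omega>" and r: "0 < r" "r < 1"
    and X: "finite X" "\<And>\<xi>. \<xi> \<in> X \<Longrightarrow> cmod \<xi> < r"
  obtains \<psi> \<eta> where "\<psi> \<in> HolD \<Omega>" "\<eta> \<noteq> 0" "\<And>\<xi>. \<xi> \<in> X \<Longrightarrow> \<psi> (\<xi> / of_real r) = \<phi> \<xi>"
    "\<And>\<xi>. \<xi> \<in> X \<Longrightarrow> vderiv \<psi> (\<xi> / of_real r) = of_real r *s vderiv \<phi> \<xi> + \<eta> *s u \<xi>"
proof -
  obtain h where h: "vholo h UNIV" "\<And>\<xi>. \<xi> \<in> (\<lambda>\<xi>. \<xi> / of_real r) ` X \<Longrightarrow> h \<xi> = 0 \<and> vderiv h \<xi> = u (of_real r * \<xi>)"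
    using hermite_interpolation[of "(\<lambda>\<xi>. \<xi> / of_real r) ` X" "\<lambda>\<xi>. u (of_real r * \<xi>)"] X(1) by blast
  have "compact (h ` cball 0 1)"
    using continuous_on_subset[OF vholo_continuous[OF h(1)]] by (intro compact_continuous_image) auto
  then obtain B where B: "B > 0" "\<And>\<zeta>. \<zeta> \<in> cball 0 1 \<Longrightarrow> norm (h \<zeta>) \<le> B"
    using compact_imp_bounded bounded_pos by (metis imageI)
  obtain K where K: "compact K" "K \<subseteq> \<Omega>" "\<And>\<zeta>. \<zeta> \<in> ball 0 1 \<Longrightarrow> \<phi> (of_real r * \<zeta>) \<in> K"
    using HolD_dilation_compact[OF \<phi>, of r] r by auto
  obtain \<delta> where \<delta>: "\<delta> > 0" "(\<Union>x\<in>K. ball x \<delta>) \<subseteq> \<Omega>"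
    using compact_subset_open_imp_ball_epsilon_subset K \<Omega> by metis
  define \<eta> where "\<eta> = complex_of_real (\<delta> / (2 * B))"
  define \<psi> where "\<psi> \<zeta> = \<phi> (of_real r * \<zeta>) + \<eta> *s h \<zeta>" for \<zeta>
  have \<psi>: "\<psi> \<zeta> \<in> \<Omega>" if \<zeta>: "\<zeta> \<in> ball 0 1" for \<zeta>
  proof -
    have "norm (\<eta> *s h \<zeta>) \<le> \<delta> / (2 * B) * B"
      unfolding norm_vector_smult using B \<delta>(1) \<zeta> by (intro mult_mono) (auto simp: \<eta>_def norm_divide norm_mult)
    also have "\<dots> < \<delta>" using B(1) \<delta>(1) by simp
    finally have "\<psi> \<zeta> \<in> ball (\<phi> (of_real r * \<zeta>)) \<delta>"
      by (simp only: mem_ball dist_norm \<psi>_def norm_minus_cancel[symmetric, of "\<eta> *s h \<zeta>"]) simp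
    then show ?thesis using \<delta>(2) K(3)[OF \<zeta>] by blast
  qed
  have hol: "vholo (\<lambda>\<zeta>. \<phi> (of_real r * \<zeta>)) (ball 0 1)" "vholo h (ball 0 1)"
    using vholo_dilation[OF \<phi>, of r] r vholo_subset[OF h(1)] by auto
  show thesis
  proof (rule that[of \<psi> \<eta>])
    show "\<psi> \<in> HolD \<Omega>"
      using \<psi> unfolding HolD_iff \<psi>_def
      by (auto intro!: vholo_add vholo_smult holomorphic_intros hol)
    show "\<eta> \<noteq> 0" using \<delta>(1) B(1) by (simp add: \<eta>_def)
    fix \<xi> assume \<xi>: "\<xi> \<in> X"
    show "\<psi> (\<xi> / of_real r) = \<phi> \<xi>"
      using h(2) \<xi> r by (simp add: \<psi>_def)
    have in1: "\<xi> / of_real r \<in> ball 0 1" using X(2)[OF \<xi>] r by (simp add: norm_divide)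
    have "vderiv \<psi> (\<xi> / of_real r) =
        vderiv (\<lambda>\<zeta>. \<phi> (of_real r * \<zeta>)) (\<xi> / of_real r) + \<eta> *s vderiv h (\<xi> / of_real r)"
      unfolding \<psi>_def by (rule vderiv_add[OF hol open_ball in1])
    also have "\<dots> = of_real r *s vderiv \<phi> \<xi> + \<eta> *s u \<xi>"
      using vderiv_dilation[OF \<phi> r in1] h(2) \<xi> r(1) by simp
    finally show "vderiv \<psi> (\<xi> / of_real r) = of_real r *s vderiv \<phi> \<xi> + \<eta> *s u \<xi>" .
  qed
qed

section \<open>The limit system of poles\<close>

locale pole_system =
  fixes \<Omega> :: "(complex ^ 'n::finite) set" and M N :: nat and a0 v :: "nat \<Rightarrow> complex ^ 'n"
  assumes open_dom: "open \<Omega>" and convex_dom: "convex \<Omega>" and bounded_dom: "bounded \<Omega>"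
    and MN: "M \<le> N" and a0_in: "a0 ` {1..N} \<subseteq> \<Omega>" and a0_inj: "inj_on a0 {1..N}"
    and v_norm: "\<And>j. j \<in> {M<..N} \<Longrightarrow> norm (v j) = 1"
begin

definition Psi :: "nat \<Rightarrow> complex ^ 'n \<Rightarrow> ereal" where
  "Psi j = (if j \<le> M then Psi_pt else Psi_dir (v j))"

definition mass :: "nat \<Rightarrow> ereal" where
  "mass j = (if j \<le> M then 1 else 2)"

text \<open>The label \<open>(j, False)\<close> names a_j or a'_j, and \<open>(j, True)\<close>
  names a''_j, so that double poles have two labels. One index set for all moving points makes
  distinctness a matter of injectivity.\<close>

definition labels :: "(nat \<times> bool) set" where
  "labels = {1..N} \<times> {False} \<union> {M<..N} \<times> {True}"

abbreviation weight :: "(complex \<Rightarrow> complex ^ 'n) \<Rightarrow> nat \<Rightarrow> complex \<Rightarrow> ereal" where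
  "weight \<phi> j \<alpha> \<equiv> Defs.mult \<phi> (a0 j) (Psi j) (mass j) \<alpha>"

abbreviation limit_lempert :: "complex ^ 'n \<Rightarrow> ereal" where
  "limit_lempert z \<equiv> gen_lempert \<Omega> {1..N} a0 Psi mass z"

lemma finite_labels: "finite labels"
  by (simp add: labels_def)

lemma fst_labels: "l \<in> labels \<Longrightarrow> fst l \<in> {1..N}"
  by (auto simp: labels_def)

section \<open>Multiplicities of discs over the limit poles\<close>

context
  fixes \<phi> j \<alpha>
  assumes \<phi>: "\<phi> \<in> HolD \<Omega>" and j: "j \<in> {1..N}" and \<alpha>: "\<alpha> \<in> ball 0 1" "\<phi> \<alpha> = a0 j"
begin

lemma weight_pt: "j \<le> M \<Longrightarrow> weight \<phi> j \<alpha> = 1"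
  using \<phi> \<alpha> by (auto simp: Psi_def mass_def HolD_iff intro!: mult_pt[of _ "ball 0 1"])

lemma weight_ge_1: "1 \<le> weight \<phi> j \<alpha>"
  using \<phi> \<alpha> j weight_pt v_norm[of j] mult_dir_ge1[of \<phi> "ball 0 1" \<alpha> "a0 j" "v j"]
  by (cases "j \<le> M") (auto simp: Psi_def mass_def HolD_iff)

lemma weight_le_mass: "weight \<phi> j \<alpha> \<le> mass j"
  by (rule mult_le_mass) (simp add: mass_def)

lemma weight_real: "ereal (real_of_ereal (weight \<phi> j \<alpha>)) = weight \<phi> j \<alpha>"
proof -
  have "weight \<phi> j \<alpha> \<le> 2"
    using weight_le_mass by (rule order_trans) (simp add: mass_def)
  then have "weight \<phi> j \<alpha> \<noteq> \<infinity>" "weight \<phi> j \<alpha> \<noteq> -\<infinity>"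
    using weight_ge_1 by auto
  then show ?thesis by (intro ereal_real') auto
qed

lemma weight_real_bounds:
  "1 \<le> real_of_ereal (weight \<phi> j \<alpha>)" "real_of_ereal (weight \<phi> j \<alpha>) \<le> (if j \<le> M then 1 else 2)"
proof -
  have "ereal 1 \<le> ereal (real_of_ereal (weight \<phi> j \<alpha>))"
    unfolding weight_real using weight_ge_1 by (simp add: one_ereal_def)
  then show "1 \<le> real_of_ereal (weight \<phi> j \<alpha>)" by simp
  have "ereal (real_of_ereal (weight \<phi> j \<alpha>)) \<le> ereal (if j \<le> M then 1 else 2)"
    unfolding weight_real using weight_le_mass by (auto simp: mass_def one_ereal_def)
  then show "real_of_ereal (weight \<phi> j \<alpha>) \<le> (if j \<le> M then 1 else 2)" by simp
qed

lemma weight_tangent: "M < j \<Longrightarrow> cproj (v j) (vderiv \<phi> \<alpha>) = 0 \<Longrightarrow> weight \<phi> j \<alpha> = 2"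
  using \<phi> \<alpha> j v_norm[of j] mult_dir_eq2[of \<phi> "ball 0 1" \<alpha> "a0 j" "v j"]
  by (auto simp: Psi_def mass_def HolD_iff)

lemma weight_transversal: "M < j \<Longrightarrow> cproj (v j) (vderiv \<phi> \<alpha>) \<noteq> 0 \<Longrightarrow> weight \<phi> j \<alpha> = 1"
  using \<phi> \<alpha> j v_norm[of j] mult_dir_eq1[of \<phi> "ball 0 1" \<alpha> "a0 j" "v j"]
  by (auto simp: Psi_def mass_def HolD_iff)

end

text \<open>The constant disc with the single node 0 is admissible, and its multiplicity is at least
  1 in front of log 0 = -\<infinity>.\<close>

lemma limit_lempert_pole:
  assumes "z \<in> a0 ` {1..N}"
  shows "limit_lempert z = -\<infinity>"
proof -
  obtain i where i: "i \<in> {1..N}" "z = a0 i" using assms by blast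
  define A :: "nat \<Rightarrow> complex set" where "A j = (if j = i then {0} else {})" for j
  have hol: "(\<lambda>_. z) \<in> HolD \<Omega>"
    using i a0_in by (auto simp: HolD_iff intro!: vholo_const)
  have w: "1 \<le> weight (\<lambda>_. z) i 0" "weight (\<lambda>_. z) i 0 \<le> mass i"
    using weight_ge_1[OF hol i(1)] weight_le_mass[OF hol i(1)] i(2) by auto
  have "limit_lempert z \<le> (\<Sum>j\<in>{1..N}. \<Sum>\<alpha>\<in>A j. weight (\<lambda>_. z) j \<alpha> * elog (cmod \<alpha>))"
    unfolding gen_lempert_def using w i hol
    by (intro Inf_lower CollectI exI[of _ "\<lambda>_. z"] exI[of _ A]) (auto simp: A_def mass_def)
  also have "\<dots> = (\<Sum>j\<in>{1..N}. if j = i then weight (\<lambda>_. z) i 0 * elog 0 else 0)"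
    by (intro sum.cong) (auto simp: A_def)
  also have "\<dots> = weight (\<lambda>_. z) i 0 * elog 0"
    using i(1) by simp
  also have "\<dots> = -\<infinity>"
    using w(1) by (cases "weight (\<lambda>_. z) i 0") (auto simp: elog_0)
  finally show ?thesis by simp
qed

text \<open>It suffices to hit one point close to z. The affine disc of radius x, the square root of
  the distance from z to that point, reaches it at the node x; so the disc shrinks into \<Omega>
  while its node still tends to 0.\<close>

lemma coman_lempert_pole:
  assumes z: "z \<in> a0 ` {1..N}"
    and q: "\<And>l. l \<in> labels \<Longrightarrow> ((\<lambda>\<epsilon>. q \<epsilon> l) \<longlongrightarrow> a0 (fst l)) F"
    and ins: "\<forall>\<^sub>F \<epsilon> in F. q \<epsilon> ` labels \<subseteq> \<Omega>"
  shows "\<forall>\<^sub>F \<epsilon> in F. coman_lempert \<Omega> (q \<epsilon> ` labels) z < ereal C"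
proof -
  obtain i where i: "i \<in> {1..N}" "z = a0 i" using z by blast
  have "z \<in> \<Omega>" using z a0_in by blast
  then obtain \<delta> where \<delta>: "\<delta> > 0" "ball z \<delta> \<subseteq> \<Omega>"
    using open_dom open_contains_ball by blast
  let ?l = "(i, False)"
  have l: "?l \<in> labels" using i by (auto simp: labels_def)
  define x where "x \<epsilon> = sqrt (norm (q \<epsilon> ?l - z))" for \<epsilon>
  have "((\<lambda>\<epsilon>. sqrt (norm (q \<epsilon> ?l - z))) \<longlongrightarrow> sqrt (norm (z - z))) F"
    using q[OF l] i by (intro tendsto_intros) auto
  then have x: "(x \<longlongrightarrow> 0) F" by (simp add: x_def[abs_def])
  have "\<forall>\<^sub>F \<epsilon> in F. x \<epsilon> < min (min 1 \<delta>) (exp (C - 1))"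
    by (rule order_tendstoD(2)[OF x]) (use \<delta> in auto)
  with ins show ?thesis
  proof eventually_elim
    case (elim \<epsilon>)
    have x0: "x \<epsilon> \<ge> 0" by (simp add: x_def)
    define f where "f \<zeta> = z + (\<zeta> / of_real (x \<epsilon>)) *s (q \<epsilon> ?l - z)" for \<zeta>
    have "f \<zeta> \<in> \<Omega>" if "\<zeta> \<in> ball 0 1" for \<zeta>
    proof -
      have "norm (f \<zeta> - z) = cmod \<zeta> * (norm (q \<epsilon> ?l - z) / x \<epsilon>)"
        using x0 by (simp add: f_def norm_vector_smult norm_divide del: vector_ssub_ldistrib)
      also have "norm (q \<epsilon> ?l - z) / x \<epsilon> = x \<epsilon>"
        by (simp add: x_def real_div_sqrt)
      also have "cmod \<zeta> * x \<epsilon> \<le> 1 * x \<epsilon>"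
        using that x0 by (intro mult_right_mono) auto
      finally have "norm (f \<zeta> - z) < \<delta>" using elim(2) by simp
      then show ?thesis using \<delta>(2) by (auto simp: dist_norm norm_minus_commute)
    qed
    moreover have "vholo f (ball 0 1)"
    proof (cases "x \<epsilon> = 0")
      case True
      then show ?thesis by (simp add: f_def[abs_def] vholo_const)
    next
      case False
      then show ?thesis unfolding f_def[abs_def]
        by (intro vholo_add vholo_smult vholo_const holomorphic_intros) auto
    qed
    ultimately have f: "f \<in> HolD \<Omega>" by (auto simp: HolD_iff)
    have "f (of_real (x \<epsilon>)) = q \<epsilon> ?l"
      by (cases "x \<epsilon> = 0") (auto simp: f_def x_def)
    then have "coman_lempert \<Omega> (q \<epsilon> ` labels) z \<le> (\<Sum>l\<in>{?l}. elog (cmod (of_real (x \<epsilon>))))"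
      using elim l x0 finite_labels
      by (intro coman_lempert_le[OF open_dom convex_dom, where q = "q \<epsilon>" and \<phi> = f] f) (auto simp: f_def)
    also have "\<dots> \<le> ereal (C - 1)"
      using x0 elim(2) by (auto intro!: elog_le)
    also have "\<dots> < ereal C" by simp
    finally show ?case .
  qed
qed

text \<open>The work lies in giving each node of a nearly optimal disc its own moving points. Two
  nodes over a double pole have multiplicity 1 each and share the two labels; a node of larger
  multiplicity is alone over its pole and takes both.\<close>

lemma coman_lempert_upper:
  assumes z: "z \<notin> a0 ` {1..N}"
    and q: "\<And>l. l \<in> labels \<Longrightarrow> ((\<lambda>\<epsilon>. q \<epsilon> l) \<longlongrightarrow> a0 (fst l)) F"
    and ins: "\<forall>\<^sub>F \<epsilon> in F. inj_on (q \<epsilon>) labels \<and> q \<epsilon> ` labels \<subseteq> \<Omega>"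
    and dir: "\<And>j. j \<in> {M<..N} \<Longrightarrow> ((\<lambda>\<epsilon>. proj_dist (q \<epsilon> (j, True) - q \<epsilon> (j, False)) (v j)) \<longlongrightarrow> 0) F"
    and less: "limit_lempert z < ereal C"
  shows "\<forall>\<^sub>F \<epsilon> in F. coman_lempert \<Omega> (q \<epsilon> ` labels) z < ereal C"
proof -
  obtain \<phi> A where \<phi>: "\<phi> \<in> HolD \<Omega>" "\<phi> 0 = z"
    and A': "\<forall>k\<in>{1..N}. finite (A k) \<and> A k \<subseteq> ball 0 1 \<and> A k \<subseteq> \<phi> -` {a0 k} \<and>
        (\<Sum>\<alpha>\<in>A k. weight \<phi> k \<alpha>) \<le> mass k"
    and val: "(\<Sum>k\<in>{1..N}. \<Sum>\<alpha>\<in>A k. weight \<phi> k \<alpha> * elog (cmod \<alpha>)) < ereal C"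
    using less unfolding gen_lempert_def Inf_less_iff by blast
  have A: "finite (A j)" "\<And>\<alpha>. \<alpha> \<in> A j \<Longrightarrow> \<alpha> \<in> ball 0 1" "\<And>\<alpha>. \<alpha> \<in> A j \<Longrightarrow> \<phi> \<alpha> = a0 j" if "j \<in> {1..N}" for j
    using A' that by blast+
  define m where "m j \<alpha> = real_of_ereal (weight \<phi> j \<alpha>)" for j \<alpha>
  have m: "weight \<phi> j \<alpha> = ereal (m j \<alpha>)" "1 \<le> m j \<alpha>" "m j \<alpha> \<le> (if j \<le> M then 1 else 2)"
    if "j \<in> {1..N}" "\<alpha> \<in> A j" for j \<alpha>
    using weight_real[OF \<phi>(1) that(1)] weight_real_bounds[OF \<phi>(1) that(1)] A[OF that(1)] that(2)
    unfolding m_def by auto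
  have msum: "(\<Sum>\<alpha>\<in>A j. m j \<alpha>) \<le> (if j \<le> M then 1 else 2)" if j: "j \<in> {1..N}" for j
  proof -
    have "ereal (\<Sum>\<alpha>\<in>A j. m j \<alpha>) = (\<Sum>\<alpha>\<in>A j. weight \<phi> j \<alpha>)"
      using m(1)[OF j] by simp
    also have "\<dots> \<le> mass j" using A' j by blast
    finally show ?thesis by (auto simp: mass_def one_ereal_def split: if_splits)
  qed
  have nz: "\<alpha> \<noteq> 0" if "j \<in> {1..N}" "\<alpha> \<in> A j" for j \<alpha>
    using A(3)[OF that] z that(1) \<phi>(2) by auto
  have card: "real (card (A j)) \<le> (if j \<le> M then 1 else 2)" if j: "j \<in> {1..N}" for j
  proof -
    have "real (card (A j)) = (\<Sum>\<alpha>\<in>A j. 1)" by simp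
    also have "\<dots> \<le> (\<Sum>\<alpha>\<in>A j. m j \<alpha>)" using m(2)[OF j] by (rule sum_mono)
    finally show ?thesis using msum[OF j] by linarith
  qed
  have two: "m j \<alpha> + m j \<beta> \<le> (if j \<le> M then 1 else 2)" if "j \<in> {1..N}" "\<alpha> \<in> A j" "\<beta> \<in> A j" "\<alpha> \<noteq> \<beta>" for j \<alpha> \<beta>
  proof -
    have "(\<Sum>\<alpha>\<in>{\<alpha>, \<beta>}. m j \<alpha>) \<le> (\<Sum>\<alpha>\<in>A j. m j \<alpha>)"
      using that A(1) m(2) by (intro sum_mono2) (auto intro: order_trans[OF zero_le_one])
    then show ?thesis using msum[OF that(1)] that(4) by simp
  qed
  \<comment> \<open>The flag g is True only at the second of two nodes over one pole, which will
    follow a''_j. The mass bound forces both multiplicities to be 1 in that case.\<close>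
  have "\<exists>g. inj_on g (A j) \<and> (\<forall>\<alpha>\<in>A j. g \<alpha> \<longrightarrow> M < j \<and> (\<forall>\<beta>\<in>A j. m j \<beta> \<le> 1))" if j: "j \<in> {1..N}" for j
  proof (cases "\<exists>\<alpha>\<in>A j. \<exists>\<beta>\<in>A j. \<alpha> \<noteq> \<beta>")
    case True
    then obtain \<alpha> \<beta> where ab: "\<alpha> \<in> A j" "\<beta> \<in> A j" "\<alpha> \<noteq> \<beta>" by blast
    have "M < j" using two[OF j ab] m(2)[OF j ab(1)] m(2)[OF j ab(2)] by (auto split: if_splits)
    moreover have "card (A j) \<le> 2" using card[OF j] by (auto split: if_splits)
    then have "A j = {\<alpha>, \<beta>}"
      using ab A(1)[OF j] by (intro card_seteq[symmetric]) auto
    ultimately show ?thesis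
      using two[OF j ab] m(2)[OF j ab(1)] m(2)[OF j ab(2)] ab
      by (intro exI[of _ "\<lambda>x. x = \<beta>"]) (auto simp: inj_on_def)
  next
    case False
    then show ?thesis by (intro exI[of _ "\<lambda>_. False"]) (auto simp: inj_on_def)
  qed
  then obtain g where g: "\<And>j. j \<in> {1..N} \<Longrightarrow> inj_on (g j) (A j)"
      "\<And>j \<alpha> \<beta>. j \<in> {1..N} \<Longrightarrow> \<alpha> \<in> A j \<Longrightarrow> g j \<alpha> \<Longrightarrow> M < j \<and> (\<beta> \<in> A j \<longrightarrow> m j \<beta> \<le> 1)"
    by metis
  define K where "K = (\<Union>j\<in>{1..N}. A j)"
  define jj where "jj \<alpha> = inv_into {1..N} a0 (\<phi> \<alpha>)" for \<alpha>
  have jj: "jj \<alpha> = j" if "j \<in> {1..N}" "\<alpha> \<in> A j" for j \<alpha>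
    using that A(3) a0_inj by (simp add: jj_def)
  have K: "jj \<alpha> \<in> {1..N}" "\<alpha> \<in> A (jj \<alpha>)" if "\<alpha> \<in> K" for \<alpha>
    using that jj by (auto simp: K_def)
  \<comment> \<open>Multiplicity above 1 excludes a transversal derivative, so these nodes can be
    split. A second node over the same pole would push the total above 2.\<close>
  define D where "D = {\<alpha> \<in> K. 1 < m (jj \<alpha>) \<alpha>}"
  have D: "\<alpha> \<in> K" "M < jj \<alpha>" "jj \<alpha> \<in> {M<..N}" if "\<alpha> \<in> D" for \<alpha>
    using that m(3)[OF K(1,2)] K(1) by (fastforce simp: D_def split: if_splits)+
  have Dg: "\<not> g (jj \<alpha>) \<beta>" if "\<alpha> \<in> D" "\<beta> \<in> A (jj \<alpha>)" for \<alpha> \<beta>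
    using g(2)[OF K(1), of \<alpha> \<beta> \<alpha>] that K(2)[of \<alpha>] by (force simp: D_def)
  define lb where "lb k = (if snd k then (jj (fst k), True) else (jj (fst k), g (jj (fst k)) (fst k)))" for k
  define Lab where "Lab = K \<times> {False} \<union> D \<times> {True}"
  have lb_in: "lb ` Lab \<subseteq> labels"
    using K(1) D(3) g(2)[OF K(1) K(2)] by (force simp: lb_def Lab_def labels_def)
  have lb_inj: "inj_on lb Lab"
  proof (rule inj_onI)
    fix k l assume kl: "k \<in> Lab" "l \<in> Lab" and eq: "lb k = lb l"
    have inK: "fst k \<in> K" "fst l \<in> K" using kl D(1) by (auto simp: Lab_def)
    have j: "jj (fst k) = jj (fst l)" using eq by (auto simp: lb_def split: if_splits)
    have D_unique: "\<alpha> = \<beta>" if "\<alpha> \<in> D" "\<beta> \<in> K" "jj \<alpha> = jj \<beta>" for \<alpha> \<beta>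
    proof (rule ccontr)
      assume "\<alpha> \<noteq> \<beta>"
      then have "m (jj \<alpha>) \<alpha> + m (jj \<alpha>) \<beta> \<le> 2"
        using two[of "jj \<alpha>" \<alpha> \<beta>] K[of \<alpha>] K[of \<beta>] D[of \<alpha>] that by (auto split: if_splits)
      then show False
        using that m(2)[of "jj \<alpha>" \<beta>] K[of \<beta>] by (auto simp: D_def)
    qed
    have nn: "\<not> (snd k \<and> \<not> snd l)" "\<not> (snd l \<and> \<not> snd k)"
      using eq kl Dg[of "fst k" "fst l"] Dg[of "fst l" "fst k"] j K(2)[OF inK(1)] K(2)[OF inK(2)]
      by (auto simp: lb_def Lab_def)
    show "k = l"
    proof (cases "snd k")
      case True
      then have "fst k \<in> D" "snd l" using kl nn by (auto simp: Lab_def)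
      then show ?thesis using D_unique inK j True by (simp add: prod_eq_iff)
    next
      case False
      then have "g (jj (fst k)) (fst k) = g (jj (fst k)) (fst l)" "\<not> snd l"
        using eq j nn by (auto simp: lb_def)
      then have "fst k = fst l"
        using inj_onD[OF g(1)[OF K(1)[OF inK(1)]]] K(2)[OF inK(1)] K(2)[OF inK(2)] j by simp
      then show ?thesis using False \<open>\<not> snd l\<close> by (simp add: prod_eq_iff)
    qed
  qed
  have finK: "finite K" using A(1) by (auto simp: K_def)
  have lim: "((\<lambda>\<epsilon>. q \<epsilon> (lb (k, b))) \<longlongrightarrow> \<phi> k) F" if "(k, b) \<in> Lab" for k b
  proof -
    have "k \<in> K" using that D(1) by (auto simp: Lab_def)
    then have "\<phi> k = a0 (fst (lb (k, b)))"
      using A(3) K by (simp add: lb_def)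
    then show ?thesis using q[of "lb (k, b)"] lb_in that by force
  qed
  show ?thesis
  proof (rule coman_lempert_eventually_less[OF open_dom convex_dom \<phi>(1,2) finK, where \<xi> = "\<lambda>k. k" and D = D
        and p = "\<lambda>k \<epsilon>. q \<epsilon> (lb (k, False))" and p' = "\<lambda>k \<epsilon>. q \<epsilon> (lb (k, True))"
        and v = "\<lambda>k. v (jj k)" and q = "\<lambda>\<epsilon> k. q \<epsilon> (lb k)" and Lab = Lab])
    show "k \<in> ball 0 1 \<and> k \<noteq> 0" if "k \<in> K" for k
      using A(2) nz K[OF that] by blast
    show "\<forall>\<^sub>F \<epsilon> in F. finite (q \<epsilon> ` labels) \<and> q \<epsilon> ` labels \<subseteq> \<Omega>"
      using ins by eventually_elim (simp add: finite_labels)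
    show "cproj (v (jj k)) (vderiv \<phi> k) = 0" if "k \<in> D" for k
    proof (rule ccontr)
      assume "cproj (v (jj k)) (vderiv \<phi> k) \<noteq> 0"
      then have "weight \<phi> (jj k) k = 1"
        using weight_transversal[OF \<phi>(1) K(1) A(2) A(3)] K D[OF that] by blast
      then have "m (jj k) k = 1" by (simp add: m_def)
      then show False using that by (simp add: D_def)
    qed
    show "((\<lambda>\<epsilon>. proj_dist (q \<epsilon> (lb (k, True)) - q \<epsilon> (lb (k, False))) (v (jj k))) \<longlongrightarrow> 0) F" if "k \<in> D" for k
      using dir[OF D(3)[OF that]] Dg[OF that] K(2)[OF D(1)[OF that]] by (simp add: lb_def)
    show "\<forall>\<^sub>F \<epsilon> in F. inj_on (\<lambda>k. q \<epsilon> (lb k)) Lab \<and> (\<lambda>k. q \<epsilon> (lb k)) ` Lab \<subseteq> q \<epsilon> ` labels"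
      using ins
    proof eventually_elim
      case (elim \<epsilon>)
      then have "inj_on (q \<epsilon> \<circ> lb) Lab"
        using lb_inj lb_in by (intro comp_inj_on) (auto intro: inj_on_subset)
      then show ?case using lb_in by (auto simp: o_def)
    qed
    show "(\<Sum>k\<in>K. ln (cmod k)) + (\<Sum>k\<in>D. ln (cmod k)) < C"
    proof -
      let ?c = "\<lambda>\<alpha>. if \<alpha> \<in> D then 2 else (1::real)"
      have "(\<Sum>k\<in>D. ln (cmod k)) = (\<Sum>k\<in>K. if k \<in> D then ln (cmod k) else 0)"
        using finK D(1) by (intro sum.mono_neutral_cong_left) auto
      then have "(\<Sum>k\<in>K. ln (cmod k)) + (\<Sum>k\<in>D. ln (cmod k)) = (\<Sum>k\<in>K. ?c k * ln (cmod k))"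
        by (auto simp: sum.distrib[symmetric] intro!: sum.cong)
      also have "\<dots> = (\<Sum>j\<in>{1..N}. \<Sum>\<alpha>\<in>A j. ?c \<alpha> * ln (cmod \<alpha>))"
        unfolding K_def
      proof (rule sum.UNION_disjoint)
        show "\<forall>i\<in>{1..N}. \<forall>j\<in>{1..N}. i \<noteq> j \<longrightarrow> A i \<inter> A j = {}"
          using jj by blast
      qed (use A(1) in auto)
      \<comment> \<open>Replacing multiplicities by the larger values 1 or 2 lowers the sum, since
        logarithms of nodes are not positive.\<close>
      also have "\<dots> \<le> (\<Sum>j\<in>{1..N}. \<Sum>\<alpha>\<in>A j. m j \<alpha> * ln (cmod \<alpha>))"
      proof (intro sum_mono mult_right_mono_neg)
        fix j \<alpha> assume j: "j \<in> {1..N}" and \<alpha>: "\<alpha> \<in> A j"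
        then have "\<alpha> \<in> K" by (auto simp: K_def)
        then show "m j \<alpha> \<le> ?c \<alpha>"
          using m(3)[OF j \<alpha>] jj[OF j \<alpha>] by (auto simp: D_def split: if_splits)
        show "ln (cmod \<alpha>) \<le> 0"
          using A(2)[OF j \<alpha>] nz[OF j \<alpha>] by simp
      qed
      also have "\<dots> < C"
      proof -
        have "(\<Sum>j\<in>{1..N}. \<Sum>\<alpha>\<in>A j. weight \<phi> j \<alpha> * elog (cmod \<alpha>)) =
            (\<Sum>j\<in>{1..N}. \<Sum>\<alpha>\<in>A j. ereal (m j \<alpha> * ln (cmod \<alpha>)))"
          using m(1) nz by (intro sum.cong refl) (simp add: elog_pos)
        then show ?thesis using val by simp
      qed
      finally show ?thesis .
    qed
    show "((\<lambda>\<epsilon>. q \<epsilon> (lb (k, False))) \<longlongrightarrow> \<phi> k) F" if "k \<in> K" for k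
      using that by (intro lim) (simp add: Lab_def)
    show "((\<lambda>\<epsilon>. q \<epsilon> (lb (k, True))) \<longlongrightarrow> \<phi> k) F" if "k \<in> D" for k
      using that by (intro lim) (simp add: Lab_def)
    show "norm (v (jj k)) = 1" if "k \<in> D" for k
      using D(3)[OF that] by (rule v_norm)
    show "D \<subseteq> K" using D(1) by blast
    show "Lab = K \<times> {False} \<union> D \<times> {True}" by (rule Lab_def)
  qed simp_all
qed

text \<open>Builds admissible pairs from a limit disc and its limit nodes; those on the circle are
  dropped at no cost. The difficulty is the mass bound: two separate nodes over a double pole fit
  only if both have multiplicity 1. A single node always fits, and a multiplicity above 1 only
  improves its contribution.\<close>

lemma limit_lempert_le:
  assumes \<phi>: "\<phi> \<in> HolD \<Omega>" "\<phi> 0 = z" and z: "z \<notin> a0 ` {1..N}"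
    and \<xi>: "\<And>l. l \<in> labels \<Longrightarrow> cmod (\<xi> l) \<le> 1" "\<And>l. l \<in> labels \<Longrightarrow> cmod (\<xi> l) < 1 \<Longrightarrow> \<phi> (\<xi> l) = a0 (fst l)"
    and collide: "\<And>j. j \<in> {M<..N} \<Longrightarrow> \<xi> (j, True) = \<xi> (j, False) \<Longrightarrow> cmod (\<xi> (j, False)) < 1 \<Longrightarrow>
        cproj (v j) (vderiv \<phi> (\<xi> (j, False))) = 0"
  shows "limit_lempert z \<le> ereal (\<Sum>l\<in>labels. ln (cmod (\<xi> l)))"
proof (rule ereal_le_epsilon2)
  fix e :: real assume e: "e > 0"
  \<comment> \<open>The origin is included so that the perturbed disc keeps its value at 0.\<close>
  define X where "X = insert 0 (\<xi> ` {l \<in> labels. cmod (\<xi> l) < 1})"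
  have finX: "finite X" using finite_labels by (simp add: X_def)
  have X1: "cmod x < 1" if "x \<in> X" for x using that by (auto simp: X_def)
  \<comment> \<open>The total multiplicity over each of the N poles is at most 2, hence the budget 2
    N for the dilation.\<close>
  obtain r where r: "0 < r" "r < 1" "\<And>x. x \<in> X \<Longrightarrow> cmod x < r" "real (2 * N) * - ln r < e"
    using exists_dilation_factor[where k = "2 * N" and x = cmod, OF finX X1 e] by metis
  define L where "L = - ln r"
  have L: "L > 0" using r by (simp add: L_def)
  \<comment> \<open>The poles whose two nodes must both be transversal. The last condition fails
    exactly when v spans the whole space, where transversality is impossible.\<close>
  define PS where "PS = {j \<in> {M<..N}. cmod (\<xi> (j, False)) < 1 \<and> cmod (\<xi> (j, True)) < 1 \<and>
      \<xi> (j, True) \<noteq> \<xi> (j, False) \<and> (\<exists>w. cproj (v j) w \<noteq> 0)}"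
  define w where "w j = (SOME w. cproj (v j) w \<noteq> 0)" for j
  have w: "cproj (v j) (w j) \<noteq> 0" if "j \<in> PS" for j
    unfolding w_def by (rule someI_ex) (use that in \<open>auto simp: PS_def\<close>)
  define jj where "jj \<alpha> = inv_into {1..N} a0 (\<phi> \<alpha>)" for \<alpha>
  have jj: "jj (\<xi> l) = fst l" if "l \<in> labels" "cmod (\<xi> l) < 1" for l
    unfolding jj_def \<xi>(2)[OF that] using fst_labels[OF that(1)] a0_inj by (rule inv_into_f_f[rotated])
  \<comment> \<open>The derivative is pushed off v only where it is tangent. Where u = 0 it is
    merely rescaled, so transversal nodes stay transversal, and colliding nodes, which do not belong
    to \<open>PS\<close>, stay tangent.\<close>
  define u where "u \<alpha> = (if jj \<alpha> \<in> PS \<and> cproj (v (jj \<alpha>)) (vderiv \<phi> \<alpha>) = 0 then w (jj \<alpha>) else 0)" for \<alpha>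
  obtain \<psi> \<eta> where \<psi>: "\<psi> \<in> HolD \<Omega>" "\<eta> \<noteq> 0" "\<And>x. x \<in> X \<Longrightarrow> \<psi> (x / of_real r) = \<phi> x"
    "\<And>x. x \<in> X \<Longrightarrow> vderiv \<psi> (x / of_real r) = of_real r *s vderiv \<phi> x + \<eta> *s u x"
    using HolD_perturb_derivative[OF open_dom \<phi>(1) r(1,2) finX r(3), of u] by blast
  define \<alpha> where "\<alpha> l = \<xi> l / of_real r" for l
  define \<mu> where "\<mu> l = ln (cmod (\<xi> l)) + L" for l
  have X_in: "\<xi> l \<in> X" if "l \<in> labels" "cmod (\<xi> l) < 1" for l
    using that by (auto simp: X_def)
  have \<alpha>_in: "\<alpha> l \<in> ball 0 1" if "l \<in> labels" "cmod (\<xi> l) < 1" for l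
    using r(3)[OF X_in[OF that]] r(1) by (simp add: \<alpha>_def norm_divide)
  have \<alpha>_hit: "\<psi> (\<alpha> l) = a0 (fst l)" if "l \<in> labels" "cmod (\<xi> l) < 1" for l
    using \<psi>(3)[OF X_in[OF that]] \<xi>(2)[OF that] by (simp add: \<alpha>_def)
  have \<xi>_nz: "\<xi> l \<noteq> 0" if "l \<in> labels" for l
    using \<xi>(2)[OF that] fst_labels[OF that] z \<phi>(2) by force
  have elog_\<alpha>: "elog (cmod (\<alpha> l)) = ereal (\<mu> l)" if "l \<in> labels" for l
    using \<xi>_nz[OF that] r(1) by (simp add: \<alpha>_def \<mu>_def L_def norm_divide elog_pos ln_div)
  have \<mu>_neg: "\<mu> l \<le> 0" if "l \<in> labels" "cmod (\<xi> l) < 1" for l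
  proof -
    have "ereal (\<mu> l) \<le> 0"
      unfolding elog_\<alpha>[OF that(1), symmetric] using \<alpha>_in[OF that] by (intro elog_nonpos) auto
    then show ?thesis by simp
  qed
  have cp: "cproj (v j) (vderiv \<psi> (\<alpha> l)) =
      of_real r *s cproj (v j) (vderiv \<phi> (\<xi> l)) + \<eta> *s cproj (v j) (u (\<xi> l))" if "l \<in> labels" "cmod (\<xi> l) < 1" for j l
    unfolding \<alpha>_def \<psi>(4)[OF X_in[OF that]] by (simp only: cproj_add cproj_smult)
  define T where "T j = ln (cmod (\<xi> (j, False))) + (if M < j then ln (cmod (\<xi> (j, True))) else 0)" for j
  \<comment> \<open>Here t is the value to be reached over pole j, and 2 L covers the dilation for
    multiplicity up to 2. Any multiplicity suffices if one logarithm is already below t; otherwise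
    multiplicity 2 must supply the second logarithm.\<close>
  have single: "\<exists>A. finite A \<and> A \<subseteq> ball 0 1 \<and> A \<subseteq> \<psi> -` {a0 j} \<and> (\<Sum>\<alpha>\<in>A. weight \<psi> j \<alpha>) \<le> mass j \<and>
      (\<Sum>\<alpha>\<in>A. weight \<psi> j \<alpha> * elog (cmod \<alpha>)) \<le> ereal (t + 2 * L)"
    if j: "j \<in> {1..N}" and l: "l \<in> labels" "fst l = j" "cmod (\<xi> l) < 1"
      and t: "ln (cmod (\<xi> l)) \<le> t \<or> (weight \<psi> j (\<alpha> l) = 2 \<and> 2 * ln (cmod (\<xi> l)) \<le> t)" for j l t
  proof (intro exI[of _ "{\<alpha> l}"] conjI)
    have h: "\<psi> (\<alpha> l) = a0 j" using \<alpha>_hit[OF l(1,3)] l(2) by simp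
    note facts = \<psi>(1) j \<alpha>_in[OF l(1,3)] h
    define m where "m = real_of_ereal (weight \<psi> j (\<alpha> l))"
    have m: "weight \<psi> j (\<alpha> l) = ereal m" "1 \<le> m"
      using weight_real[OF facts] weight_real_bounds(1)[OF facts] by (simp_all add: m_def)
    have "m * \<mu> l \<le> t + 2 * L"
    proof (cases "ln (cmod (\<xi> l)) \<le> t")
      case True
      have "m * \<mu> l \<le> 1 * \<mu> l" using m(2) \<mu>_neg[OF l(1,3)] by (rule mult_right_mono_neg)
      then show ?thesis using True L by (simp add: \<mu>_def)
    next
      case False
      then have "m = 2" using t m(1) by (simp add: numeral_eq_ereal)
      then show ?thesis using False t by (simp add: \<mu>_def)
    qed
    then show "(\<Sum>\<alpha>\<in>{\<alpha> l}. weight \<psi> j \<alpha> * elog (cmod \<alpha>)) \<le> ereal (t + 2 * L)"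
      by (simp add: m(1) elog_\<alpha>[OF l(1)])
    show "(\<Sum>\<alpha>\<in>{\<alpha> l}. weight \<psi> j \<alpha>) \<le> mass j"
      using weight_le_mass[OF facts] by simp
    show "{\<alpha> l} \<subseteq> \<psi> -` {a0 j}" using h by simp
  qed (use \<alpha>_in[OF l(1,3)] in auto)
  have "\<exists>A. finite A \<and> A \<subseteq> ball 0 1 \<and> A \<subseteq> \<psi> -` {a0 j} \<and> (\<Sum>\<alpha>\<in>A. weight \<psi> j \<alpha>) \<le> mass j \<and>
      (\<Sum>\<alpha>\<in>A. weight \<psi> j \<alpha> * elog (cmod \<alpha>)) \<le> ereal (T j + 2 * L)" if j: "j \<in> {1..N}" for j
  proof -
    let ?f = "(j, False)" and ?t = "(j, True)"
    have f: "?f \<in> labels" using j by (auto simp: labels_def)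
    have tl: "?t \<in> labels" if "M < j" using that j by (auto simp: labels_def)
    have ln1: "ln (cmod (\<xi> l)) = 0" if "l \<in> labels" "\<not> cmod (\<xi> l) < 1" for l
      using \<xi>(1)[OF that(1)] that(2) by (simp add: not_less)
    consider (none) "\<not> cmod (\<xi> ?f) < 1" "M < j \<longrightarrow> \<not> cmod (\<xi> ?t) < 1"
      | (one_f) "cmod (\<xi> ?f) < 1" "M < j \<longrightarrow> \<not> cmod (\<xi> ?t) < 1"
      | (one_t) "\<not> cmod (\<xi> ?f) < 1" "M < j" "cmod (\<xi> ?t) < 1"
      | (same) "cmod (\<xi> ?f) < 1" "M < j" "\<xi> ?t = \<xi> ?f"
      | (pair) "cmod (\<xi> ?f) < 1" "M < j" "cmod (\<xi> ?t) < 1" "\<xi> ?t \<noteq> \<xi> ?f" "j \<in> PS"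
      | (line) "cmod (\<xi> ?f) < 1" "M < j" "cmod (\<xi> ?t) < 1" "\<xi> ?t \<noteq> \<xi> ?f" "\<And>w. cproj (v j) w = 0"
      using j by (auto simp: PS_def)
    then show ?thesis
    proof cases
      case none
      then have "T j = 0" using ln1 f tl by (simp add: T_def)
      then show ?thesis using L by (intro exI[of _ "{}"]) (simp add: mass_def)
    next
      case one_f
      then have "T j = ln (cmod (\<xi> ?f))" using ln1 tl by (simp add: T_def)
      then show ?thesis using one_f f by (intro single[OF j, of ?f]) auto
    next
      case one_t
      then have "T j = ln (cmod (\<xi> ?t))" using ln1 f by (simp add: T_def)
      then show ?thesis using one_t tl by (intro single[OF j, of ?t]) auto
    next
      case same
      \<comment> \<open>Two colliding nodes become one node of multiplicity 2: tangency comes from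
        the collision hypothesis and survives the perturbation because u vanishes there.\<close>
      have "j \<notin> PS" using same by (simp add: PS_def)
      then have "u (\<xi> ?f) = 0" using jj[OF f same(1)] by (simp add: u_def)
      moreover have "cproj (v j) (vderiv \<phi> (\<xi> ?f)) = 0"
        using collide[of j] same j by auto
      ultimately have "cproj (v j) (vderiv \<psi> (\<alpha> ?f)) = 0"
        using cp[OF f same(1), of j] by (simp add: cproj_def cdot_def)
      then have "weight \<psi> j (\<alpha> ?f) = 2"
        using weight_tangent[OF \<psi>(1) j \<alpha>_in[OF f same(1)]] \<alpha>_hit[OF f same(1)] same(2) by simp
      then show ?thesis using same f by (intro single[OF j, of ?f]) (auto simp: T_def)
    next
      case pair
      note t = tl[OF pair(2)]
      have tr: "weight \<psi> j (\<alpha> l) = 1" if l: "l \<in> labels" "fst l = j" "cmod (\<xi> l) < 1" for l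
      proof -
        have jl: "jj (\<xi> l) = j" using jj l by simp
        have "cproj (v j) (vderiv \<psi> (\<alpha> l)) \<noteq> 0"
        proof (cases "cproj (v j) (vderiv \<phi> (\<xi> l)) = 0")
          case True
          then have "cproj (v j) (vderiv \<psi> (\<alpha> l)) = \<eta> *s cproj (v j) (w j)"
            using cp[OF l(1,3), of j] pair(5) jl by (simp add: u_def)
          then show ?thesis using \<psi>(2) w[OF pair(5)] by (simp add: vec_eq_iff)
        next
          case False
          then have "u (\<xi> l) = 0" using jl by (simp add: u_def)
          then have "cproj (v j) (vderiv \<psi> (\<alpha> l)) = of_real r *s cproj (v j) (vderiv \<phi> (\<xi> l))"
            using cp[OF l(1,3), of j] by (simp add: cproj_def[of _ 0] cdot_def)
          then show ?thesis using False r(1) by (simp add: vec_eq_iff)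
        qed
        then show ?thesis
          using weight_transversal[OF \<psi>(1) j \<alpha>_in[OF l(1,3)]] \<alpha>_hit[OF l(1,3)] l(2) pair(2) by simp
      qed
      have ne: "\<alpha> ?f \<noteq> \<alpha> ?t" using pair(4) r(1) by (simp add: \<alpha>_def)
      show ?thesis
      proof (intro exI[of _ "{\<alpha> ?f, \<alpha> ?t}"] conjI)
        show "(\<Sum>\<alpha>\<in>{\<alpha> ?f, \<alpha> ?t}. weight \<psi> j \<alpha>) \<le> mass j"
          using ne tr[of ?f] tr[of ?t] f t pair by (simp add: mass_def one_ereal_def numeral_eq_ereal)
        show "(\<Sum>\<alpha>\<in>{\<alpha> ?f, \<alpha> ?t}. weight \<psi> j \<alpha> * elog (cmod \<alpha>)) \<le> ereal (T j + 2 * L)"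
          using ne tr[of ?f] tr[of ?t] f t pair elog_\<alpha>[OF f] elog_\<alpha>[OF t]
          by (simp add: T_def \<mu>_def)
      qed (use \<alpha>_in \<alpha>_hit f t pair in auto)
    next
      case line
      note t = tl[OF line(2)]
      \<comment> \<open>Every derivative is parallel to v here, so both nodes have multiplicity 2
        and only one fits. Twice the smaller logarithm is at most the sum of the two.\<close>
      define l where "l = (if cmod (\<xi> ?f) \<le> cmod (\<xi> ?t) then ?f else ?t)"
      have l: "l \<in> labels" "fst l = j" "cmod (\<xi> l) < 1" "cmod (\<xi> l) \<le> cmod (\<xi> ?f)" "cmod (\<xi> l) \<le> cmod (\<xi> ?t)"
        using f t line by (auto simp: l_def)
      have "weight \<psi> j (\<alpha> l) = 2"
        using weight_tangent[OF \<psi>(1) j \<alpha>_in[OF l(1,3)]] \<alpha>_hit[OF l(1,3)] l(2) line(2,5) by simp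
      moreover have "ln (cmod (\<xi> l)) \<le> ln (cmod (\<xi> ?f))" "ln (cmod (\<xi> l)) \<le> ln (cmod (\<xi> ?t))"
        using l \<xi>_nz[OF l(1)] by (auto intro!: ln_mono)
      ultimately show ?thesis using line l by (intro single[OF j, of l]) (auto simp: T_def)
    qed
  qed
  then have "\<forall>j\<in>{1..N}. \<exists>A. finite A \<and> A \<subseteq> ball 0 1 \<and> A \<subseteq> \<psi> -` {a0 j} \<and>
      (\<Sum>\<alpha>\<in>A. weight \<psi> j \<alpha>) \<le> mass j \<and>
      (\<Sum>\<alpha>\<in>A. weight \<psi> j \<alpha> * elog (cmod \<alpha>)) \<le> ereal (T j + 2 * L)" by (rule ballI)
  from bchoice[OF this]
  obtain A where A: "\<And>j. j \<in> {1..N} \<Longrightarrow> finite (A j) \<and> A j \<subseteq> ball 0 1 \<and> A j \<subseteq> \<psi> -` {a0 j} \<and>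
      (\<Sum>\<alpha>\<in>A j. weight \<psi> j \<alpha>) \<le> mass j"
      "\<And>j. j \<in> {1..N} \<Longrightarrow> (\<Sum>\<alpha>\<in>A j. weight \<psi> j \<alpha> * elog (cmod \<alpha>)) \<le> ereal (T j + 2 * L)"
    by blast
  have "\<psi> 0 = z" using \<psi>(3)[of 0] \<phi>(2) by (simp add: X_def)
  then have "limit_lempert z \<le> (\<Sum>j\<in>{1..N}. \<Sum>\<alpha>\<in>A j. weight \<psi> j \<alpha> * elog (cmod \<alpha>))"
    unfolding gen_lempert_def using \<psi>(1) A(1) by (intro Inf_lower) blast
  also have "\<dots> \<le> (\<Sum>j\<in>{1..N}. ereal (T j + 2 * L))"
    by (intro sum_mono A(2))
  also have "\<dots> = ereal ((\<Sum>j\<in>{1..N}. T j) + real (2 * N) * L)"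
    by (simp add: sum.distrib algebra_simps)
  also have "(\<Sum>j\<in>{1..N}. T j) = (\<Sum>l\<in>labels. ln (cmod (\<xi> l)))"
  proof -
    have "(\<Sum>j\<in>{1..N}. if M < j then ln (cmod (\<xi> (j, True))) else 0) = (\<Sum>j\<in>{M<..N}. ln (cmod (\<xi> (j, True))))"
      by (intro sum.mono_neutral_cong_right) auto
    moreover have "(\<Sum>l\<in>labels. ln (cmod (\<xi> l))) =
        (\<Sum>l\<in>{1..N} \<times> {False}. ln (cmod (\<xi> l))) + (\<Sum>l\<in>{M<..N} \<times> {True}. ln (cmod (\<xi> l)))"
      unfolding labels_def by (intro sum.union_disjoint) auto
    ultimately show ?thesis
      by (simp add: T_def sum.distrib sum.cartesian_product' flip: sum.cartesian_product)
  qed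
  also have "ereal ((\<Sum>l\<in>labels. ln (cmod (\<xi> l))) + real (2 * N) * L) \<le>
      ereal (\<Sum>l\<in>labels. ln (cmod (\<xi> l))) + ereal e"
    using r(4) by (simp add: L_def)
  finally show "limit_lempert z \<le> ereal (\<Sum>l\<in>labels. ln (cmod (\<xi> l))) + ereal e" .
qed

text \<open>Boundedness of \<Omega> makes the chosen discs a normal family, and their nodes lie in a
  compact disc. The limit data satisfy the hypotheses of \<open>limit_lempert_le\<close>, and the
  sums of logarithms pass to the limit.\<close>

lemma limit_lempert_le_of_sequence:
  assumes z: "z \<in> \<Omega>" "z \<notin> a0 ` {1..N}"
    and q: "\<And>l. l \<in> labels \<Longrightarrow> (\<lambda>n. q n l) \<longlonglongrightarrow> a0 (fst l)"
    and inj: "\<And>n. inj_on (q n) labels"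
    and dir: "\<And>j. j \<in> {M<..N} \<Longrightarrow> (\<lambda>n. proj_dist (q n (j, True) - q n (j, False)) (v j)) \<longlonglongrightarrow> 0"
    and less: "\<And>n. coman_lempert \<Omega> (q n ` labels) z < ereal C"
  shows "limit_lempert z \<le> ereal C"
proof -
  have "\<exists>\<phi> x. \<phi> \<in> HolD \<Omega> \<and> \<phi> 0 = z \<and> (\<forall>l\<in>labels. x l \<in> ball 0 1 \<and> \<phi> (x l) = q n l) \<and>
      (\<Sum>l\<in>labels. elog (cmod (x l))) < ereal C" for n
  proof -
    obtain \<phi> \<zeta> where \<phi>: "\<phi> \<in> HolD \<Omega>" "\<phi> 0 = z" "\<forall>b\<in>q n ` labels. \<zeta> b \<in> ball 0 1 \<and> \<phi> (\<zeta> b) = b"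
        "(\<Sum>b\<in>q n ` labels. elog (cmod (\<zeta> b))) < ereal C"
      using less[of n] unfolding coman_lempert_def Inf_less_iff by blast
    then show ?thesis
      by (intro exI[of _ \<phi>] exI[of _ "\<lambda>l. \<zeta> (q n l)"]) (auto simp: sum.reindex[OF inj])
  qed
  then obtain f y where fy: "\<And>n. f n \<in> HolD \<Omega>" "\<And>n. f n 0 = z"
      "\<And>n l. l \<in> labels \<Longrightarrow> y n l \<in> ball 0 1 \<and> f n (y n l) = q n l"
      "\<And>n. (\<Sum>l\<in>labels. elog (cmod (y n l))) < ereal C"
    by metis
  obtain B where B0: "\<And>x. x \<in> \<Omega> \<Longrightarrow> norm x \<le> B"
    using bounded_dom bounded_iff by blast
  have B: "norm (f n \<zeta>) \<le> B" if "\<zeta> \<in> ball 0 1" for n \<zeta>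
    using fy(1)[of n] that unfolding HolD_iff by (intro B0) blast
  have f_vholo: "vholo (f n) (ball 0 1)" for n
    using fy(1) by (auto simp: HolD_iff)
  obtain r1 \<phi> where r1: "strict_mono r1" "vholo \<phi> (ball 0 1)" "locally_tends (\<lambda>n. f (r1 n)) \<phi>"
    by (rule vector_Montel[of f B, OF f_vholo B])
  have "\<exists>r2. strict_mono r2 \<and> (\<forall>l\<in>labels. \<exists>\<xi>\<in>cball 0 1. (\<lambda>n. y (r1 (r2 n)) l) \<longlonglongrightarrow> \<xi>)"
  proof (rule finite_common_subseq[OF finite_labels])
    fix l and s :: "nat \<Rightarrow> nat" assume l: "l \<in> labels"
    have "\<forall>n. y (r1 (s n)) l \<in> cball 0 1" using fy(3)[OF l] by (auto intro: less_imp_le)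
    then obtain \<xi> r where "\<xi> \<in> cball 0 1" "strict_mono r" "((\<lambda>n. y (r1 (s n)) l) \<circ> r) \<longlonglongrightarrow> \<xi>"
      using compact_cball[of "0::complex" 1] unfolding compact_def by metis
    then show "\<exists>r. strict_mono r \<and> (\<exists>\<xi>\<in>cball 0 1. (\<lambda>n. y (r1 ((s \<circ> r) n)) l) \<longlonglongrightarrow> \<xi>)"
      unfolding o_def by (intro exI[of _ r] conjI bexI[of _ \<xi>])
  next
    fix l and s r :: "nat \<Rightarrow> nat"
    assume "\<exists>\<xi>\<in>cball 0 1. (\<lambda>n. y (r1 (s n)) l) \<longlonglongrightarrow> \<xi>" "strict_mono r"
    then show "\<exists>\<xi>\<in>cball 0 1. (\<lambda>n. y (r1 ((s \<circ> r) n)) l) \<longlonglongrightarrow> \<xi>"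
      using LIMSEQ_subseq_LIMSEQ by (fastforce simp: o_def)
  qed
  then obtain r2 where r2: "strict_mono r2"
    and "\<forall>l\<in>labels. \<exists>\<xi>. \<xi> \<in> cball 0 1 \<and> (\<lambda>n. y (r1 (r2 n)) l) \<longlonglongrightarrow> \<xi>" by blast
  then obtain \<xi> where \<xi>: "\<And>l. l \<in> labels \<Longrightarrow> \<xi> l \<in> cball 0 1" "\<And>l. l \<in> labels \<Longrightarrow> (\<lambda>n. y (r1 (r2 n)) l) \<longlonglongrightarrow> \<xi> l"
    by metis
  define r where "r n = r1 (r2 n)" for n
  have r: "strict_mono r"
    using strict_mono_o[OF r1(1) r2] by (simp add: r_def[abs_def] o_def)
  have lt: "locally_tends (\<lambda>n. f (r n)) \<phi>"
    using locally_tends_subseq[OF r1(3) r2] by (simp add: r_def)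
  have y_lim: "(\<lambda>n. y (r n) l) \<longlonglongrightarrow> \<xi> l" if "l \<in> labels" for l
    using \<xi>(2)[OF that] by (simp add: r_def)
  have q_lim: "(\<lambda>n. q (r n) l) \<longlonglongrightarrow> a0 (fst l)" if "l \<in> labels" for l
    using LIMSEQ_subseq_LIMSEQ[OF q[OF that] r] by (simp add: o_def)
  have pw: "(\<lambda>n. f (r n) \<zeta>) \<longlonglongrightarrow> \<phi> \<zeta>" if "\<zeta> \<in> ball 0 1" for \<zeta>
    using locally_tends_moving[OF lt r1(2) tendsto_const that] .
  have \<phi>0: "\<phi> 0 = z"
    using pw[of 0] fy(2) by (simp add: LIMSEQ_const_iff)
  have \<phi>: "\<phi> \<in> HolD \<Omega>"
  proof (rule HolD_closure[OF open_dom convex_dom r1(2)])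
    show "\<phi> 0 \<in> \<Omega>" using \<phi>0 z by simp
    show "\<phi> \<zeta> \<in> closure \<Omega>" if "\<zeta> \<in> ball 0 1" for \<zeta>
    proof -
      have "\<forall>n. f (r n) \<zeta> \<in> \<Omega>"
        using fy(1) that unfolding HolD_iff by blast
      with pw[OF that] show ?thesis
        unfolding closure_sequential by (intro exI[of _ "\<lambda>n. f (r n) \<zeta>"]) simp
    qed
  qed
  have hit: "\<phi> (\<xi> l) = a0 (fst l)" if l: "l \<in> labels" "cmod (\<xi> l) < 1" for l
  proof -
    have "(\<lambda>n. f (r n) (y (r n) l)) \<longlonglongrightarrow> \<phi> (\<xi> l)"
      using locally_tends_moving[OF lt r1(2) y_lim[OF l(1)]] l(2) by simp
    then have "(\<lambda>n. q (r n) l) \<longlonglongrightarrow> \<phi> (\<xi> l)"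
      using fy(3)[OF l(1)] by simp
    then show ?thesis using q_lim[OF l(1)] LIMSEQ_unique by blast
  qed
  \<comment> \<open>The value \<phi> 0 = z is not a limit pole. Hence the logarithm is continuous at
    every limit node.\<close>
  have nz: "\<xi> l \<noteq> 0" if "l \<in> labels" for l
    using hit[OF that] \<phi>0 z(2) fst_labels[OF that] by force
  have "limit_lempert z \<le> ereal (\<Sum>l\<in>labels. ln (cmod (\<xi> l)))"
  proof (rule limit_lempert_le[OF \<phi> \<phi>0 z(2)])
    show "cmod (\<xi> l) \<le> 1" if "l \<in> labels" for l using \<xi>(1)[OF that] by simp
    show "\<phi> (\<xi> l) = a0 (fst l)" if "l \<in> labels" "cmod (\<xi> l) < 1" for l by (rule hit[OF that])
    fix j assume j: "j \<in> {M<..N}" and eq: "\<xi> (j, True) = \<xi> (j, False)" and in1: "cmod (\<xi> (j, False)) < 1"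
    let ?f = "(j, False)" and ?t = "(j, True)"
    have ft: "?f \<in> labels" "?t \<in> labels" using j by (auto simp: labels_def)
    have y_ne: "y (r n) ?f \<noteq> y (r n) ?t" for n
      using fy(3)[OF ft(1), of "r n"] fy(3)[OF ft(2), of "r n"] inj_onD[OF inj[of "r n"] _ ft] by auto
    \<comment> \<open>The quotient converges to the derivative at the common node. Its transversal
      part is its norm times the sine of the angle between the pole difference and v, because
      scaling does not change that angle; this product tends to 0.\<close>
    define d where "d n = (1 / (y (r n) ?t - y (r n) ?f)) *s (q (r n) ?t - q (r n) ?f)" for n
    have "d \<longlonglongrightarrow> vderiv \<phi> (\<xi> ?f)"
      using locally_tends_diffquot[OF lt r1(2) f_vholo y_lim[OF ft(1)] y_lim[OF ft(2), unfolded eq] y_ne] in1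
        fy(3)[OF ft(1)] fy(3)[OF ft(2)] by (simp add: d_def[abs_def])
    then have "(\<lambda>n. norm (d n) * proj_dist (q (r n) ?t - q (r n) ?f) (v j)) \<longlonglongrightarrow> norm (vderiv \<phi> (\<xi> ?f)) * 0"
      using LIMSEQ_subseq_LIMSEQ[OF dir[OF j] r] by (intro tendsto_intros) (simp_all add: o_def)
    moreover have "norm (cproj (v j) (d n)) = norm (d n) * proj_dist (q (r n) ?t - q (r n) ?f) (v j)" for n
      unfolding d_def cproj_smult norm_vector_smult norm_cproj_eq_proj_dist[OF v_norm[OF j]] by simp
    moreover have "(\<lambda>n. norm (cproj (v j) (d n))) \<longlonglongrightarrow> norm (cproj (v j) (vderiv \<phi> (\<xi> ?f)))"
      using \<open>d \<longlonglongrightarrow> _\<close> by (intro tendsto_intros)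
    ultimately show "cproj (v j) (vderiv \<phi> (\<xi> ?f)) = 0"
      using LIMSEQ_unique by fastforce
  qed
  also have "(\<Sum>l\<in>labels. ln (cmod (\<xi> l))) \<le> C"
  proof (rule tendsto_upperbound)
    show "(\<lambda>n. \<Sum>l\<in>labels. ln (cmod (y (r n) l))) \<longlonglongrightarrow> (\<Sum>l\<in>labels. ln (cmod (\<xi> l)))"
      using nz y_lim by (intro tendsto_intros) auto
    have "\<forall>\<^sub>F n in sequentially. \<forall>l\<in>labels. y (r n) l \<noteq> 0"
      by (intro eventually_ball_finite ballI finite_labels tendsto_imp_eventually_ne[OF y_lim nz])
    then show "\<forall>\<^sub>F n in sequentially. (\<Sum>l\<in>labels. ln (cmod (y (r n) l))) \<le> C"
    proof eventually_elim
      case (elim n)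
      then have "(\<Sum>l\<in>labels. elog (cmod (y (r n) l))) = ereal (\<Sum>l\<in>labels. ln (cmod (y (r n) l)))"
        by (simp add: elog_pos)
      then show ?case using fy(4)[of "r n"] by simp
    qed
  qed simp
  finally show ?thesis by simp
qed

text \<open>Upper and lower bounds are proved separately through order neighbourhoods of the limit.
  The real number C strictly in between handles infinite values and gives the strict inequalities
  needed to pick discs from an infimum.\<close>

lemma coman_lempert_tendsto:
  fixes q :: "complex \<Rightarrow> nat \<times> bool \<Rightarrow> complex ^ 'n"
  assumes z: "z \<in> \<Omega>"
    and q: "\<And>l. l \<in> labels \<Longrightarrow> ((\<lambda>\<epsilon>. q \<epsilon> l) \<longlongrightarrow> a0 (fst l)) (at 0)"
    and ins: "\<forall>\<^sub>F \<epsilon> in at 0. inj_on (q \<epsilon>) labels \<and> q \<epsilon> ` labels \<subseteq> \<Omega>"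
    and dir: "\<And>j. j \<in> {M<..N} \<Longrightarrow>
      ((\<lambda>\<epsilon>. proj_dist (q \<epsilon> (j, True) - q \<epsilon> (j, False)) (v j)) \<longlongrightarrow> 0) (at 0)"
  shows "((\<lambda>\<epsilon>. coman_lempert \<Omega> (q \<epsilon> ` labels) z) \<longlongrightarrow> limit_lempert z) (at 0)"
proof (cases "z \<in> a0 ` {1..N}")
  case True
  have "\<forall>\<^sub>F \<epsilon> in at 0. q \<epsilon> ` labels \<subseteq> \<Omega>"
    using ins by eventually_elim simp
  then show ?thesis
    unfolding limit_lempert_pole[OF True] tendsto_MInfty
    using coman_lempert_pole[OF True q] by blast
next
  case False
  show ?thesis
  proof (rule order_tendstoI)
    fix c assume "limit_lempert z < c"
    then obtain C where C: "limit_lempert z < ereal C" "ereal C < c"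
      using ereal_dense2 by blast
    have "\<forall>\<^sub>F \<epsilon> in at 0. coman_lempert \<Omega> (q \<epsilon> ` labels) z < ereal C"
      by (rule coman_lempert_upper[where q = q, OF False q ins dir C(1)])
    then show "\<forall>\<^sub>F \<epsilon> in at 0. coman_lempert \<Omega> (q \<epsilon> ` labels) z < c"
      by eventually_elim (use C(2) in \<open>auto intro: less_trans\<close>)
  next
    fix c assume "c < limit_lempert z"
    then obtain C where C: "c < ereal C" "ereal C < limit_lempert z"
      using ereal_dense2 by blast
    \<comment> \<open>Injectivity is placed inside the claim so that every term of a sequence of
      counterexamples has it.\<close>
    have "\<forall>\<^sub>F \<epsilon> in at 0. inj_on (q \<epsilon>) labels \<longrightarrow> c < coman_lempert \<Omega> (q \<epsilon> ` labels) z"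
    proof (rule sequentially_imp_eventually_at, intro allI impI)
      fix f :: "nat \<Rightarrow> complex"
      assume f: "(\<forall>n. f n \<noteq> 0) \<and> f \<longlonglongrightarrow> 0"
      show "\<forall>\<^sub>F n in sequentially. inj_on (q (f n)) labels \<longrightarrow> c < coman_lempert \<Omega> (q (f n) ` labels) z"
      proof (rule ccontr)
        assume "\<not> ?thesis"
        then have "\<exists>s :: nat \<Rightarrow> nat. strict_mono s \<and> (\<forall>n. inj_on (q (f (s n))) labels \<and>
            coman_lempert \<Omega> (q (f (s n)) ` labels) z \<le> c)"
          using not_eventually_sequentiallyD[of "\<lambda>n. inj_on (q (f n)) labels \<longrightarrow>
            c < coman_lempert \<Omega> (q (f n) ` labels) z"] by (simp add: not_less)
        then obtain s :: "nat \<Rightarrow> nat" where s: "strict_mono s" "\<And>n. inj_on (q (f (s n))) labels"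
            "\<And>n. coman_lempert \<Omega> (q (f (s n)) ` labels) z \<le> c"
          by blast
        have "(\<lambda>n. f (s n)) \<longlonglongrightarrow> 0"
          using f LIMSEQ_subseq_LIMSEQ s(1) by (fastforce simp: o_def)
        then have lim: "filterlim (\<lambda>n. f (s n)) (at 0) sequentially"
          using f by (simp add: filterlim_at)
        have "limit_lempert z \<le> ereal C"
        proof (rule limit_lempert_le_of_sequence[OF z False, where q = "\<lambda>n. q (f (s n))"])
          show "(\<lambda>n. q (f (s n)) l) \<longlonglongrightarrow> a0 (fst l)" if "l \<in> labels" for l
            using filterlim_compose[OF q[OF that] lim] .
          show "(\<lambda>n. proj_dist (q (f (s n)) (j, True) - q (f (s n)) (j, False)) (v j)) \<longlonglongrightarrow> 0"
            if "j \<in> {M<..N}" for j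
            using filterlim_compose[OF dir[OF that] lim] .
          show "coman_lempert \<Omega> (q (f (s n)) ` labels) z < ereal C" for n
            using s(3) C(1) by (rule le_less_trans)
        qed (rule s(2))
        then show False using C(2) by simp
      qed
    qed
    with ins show "\<forall>\<^sub>F \<epsilon> in at 0. c < coman_lempert \<Omega> (q \<epsilon> ` labels) z"
      by eventually_elim simp
  qed
qed

end

theorem theorem3p3:
  fixes \<Omega> :: "(complex ^ 'n::finite) set"
    and M N :: nat
    and a a' a'' :: "nat \<Rightarrow> complex \<Rightarrow> complex ^ 'n"
    and a0 v :: "nat \<Rightarrow> complex ^ 'n"
    and S :: "complex \<Rightarrow> (complex ^ 'n) set"
  assumes dom: "open \<Omega>" "connected \<Omega>" "bounded \<Omega>" "convex \<Omega>"
    and MN: "M \<le> N"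
    and S_def: "\<And>\<epsilon>. S \<epsilon> = (\<lambda>j. a j \<epsilon>) ` {1..M} \<union> (\<lambda>j. a' j \<epsilon>) ` {M<..N}
                          \<union> (\<lambda>j. a'' j \<epsilon>) ` {M<..N}"
    and distinct: "\<forall>\<^sub>F \<epsilon> in at 0. card (S \<epsilon>) = M + 2 * (N - M)"
    and inside: "\<forall>\<^sub>F \<epsilon> in at 0. S \<epsilon> \<subseteq> \<Omega>"
    and lim1: "\<And>j. j \<in> {1..M} \<Longrightarrow> ((\<lambda>\<epsilon>. a j \<epsilon>) \<longlongrightarrow> a0 j) (at 0)"
    and lim2: "\<And>j. j \<in> {M<..N} \<Longrightarrow> ((\<lambda>\<epsilon>. a' j \<epsilon>) \<longlongrightarrow> a0 j) (at 0)"
    and lim3: "\<And>j. j \<in> {M<..N} \<Longrightarrow> ((\<lambda>\<epsilon>. a'' j \<epsilon>) \<longlongrightarrow> a0 j) (at 0)"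
    and a0_in: "a0 ` {1..N} \<subseteq> \<Omega>"
    and a0_inj: "inj_on a0 {1..N}"
    and v_norm: "\<And>j. j \<in> {M<..N} \<Longrightarrow> norm (v j) = 1"
    and dir: "\<And>j. j \<in> {M<..N} \<Longrightarrow>
               ((\<lambda>\<epsilon>. proj_dist (a'' j \<epsilon> - a' j \<epsilon>) (v j)) \<longlongrightarrow> 0) (at 0)"
  shows "\<forall>z\<in>\<Omega>.
     ((\<lambda>\<epsilon>. coman_lempert \<Omega> (S \<epsilon>) z) \<longlongrightarrow>
        gen_lempert \<Omega> {1..N} a0 (\<lambda>j. if j \<le> M then Psi_pt else Psi_dir (v j))
                    (\<lambda>j. if j \<le> M then 1 else 2) z) (at 0) \<and>
     ((\<lambda>\<epsilon>. gen_lempert_pts \<Omega> (S \<epsilon>) z) \<longlongrightarrow>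
        gen_lempert \<Omega> {1..N} a0 (\<lambda>j. if j \<le> M then Psi_pt else Psi_dir (v j))
                    (\<lambda>j. if j \<le> M then 1 else 2) z) (at 0)"
proof
  fix z assume z: "z \<in> \<Omega>"
  interpret pole_system \<Omega> M N a0 v
    by unfold_locales (use dom MN a0_in a0_inj v_norm in auto)
  define q where "q \<epsilon> l = (if snd l then a'' (fst l) \<epsilon> else if fst l \<le> M then a (fst l) \<epsilon> else a' (fst l) \<epsilon>)"
    for \<epsilon> and l :: "nat \<times> bool"
  have "{1..N} = {1..M} \<union> {M<..N}" using MN by auto
  then have "labels = (\<lambda>j. (j, False)) ` ({1..M} \<union> {M<..N}) \<union> (\<lambda>j. (j, True)) ` {M<..N}"
    unfolding labels_def by auto
  then have S_eq: "S \<epsilon> = q \<epsilon> ` labels" for \<epsilon>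
    unfolding S_def by (simp only: image_Un image_image) (simp add: q_def)
  have card_labels: "card labels = M + 2 * (N - M)"
    unfolding labels_def using MN by (subst card_Un_disjoint) (auto simp: card_cartesian_product)
  \<comment> \<open>\<open>S \<epsilon>\<close> is the image of \<open>labels\<close> and has as
    many elements, which forces the labelling to be injective.\<close>
  have ins: "\<forall>\<^sub>F \<epsilon> in at 0. inj_on (q \<epsilon>) labels \<and> q \<epsilon> ` labels \<subseteq> \<Omega>"
    using distinct inside
    by eventually_elim (simp add: S_eq eq_card_imp_inj_on finite_labels card_labels)
  have q_lim: "((\<lambda>\<epsilon>. q \<epsilon> l) \<longlongrightarrow> a0 (fst l)) (at 0)" if "l \<in> labels" for l
    using that lim1[of "fst l"] lim2[of "fst l"] lim3[of "fst l"]
    by (cases "fst l \<le> M") (auto simp: labels_def q_def)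
  have dir': "((\<lambda>\<epsilon>. proj_dist (q \<epsilon> (j, True) - q \<epsilon> (j, False)) (v j)) \<longlongrightarrow> 0) (at 0)" if "j \<in> {M<..N}" for j
    using dir[OF that] that by (simp add: q_def)
  have coman: "((\<lambda>\<epsilon>. coman_lempert \<Omega> (S \<epsilon>) z) \<longlongrightarrow> limit_lempert z) (at 0)"
    unfolding S_eq by (rule coman_lempert_tendsto[where q = q, OF z q_lim ins dir'])
  have ev: "\<forall>\<^sub>F \<epsilon> in at 0. gen_lempert_pts \<Omega> (S \<epsilon>) z = coman_lempert \<Omega> (S \<epsilon>) z"
    using ins by eventually_elim
      (simp add: S_eq gen_lempert_pts_eq_coman_lempert open_dom convex_dom finite_labels)
  have "((\<lambda>\<epsilon>. gen_lempert_pts \<Omega> (S \<epsilon>) z) \<longlongrightarrow> limit_lempert z) (at 0)"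
    unfolding tendsto_cong[OF ev] by (rule coman)
  with coman show "((\<lambda>\<epsilon>. coman_lempert \<Omega> (S \<epsilon>) z) \<longlongrightarrow>
        gen_lempert \<Omega> {1..N} a0 (\<lambda>j. if j \<le> M then Psi_pt else Psi_dir (v j))
                    (\<lambda>j. if j \<le> M then 1 else 2) z) (at 0) \<and>
     ((\<lambda>\<epsilon>. gen_lempert_pts \<Omega> (S \<epsilon>) z) \<longlongrightarrow>
        gen_lempert \<Omega> {1..N} a0 (\<lambda>j. if j \<le> M then Psi_pt else Psi_dir (v j))
                    (\<lambda>j. if j \<le> M then 1 else 2) z) (at 0)"
    unfolding Psi_def[abs_def] mass_def[abs_def] by blast
qed

end
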